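(* Let $1\leq p<\infty$, $0<\alpha<d$ and $\beta\in\mathbb{R}$ with $0\leq\alpha+\beta+1<d/p$. Then there is a constant $C_{d,\alpha,\beta,p}$ depending only on $d,\alpha,\beta,p$ such that for all $f\in W^{1,p}(\mathbb{R}^d)$, \[ \|\mathrm{M}^{d}_{\alpha,\beta} f\|_{L^{(p^{-1}-(1+\alpha+\beta)/d)^{-1}}(\mathbb{R}^d)}\leq C_{d,\alpha,\beta,p}\|\nabla f\|_{L^p(\mathbb{R}^d)}. \] For $p=1$, the same holds for all $f\in\mathrm{BV}(\mathbb{R}^d)$ with $\|\nabla f\|_1$ replaced by $\operatorname{var} f$. The endpoint case $p=d/(1+\alpha+\beta)$ also holds, with left-hand side $\|\mathrm{M}^{d}_{\alpha,\beta}f\|_{L^\infty}$.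
   Context: Dyadic cubes are the cubes $[x_1,x_1+2^n)\times\dots\times[x_d,x_d+2^n)$ with $n\in\mathbb{Z}$ and $x_i\in2^n\mathbb{Z}$; $\ell(Q)$ denotes the sidelength of $Q$ and $\overline Q$ its closure. For a cube $Q$, $f_Q=\frac1{|Q|}\int_Q|f|$. Let $\mathcal{Q}_\alpha$ be the set of all dyadic cubes $Q$ such that for every dyadic cube $P\supsetneq Q$ we have $\ell(P)^\alpha f_P<\ell(Q)^\alpha f_Q$. Define $\mathrm{M}^{d}_{\alpha,\beta}f(x)=\sup_{Q\in\mathcal{Q}_\alpha:\,x\in\overline Q}\ell(Q)^{\alpha+\beta}f_Q$. $\operatorname{var} f$ is the total variation of $f\in\mathrm{BV}(\mathbb{R}^d)$. *)

theory Defs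
  imports "HOL-Analysis.Analysis"
begin

definition epowr :: "ennreal \<Rightarrow> real \<Rightarrow> ennreal" where
  "epowr x q = (if x = \<infinity> then \<infinity> else ennreal (enn2real x powr q))"

definition Lq_enorm :: "real \<Rightarrow> ('a::euclidean_space \<Rightarrow> ennreal) \<Rightarrow> ennreal" where
  "Lq_enorm q h = epowr (\<integral>\<^sup>+ x. epowr (h x) q \<partial>lebesgue) (1 / q)"

definition pd :: "'n::finite \<Rightarrow> (real^'n \<Rightarrow> real) \<Rightarrow> real^'n \<Rightarrow> real" where
  "pd i \<phi> x = deriv (\<lambda>t. \<phi> (x + t *\<^sub>R axis i 1)) 0"

definition smooth_fun :: "(real^'n::finite \<Rightarrow> real) \<Rightarrow> bool" where
  "smooth_fun \<phi> \<longleftrightarrow> (\<forall>is::'n list. \<forall>x. (foldr pd is \<phi>) differentiable (at x))"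

definition test_fun :: "(real^'n::finite \<Rightarrow> real) \<Rightarrow> bool" where
  "test_fun \<phi> \<longleftrightarrow> smooth_fun \<phi> \<and> compact (closure {x. \<phi> x \<noteq> 0})"

definition weak_gradient :: "(real^'n::finite \<Rightarrow> real) \<Rightarrow> (real^'n \<Rightarrow> real^'n) \<Rightarrow> bool" where
  "weak_gradient f g \<longleftrightarrow>
     (\<forall>i \<phi>. test_fun \<phi> \<longrightarrow>
        (\<integral>x. f x * pd i \<phi> x \<partial>lebesgue) = - (\<integral>x. g x $ i * \<phi> x \<partial>lebesgue))"

definition sobolev_W1p :: "real \<Rightarrow> (real^'n::finite \<Rightarrow> real) \<Rightarrow> (real^'n \<Rightarrow> real^'n) \<Rightarrow> bool" where
  "sobolev_W1p p f g \<longleftrightarrow>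
     f \<in> borel_measurable lebesgue \<and> Lq_enorm p (\<lambda>x. ennreal \<bar>f x\<bar>) < \<infinity> \<and>
     g \<in> borel_measurable lebesgue \<and> Lq_enorm p (\<lambda>x. ennreal (norm (g x))) < \<infinity> \<and>
     weak_gradient f g"

definition divergence :: "(real^'n::finite \<Rightarrow> real^'n) \<Rightarrow> real^'n \<Rightarrow> real" where
  "divergence \<Phi> x = (\<Sum>i\<in>UNIV. pd i (\<lambda>y. \<Phi> y $ i) x)"

definition test_fields :: "(real^'n::finite \<Rightarrow> real^'n) set" where
  "test_fields = {\<Phi>. (\<forall>i. test_fun (\<lambda>y. \<Phi> y $ i)) \<and> (\<forall>x. norm (\<Phi> x) \<le> 1)}"

text \<open>var f = sup of the integrals of f div Phi over test fields (the sup is >= 0 since Phi = 0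
  is admissible, so taking it in [0,\<infinity>] changes nothing).\<close>
definition total_var :: "(real^'n::finite \<Rightarrow> real) \<Rightarrow> ennreal" where
  "total_var f = (SUP \<Phi>\<in>test_fields. ennreal (\<integral>x. f x * divergence \<Phi> x \<partial>lebesgue))"

definition BV :: "(real^'n::finite \<Rightarrow> real) \<Rightarrow> bool" where
  "BV f \<longleftrightarrow> f \<in> borel_measurable lebesgue \<and> integrable lebesgue f \<and> total_var f < \<infinity>"

definition dcube :: "int \<Rightarrow> ('n::finite \<Rightarrow> int) \<Rightarrow> (real^'n) set" where
  "dcube k j = {y. \<forall>i. 2 powr k * j i \<le> y $ i \<and> y $ i < 2 powr k * (j i + 1)}"

definition side :: "int \<Rightarrow> real" where
  "side k = 2 powr k"

definition avg :: "(real^'n::finite \<Rightarrow> real) \<Rightarrow> (real^'n) set \<Rightarrow> real" where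
  "avg f Q = (LINT x:Q|lebesgue. \<bar>f x\<bar>) / measure lebesgue Q"

definition Q_alpha :: "real \<Rightarrow> (real^'n::finite \<Rightarrow> real) \<Rightarrow> (int \<times> ('n \<Rightarrow> int)) set" where
  "Q_alpha \<alpha> f = {(k, j). \<forall>k' j'. dcube k j \<subset> dcube k' j' \<longrightarrow>
      side k' powr \<alpha> * avg f (dcube k' j') < side k powr \<alpha> * avg f (dcube k j)}"

definition dyadic_max :: "real \<Rightarrow> real \<Rightarrow> (real^'n::finite \<Rightarrow> real) \<Rightarrow> real^'n \<Rightarrow> ennreal" where
  "dyadic_max \<alpha> \<beta> f x =
     (SUP (k, j) \<in> {(k, j). (k, j) \<in> Q_alpha \<alpha> f \<and> x \<in> closure (dcube k j)}.
        ennreal (side k powr (\<alpha> + \<beta>) * avg f (dcube k j)))"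

end

theory Submission
  imports Defs
begin

text \<open>
  If \<open>Q\<close> belongs to the selected family and \<open>P\<close> is its parent, then \<open>f\<^sub>P \<le> 2\<^sup>-\<^sup>\<alpha> f\<^sub>Q\<close>, so \<open>f\<^sub>Q\<close> is controlled by the
  oscillation of \<open>f\<close> on \<open>P\<close>. For \<open>p > 1\<close> and at the endpoint, the Poincare inequality on \<open>P\<close> bounds the maximal
  function by a dyadic fractional maximal function of the gradient.

  For exponent one and \<open>V\<close> the variation, it suffices to bound the sum of \<open>l(Q)\<^sup>d\<^sup>-\<^sup>1 f\<^sub>Q\<close> over all selected cubes by \<open>C V\<close>.
  Let \<open>N\<^sub>k(x)\<close> be \<open>2\<^sup>d\<^sup>+\<^sup>1\<close> times the largest mean of \<open>\<bar>f\<bar>\<close> over the cubes of side at least \<open>2\<^sup>k\<close> containing \<open>x\<close>, and cut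
  \<open>\<bar>f\<bar>\<close> into the layers \<open>min \<bar>f\<bar> N\<^sub>k - min \<bar>f\<bar> N\<^sub>k\<^sub>+\<^sub>1\<close>. By Chebyshev each layer vanishes on half of every cube of
  side \<open>2\<^sup>k\<close>, so its mean is bounded by its oscillation there. For a selected cube of side \<open>2\<^sup>k\<close> the maximum
  \<open>N\<^sub>k\<^sub>+\<^sub>n\<close> is at most \<open>f\<^sub>Q / 2\<close> for a fixed \<open>n\<close>, so at least half of \<open>f\<^sub>Q\<close> comes from layers of index below \<open>k + n\<close>,
  and summing the geometric series in \<open>k\<close> leaves the sum of \<open>2\<^sup>-\<^sup>k\<close> times the integrals of the layers. These
  oscillations add up: the increments of the layers between two points are dominated by the increment of
  \<open>f\<close>, and the integral of \<open>\<bar>f(x + w) - f(x)\<bar>\<close> is at most \<open>\<bar>w\<bar> V\<close>.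
\<close>

subsection \<open>Smooth bumps\<close>

text \<open>Exponent one is the hard case. The dyadic maximal operator is only of weak type there,
  and the constant of its strong type bound blows up as p decreases to 1. Selected cubes may be
  nested, so a Poincare inequality on each of them would charge the same variation once per scale.
  The layers remove this overcounting: N_k is constant on cubes of side 2^k and decreases in k, so
  for two points of a common cube all layers from that scale on act as the same nondecreasing
  functions of |f|, and their increments together are at most that of f. The variation enters only
  through translations of f, so BV and Sobolev functions share the argument at exponent one. The
  passage from weak derivatives to translations is made by duality with explicit bumps. The sum over
  selected cubes also settles the higher exponents q: every single term is at most the bound B for
  the sum, so q-th powers cost only a factor B^(q-1).\<close>

definition flat_exp :: "nat \<Rightarrow> real \<Rightarrow> real" where
  "flat_exp k t = (if t > 0 then exp (- (1 / t)) / t ^ k else 0)"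

lemma flat_exp_nonneg: "0 \<le> flat_exp k t"
  by (simp add: flat_exp_def)

text \<open>The term of index k + 1 of the exponential series bounds exp (1/t) from below by
  t^-(k+1) / (k+1)!. This is one power more than the denominator has, and the spare factor t makes
  the function vanish linearly at 0.\<close>

lemma flat_exp_le_fact: "flat_exp k t \<le> fact (Suc k) * \<bar>t\<bar>"
proof (cases "t > 0")
  case True
  have "(1/t) ^ Suc k / fact (Suc k) \<le> exp (1/t)"
    using True sum_le_suminf[OF summable_exp_generic[of "1/t"], of "{Suc k}"]
    by (simp add: exp_def divide_inverse mult.commute del: fact_Suc power_Suc)
  hence "(1/t) ^ Suc k * exp (- (1/t)) \<le> fact (Suc k)"
    using True by (simp add: exp_minus field_simps del: fact_Suc power_Suc)
  hence "(1/t) ^ Suc k * exp (- (1/t)) * t \<le> fact (Suc k) * t"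
    using True by (intro mult_right_mono) auto
  moreover have "(1/t) ^ Suc k * exp (- (1/t)) * t = exp (- (1 / t)) / t ^ k"
    using True by (simp add: power_divide field_simps)
  ultimately show ?thesis using True by (simp add: flat_exp_def)
next
  case False
  thus ?thesis by (simp add: flat_exp_def mult_nonneg_nonpos del: fact_Suc)
qed

text \<open>Keeping the powers of 1/t in the family makes its linear span closed under
  differentiation. At 0 the difference quotient is at most the member of index k + 1, which tends to
  0 by the linear bound.\<close>

lemma flat_exp_has_derivative:
  "(flat_exp k has_real_derivative (flat_exp (k + 2) t - real k * flat_exp (k + 1) t)) (at t)"
proof (cases t "0::real" rule: linorder_cases)
  case greater
  have "((\<lambda>t. exp (- (1 / t)) / t ^ k) has_real_derivative
      (flat_exp (k + 2) t - real k * flat_exp (k + 1) t)) (at t)"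
    using greater
    apply (auto intro!: derivative_eq_intros simp: flat_exp_def)
    apply (cases k)
    apply (auto simp: field_simps power2_eq_square)
    done
  thus ?thesis
    by (rule has_field_derivative_transform_within_open[where S="{0<..}"])
       (use greater in \<open>auto simp: flat_exp_def\<close>)
next
  case less
  have "((\<lambda>t. 0) has_real_derivative (flat_exp (k + 2) t - real k * flat_exp (k + 1) t)) (at t)"
    using less by (auto simp: flat_exp_def)
  thus ?thesis
    by (rule has_field_derivative_transform_within_open[where S="{..<0}"])
       (use less in \<open>auto simp: flat_exp_def\<close>)
next
  case equal
  have "((\<lambda>h. flat_exp k h / h) \<longlongrightarrow> 0) (at 0)"
  proof (rule Lim_null_comparison)
    show "\<forall>\<^sub>F h in at 0. norm (flat_exp k h / h) \<le> fact (Suc (Suc k)) * \<bar>h\<bar>"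
    proof (rule always_eventually, rule allI)
      fix h :: real
      have "norm (flat_exp k h / h) \<le> flat_exp (Suc k) h" by (auto simp: flat_exp_def mult.commute)
      also have "\<dots> \<le> fact (Suc (Suc k)) * \<bar>h\<bar>" by (rule flat_exp_le_fact)
      finally show "norm (flat_exp k h / h) \<le> fact (Suc (Suc k)) * \<bar>h\<bar>" .
    qed
    show "((\<lambda>h. fact (Suc (Suc k)) * \<bar>h\<bar>) \<longlongrightarrow> 0) (at (0::real))"
      by (auto intro!: tendsto_mult_right_zero tendsto_rabs_zero)
  qed
  thus ?thesis using equal
    by (simp add: has_field_derivative_iff flat_exp_def)
qed

text \<open>A syntactic class that is closed under \<open>pd\<close>. Differentiability of all
  iterated partial derivatives, which \<open>smooth_fun\<close> demands, then follows by induction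
  over the list of directions.\<close>

inductive bump_algebra :: "(real^'n::finite \<Rightarrow> real) \<Rightarrow> bool" where
  coord: "bump_algebra (\<lambda>x. flat_exp k (a * x $ i + b))"
| const: "bump_algebra (\<lambda>x. c)"
| add: "bump_algebra \<phi> \<Longrightarrow> bump_algebra \<psi> \<Longrightarrow> bump_algebra (\<lambda>x. \<phi> x + \<psi> x)"
| mult: "bump_algebra \<phi> \<Longrightarrow> bump_algebra \<psi> \<Longrightarrow> bump_algebra (\<lambda>x. \<phi> x * \<psi> x)"

lemma pd_has_derivative:
  assumes "\<phi> differentiable (at x)"
  shows "((\<lambda>t. \<phi> (x + t *\<^sub>R axis i 1)) has_real_derivative pd i \<phi> x) (at 0)"
proof -
  have "\<phi> differentiable (at (x + 0 *\<^sub>R axis i 1))" using assms by simp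
  hence "(\<phi> \<circ> (\<lambda>t. x + t *\<^sub>R axis i 1)) differentiable (at (0::real))"
    by (intro differentiable_chain_at) auto
  hence "(\<lambda>t. \<phi> (x + t *\<^sub>R axis i 1)) field_differentiable (at 0)"
    by (simp add: o_def real_differentiable_def field_differentiable_def)
  thus ?thesis unfolding pd_def by (simp add: DERIV_deriv_iff_field_differentiable)
qed

lemma pd_eqI:
  "((\<lambda>t. \<phi> (x + t *\<^sub>R axis i 1)) has_real_derivative D) (at 0) \<Longrightarrow> pd i \<phi> x = D"
  unfolding pd_def by (rule DERIV_imp_deriv)

lemma pd_eq_frechet:
  assumes "(\<phi> has_derivative D) (at x)"
  shows "pd i \<phi> x = D (axis i 1)"
proof (rule pd_eqI)
  have l: "linear D" using assms has_derivative_linear by blast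
  have "(\<phi> has_derivative D) (at (x + 0 *\<^sub>R axis i 1))" using assms by simp
  hence "((\<lambda>t. \<phi> (x + t *\<^sub>R axis i 1)) has_derivative (\<lambda>t. D (t *\<^sub>R axis i 1))) (at 0)"
    by (rule has_derivative_compose[rotated]) (auto intro!: derivative_eq_intros)
  thus "((\<lambda>t. \<phi> (x + t *\<^sub>R axis i 1)) has_real_derivative D (axis i 1)) (at 0)"
    unfolding has_field_derivative_def
    by (simp add: linear_cmul[OF l] mult.commute[of _ "D _"])
qed

lemma frechet_eq_sum_pd:
  fixes \<phi> :: "real^'n::finite \<Rightarrow> real"
  assumes "(\<phi> has_derivative D) (at x)"
  shows "D w = (\<Sum>i\<in>UNIV. w $ i * pd i \<phi> x)"
proof -
  have l: "linear D" using assms has_derivative_linear by blast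
  have "D w = D (\<Sum>i\<in>UNIV. w $ i *\<^sub>R axis i 1)"
    using basis_expansion[of w] by (simp add: scalar_mult_eq_scaleR)
  also have "\<dots> = (\<Sum>i\<in>UNIV. w $ i * D (axis i 1))"
    by (simp add: linear_sum[OF l] linear_cmul[OF l])
  finally show ?thesis by (simp add: pd_eq_frechet[OF assms])
qed

lemma bump_algebra_differentiable_pd:
  assumes "bump_algebra (\<phi> :: real^'n::finite \<Rightarrow> real)"
  shows "(\<forall>x. \<phi> differentiable (at x)) \<and> (\<forall>i. bump_algebra (pd i \<phi>))"
  using assms
proof induction
  case (coord k a i b)
  have der: "((\<lambda>x::real^'n. flat_exp k (a * x $ i + b)) has_derivative
     (\<lambda>v. (flat_exp (k+2) (a * x $ i + b) - real k * flat_exp (k+1) (a * x $ i + b)) * (a * v $ i))) (at x)" for x :: "real^'n"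
  proof -
    have "((\<lambda>x::real^'n. x $ i) has_derivative (\<lambda>v. v $ i)) (at x)"
      by (intro bounded_linear_imp_has_derivative bounded_linear_vec_nth)
    hence "((\<lambda>x::real^'n. a * x $ i + b) has_derivative (\<lambda>v. a * v $ i)) (at x)"
      by (intro has_derivative_add_const has_derivative_mult_right)
    thus ?thesis
      by (rule has_derivative_compose[where g="flat_exp k"])
         (rule flat_exp_has_derivative[unfolded has_field_derivative_def])
  qed
  have "pd j (\<lambda>x::real^'n. flat_exp k (a * x $ i + b)) =
     (\<lambda>x. (flat_exp (k+2) (a * x $ i + b) + (- real k) * flat_exp (k+1) (a * x $ i + b)) * (a * axis j 1 $ i))" for j
    by (rule ext) (simp add: pd_eq_frechet[OF der])
  moreover have "bump_algebra (\<lambda>x. (flat_exp (k+2) (a * x $ i + b) + (- real k) * flat_exp (k+1) (a * x $ i + b)) * (a * axis j 1 $ i))" for j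
    by (intro bump_algebra.intros)
  ultimately show ?case using der by (auto simp: differentiable_def)
next
  case (const c)
  have "pd j (\<lambda>x::real^'n. c) = (\<lambda>x. 0)" for j by (rule ext, rule pd_eqI) auto
  thus ?case by (auto intro: bump_algebra.const)
next
  case (add \<phi> \<psi>)
  have "pd i (\<lambda>x. \<phi> x + \<psi> x) = (\<lambda>x. pd i \<phi> x + pd i \<psi> x)" for i
    using add by (intro ext pd_eqI DERIV_add pd_has_derivative) auto
  thus ?case using add by (auto intro: bump_algebra.intros)
next
  case (mult \<phi> \<psi>)
  have "pd i (\<lambda>x. \<phi> x * \<psi> x) = (\<lambda>x. pd i \<phi> x * \<psi> x + pd i \<psi> x * \<phi> x)" for i
  proof (intro ext pd_eqI)
    fix x
    show "((\<lambda>t. \<phi> (x + t *\<^sub>R axis i 1) * \<psi> (x + t *\<^sub>R axis i 1)) has_real_derivative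
         pd i \<phi> x * \<psi> x + pd i \<psi> x * \<phi> x) (at 0)"
      using DERIV_mult[OF pd_has_derivative[of \<phi> x i] pd_has_derivative[of \<psi> x i]] mult by simp
  qed
  thus ?case using mult by (simp add: bump_algebra.add bump_algebra.mult)
qed

lemmas bump_algebra_differentiable = bump_algebra_differentiable_pd[THEN conjunct1, rule_format]
lemmas bump_algebra_pd = bump_algebra_differentiable_pd[THEN conjunct2, rule_format]

lemma bump_algebra_continuous: "bump_algebra \<phi> \<Longrightarrow> continuous_on S \<phi>"
  using bump_algebra_differentiable differentiable_imp_continuous_within
  by (intro continuous_at_imp_continuous_on) blast

lemma bump_algebra_measurable: "bump_algebra \<phi> \<Longrightarrow> \<phi> \<in> borel_measurable borel"
  by (intro borel_measurable_continuous_onI bump_algebra_continuous)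

lemma bump_algebra_smooth: "bump_algebra \<phi> \<Longrightarrow> smooth_fun \<phi>"
proof -
  assume "bump_algebra \<phi>"
  hence "bump_algebra (foldr pd is \<phi>)" for "is" by (induction "is") (auto intro: bump_algebra_pd)
  thus ?thesis unfolding smooth_fun_def using bump_algebra_differentiable by blast
qed

lemma bump_algebra_translate: "bump_algebra \<phi> \<Longrightarrow> bump_algebra (\<lambda>x. \<phi> (x - v))"
proof (induction rule: bump_algebra.induct)
  case (coord k a i b)
  have "(\<lambda>x. flat_exp k (a * (x - v) $ i + b)) = (\<lambda>x. flat_exp k (a * x $ i + (b - a * v $ i)))"
    by (simp add: algebra_simps)
  thus ?case by (simp only: bump_algebra.coord)
qed (auto intro: bump_algebra.intros)

lemma bump_algebra_prod:
  "(\<And>j. j \<in> J \<Longrightarrow> bump_algebra (\<phi> j)) \<Longrightarrow> bump_algebra (\<lambda>x. \<Prod>j\<in>J. \<phi> j x)"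
  by (induction J rule: infinite_finite_induct) (auto intro: bump_algebra.intros)

text \<open>Every duality argument tests against these functions only. They are test functions, are
  stable under sums, translations and partial derivatives, and are rich enough to approximate
  indicators of boxes.\<close>

definition bump_test :: "(real^'n::finite \<Rightarrow> real) \<Rightarrow> bool" where
  "bump_test \<phi> \<longleftrightarrow> bump_algebra \<phi> \<and> (\<exists>R. \<forall>x. R < norm x \<longrightarrow> \<phi> x = 0)"

lemma bump_test_test_fun: "bump_test \<phi> \<Longrightarrow> test_fun \<phi>"
proof -
  assume *: "bump_test \<phi>"
  then obtain R where "\<And>x. R < norm x \<Longrightarrow> \<phi> x = 0" by (auto simp: bump_test_def)
  hence "{x. \<phi> x \<noteq> 0} \<subseteq> cball 0 R" by (force simp: not_less)
  hence "bounded {x. \<phi> x \<noteq> 0}" using bounded_cball bounded_subset by blast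
  thus ?thesis using * by (auto simp: test_fun_def bump_test_def bump_algebra_smooth compact_closure)
qed

lemma bump_test_cmult: "bump_test \<phi> \<Longrightarrow> bump_test (\<lambda>x. c * \<phi> x)"
  by (auto simp: bump_test_def intro: bump_algebra.intros)

lemma bump_test_translate: "bump_test \<phi> \<Longrightarrow> bump_test (\<lambda>x. \<phi> (x - v))"
proof -
  assume *: "bump_test \<phi>"
  then obtain R where R: "\<And>x. R < norm x \<Longrightarrow> \<phi> x = 0" by (auto simp: bump_test_def)
  have "\<phi> (x - v) = 0" if "R + norm v < norm x" for x
    using that norm_triangle_sub[of x v] by (intro R) linarith
  thus ?thesis using * bump_algebra_translate by (auto simp: bump_test_def)
qed

lemma bump_test_add:
  assumes "bump_test \<phi>" "bump_test \<psi>" shows "bump_test (\<lambda>x. \<phi> x + \<psi> x)"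
proof -
  obtain R where R: "\<And>x. R < norm x \<Longrightarrow> \<phi> x = 0" using assms(1) unfolding bump_test_def by blast
  obtain S where S: "\<And>x. S < norm x \<Longrightarrow> \<psi> x = 0" using assms(2) unfolding bump_test_def by blast
  have "\<forall>x. max R S < norm x \<longrightarrow> \<phi> x + \<psi> x = 0" using R S by simp
  moreover have "bump_algebra (\<lambda>x. \<phi> x + \<psi> x)" using assms by (simp add: bump_test_def bump_algebra.add)
  ultimately show ?thesis unfolding bump_test_def by blast
qed

lemma bump_test_sum:
  "(\<And>j. j \<in> J \<Longrightarrow> bump_test (\<phi> j)) \<Longrightarrow> bump_test (\<lambda>x. \<Sum>j\<in>J. \<phi> j x)"
proof (induction J rule: infinite_finite_induct)
  case (insert j J)
  thus ?case by (simp add: bump_test_add)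
qed (simp_all add: bump_test_def bump_algebra.const)

lemma bump_test_pd: "bump_test \<phi> \<Longrightarrow> bump_test (pd i \<phi>)"
proof -
  assume *: "bump_test \<phi>"
  then obtain R where R: "\<And>x. R < norm x \<Longrightarrow> \<phi> x = 0" by (auto simp: bump_test_def)
  have "pd i \<phi> x = 0" if "R < norm x" for x
  proof -
    have "(\<phi> has_derivative (\<lambda>_. 0)) (at x)"
      by (rule has_derivative_transform_within_open[where f="\<lambda>_. 0" and s="- cball 0 R"])
         (use R that in \<open>auto simp: open_Compl not_le\<close>)
    thus ?thesis by (rule pd_eq_frechet)
  qed
  thus ?thesis using * by (auto simp: bump_test_def bump_algebra_pd)
qed

lemma bump_test_bounded:
  assumes "bump_test (\<phi> :: real^'n::finite \<Rightarrow> real)"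
  obtains B R where "B \<ge> 0" "\<And>x. \<bar>\<phi> x\<bar> \<le> B * indicator (cball 0 R) x"
proof -
  obtain R where R: "\<And>x. R < norm x \<Longrightarrow> \<phi> x = 0" using assms by (auto simp: bump_test_def)
  have "compact (\<phi> ` cball 0 R)" using assms
    by (intro compact_continuous_image bump_algebra_continuous) (auto simp: bump_test_def)
  then obtain B where B: "\<And>x. x \<in> cball 0 R \<Longrightarrow> \<bar>\<phi> x\<bar> \<le> B"
    by (metis bounded_iff compact_imp_bounded image_eqI real_norm_def)
  show ?thesis
    by (rule that[of "max B 0" R]) (use B R in \<open>auto simp: indicator_def not_le intro: order.trans[OF B]\<close>)
qed

text \<open>The factors exp (-1 / (s t)) tend to 1 for every t > 0 as s grows, so s is a sharpness
  parameter: the limit is the indicator of the open box, and the values stay between 0 and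
  1.\<close>

definition box_bump :: "real \<Rightarrow> real^'n \<Rightarrow> real^'n \<Rightarrow> real^'n::finite \<Rightarrow> real" where
  "box_bump s a b x = (\<Prod>i\<in>UNIV. flat_exp 0 (s * (x $ i - a $ i)) * flat_exp 0 (s * (b $ i - x $ i)))"

lemma box_bump_bump_test: "bump_test (box_bump s a b)" if "s > 0"
proof -
  have "bump_algebra (\<lambda>x. flat_exp 0 (s * (x $ i - a $ i)) * flat_exp 0 (s * (b $ i - x $ i)))" for i
  proof -
    have "s * (x $ i - a $ i) = s * x $ i + - s * a $ i" "s * (b $ i - x $ i) = - s * x $ i + s * b $ i" for x
      by (simp_all add: right_diff_distrib)
    thus ?thesis by (simp only: bump_algebra.mult bump_algebra.coord)
  qed
  hence 1: "bump_algebra (box_bump s a b)" unfolding box_bump_def by (rule bump_algebra_prod)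
  obtain R where R: "box a b \<subseteq> cball 0 R"
    using bounded_subset_ballD[OF bounded_box[of a b], of 0] ball_subset_cball[of 0] by (meson order_trans)
  have "box_bump s a b x = 0" if "R < norm x" for x
  proof -
    have "x \<notin> box a b" using R that by auto
    then obtain i where "\<not> (a $ i < x $ i \<and> x $ i < b $ i)" by (auto simp: mem_box_cart)
    hence "flat_exp 0 (s * (x $ i - a $ i)) * flat_exp 0 (s * (b $ i - x $ i)) = 0"
      using \<open>s > 0\<close> by (auto simp: flat_exp_def zero_less_mult_iff)
    thus ?thesis unfolding box_bump_def by (metis (mono_tags, lifting) UNIV_I finite prod_zero)
  qed
  thus ?thesis using 1 unfolding bump_test_def by blast
qed

lemma box_bump_bounds:
  assumes "s > 0"
  shows "0 \<le> box_bump s a b x" "box_bump s a b x \<le> indicator (box a b) x"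
proof -
  have le1: "flat_exp 0 t \<le> 1" for t by (auto simp: flat_exp_def)
  show "0 \<le> box_bump s a b x" unfolding box_bump_def by (intro prod_nonneg) (auto simp: flat_exp_nonneg)
  show "box_bump s a b x \<le> indicator (box a b) x"
  proof (cases "x \<in> box a b")
    case True
    have "box_bump s a b x \<le> (\<Prod>i\<in>(UNIV::'a set). 1)" unfolding box_bump_def
      by (intro prod_mono conjI mult_le_one le1) (auto simp: flat_exp_nonneg)
    thus ?thesis using True by simp
  next
    case False
    then obtain i where "\<not> (a $ i < x $ i \<and> x $ i < b $ i)" by (auto simp: mem_box_cart)
    hence "flat_exp 0 (s * (x $ i - a $ i)) * flat_exp 0 (s * (b $ i - x $ i)) = 0"
      using \<open>s > 0\<close> by (auto simp: flat_exp_def zero_less_mult_iff)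
    hence "box_bump s a b x = 0" unfolding box_bump_def by (metis (mono_tags, lifting) UNIV_I finite prod_zero)
    thus ?thesis by simp
  qed
qed

lemma box_bump_tendsto:
  "(\<lambda>m. box_bump (real (Suc m)) a b x) \<longlonglongrightarrow> indicator (box a b) x"
proof (cases "x \<in> box a b")
  case True
  have lim: "(\<lambda>m. flat_exp 0 (real (Suc m) * t)) \<longlonglongrightarrow> 1" if "t > 0" for t
  proof -
    have "(\<lambda>m. exp (- ((1 / t) * inverse (real (Suc m))))) \<longlonglongrightarrow> exp (- ((1 / t) * 0))"
      by (intro tendsto_intros LIMSEQ_inverse_real_of_nat)
    moreover have "flat_exp 0 (real (Suc m) * t) = exp (- ((1 / t) * inverse (real (Suc m))))" for m
      using that by (simp add: flat_exp_def zero_less_mult_iff field_simps del: of_nat_Suc)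
    ultimately show ?thesis by simp
  qed
  have "(\<lambda>m. box_bump (real (Suc m)) a b x) \<longlonglongrightarrow> (\<Prod>i\<in>(UNIV::'a set). 1 * 1)"
    unfolding box_bump_def using True
    by (intro tendsto_prod tendsto_mult lim) (auto simp: mem_box_cart)
  thus ?thesis using True by simp
next
  case False
  have "box_bump (real (Suc m)) a b x = 0" for m
    using box_bump_bounds[of "real (Suc m)" a b x] False by simp
  thus ?thesis using False by simp
qed

subsection \<open>The dyadic grid\<close>

lemma nn_integral_lborel_translate:
  fixes f :: "'a::euclidean_space \<Rightarrow> ennreal"
  assumes [measurable]: "f \<in> borel_measurable borel"
  shows "(\<integral>\<^sup>+ x. f (x + v) \<partial>lborel) = (\<integral>\<^sup>+ x. f x \<partial>lborel)"
proof -
  have "(\<integral>\<^sup>+ x. f x \<partial>lborel) = (\<integral>\<^sup>+ x. f x \<partial>distr lborel borel ((+) v))"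
    by (simp add: lborel_distr_plus)
  also have "\<dots> = (\<integral>\<^sup>+ x. f (v + x) \<partial>lborel)" by (simp add: nn_integral_distr)
  finally show ?thesis by (simp add: add.commute)
qed

lemma integral_lborel_translate:
  fixes f :: "'a::euclidean_space \<Rightarrow> real"
  assumes [measurable]: "f \<in> borel_measurable borel"
  shows "(\<integral> x. f (x + v) \<partial>lborel) = (\<integral> x. f x \<partial>lborel)"
proof -
  have "(\<integral> x. f x \<partial>lborel) = (\<integral> x. f x \<partial>distr lborel borel ((+) v))"
    by (simp add: lborel_distr_plus)
  also have "\<dots> = (\<integral> x. f (v + x) \<partial>lborel)" by (simp add: integral_distr)
  finally show ?thesis by (simp add: add.commute)
qed

lemma integrable_lborel_translate:
  fixes f :: "'a::euclidean_space \<Rightarrow> real"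
  assumes "integrable lborel f"
  shows "integrable lborel (\<lambda>x. f (x + v))"
proof -
  have "integrable (distr lborel borel ((+) v)) f" using assms by (simp add: lborel_distr_plus)
  thus ?thesis using assms by (simp add: integrable_distr_eq add.commute)
qed

lemma nn_integral_lborel_scale:
  fixes f :: "'a::euclidean_space \<Rightarrow> ennreal"
  assumes [measurable]: "f \<in> borel_measurable borel" and "c > 0"
  shows "(\<integral>\<^sup>+ x. f x \<partial>lborel) = ennreal (c ^ DIM('a)) * (\<integral>\<^sup>+ x. f (c *\<^sub>R x) \<partial>lborel)"
proof -
  have "(\<integral>\<^sup>+ x. f x \<partial>lborel) = (\<integral>\<^sup>+ x. f x \<partial>density (distr lborel borel (\<lambda>x. 0 + c *\<^sub>R x)) (\<lambda>_. \<bar>c\<bar>^DIM('a)))"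
    using lborel_affine[of c "0::'a"] \<open>c > 0\<close> by simp
  also have "\<dots> = ennreal (c ^ DIM('a)) * (\<integral>\<^sup>+ x. f (c *\<^sub>R x) \<partial>lborel)"
    using \<open>c > 0\<close> by (simp add: nn_integral_density nn_integral_distr nn_integral_cmult)
  finally show ?thesis .
qed

text \<open>Sums over all scales or all cubes are written as integrals against the counting measure,
  so that Tonelli exchanges them with other integrals. Upper bounds for them are reduced here to
  finite partial sums.\<close>

lemma nn_integral_count_space_le:
  fixes f :: "'a::countable \<Rightarrow> ennreal"
  assumes "\<And>F. finite F \<Longrightarrow> sum f F \<le> B"
  shows "(\<integral>\<^sup>+ i. f i \<partial>count_space UNIV) \<le> B"
proof -
  define S where "S n = {i::'a. to_nat i < n}" for n
  have fin: "finite (S n)" for n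
    unfolding S_def by (rule inj_on_finite[of to_nat _ "{..<n}"]) (auto intro: inj_on_subset[OF inj_to_nat])
  have "f i = (SUP n. f i * indicator (S n) i)" for i
  proof (rule antisym)
    have "f i \<le> f i * indicator (S (Suc (to_nat i))) i" by (simp add: S_def)
    thus "f i \<le> (SUP n. f i * indicator (S n) i)" by (rule SUP_upper2[OF UNIV_I])
    show "(SUP n. f i * indicator (S n) i) \<le> f i" by (intro SUP_least) (auto simp: indicator_def)
  qed
  hence "(\<integral>\<^sup>+ i. f i \<partial>count_space UNIV) = (\<integral>\<^sup>+ i. (SUP n. f i * indicator (S n) i) \<partial>count_space UNIV)"
    by simp
  also have "\<dots> = (SUP n. \<integral>\<^sup>+ i. f i * indicator (S n) i \<partial>count_space UNIV)"
    by (rule nn_integral_monotone_convergence_SUP)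
       (auto simp: incseq_def le_fun_def S_def indicator_def)
  also have "\<dots> \<le> B"
  proof (rule SUP_least)
    fix n
    have "(\<integral>\<^sup>+ i. f i * indicator (S n) i \<partial>count_space UNIV) = (\<Sum>i\<in>S n. f i * indicator (S n) i)"
      by (rule nn_integral_count_space') (auto simp: fin)
    also have "\<dots> = sum f (S n)" by (rule sum.cong) auto
    finally show "(\<integral>\<^sup>+ i. f i * indicator (S n) i \<partial>count_space UNIV) \<le> B" using assms fin by simp
  qed
  finally show ?thesis .
qed

lemma sum_le_nn_integral_count_space:
  fixes f :: "'a \<Rightarrow> ennreal"
  assumes "finite F"
  shows "sum f F \<le> (\<integral>\<^sup>+ i. f i \<partial>count_space UNIV)"
proof -
  have "sum f F = (\<Sum>i\<in>F. f i * indicator F i)" by (rule sum.cong) auto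
  also have "\<dots> = (\<integral>\<^sup>+ i. f i * indicator F i \<partial>count_space UNIV)"
    by (rule nn_integral_count_space'[symmetric]) (auto simp: assms)
  also have "\<dots> \<le> (\<integral>\<^sup>+ i. f i \<partial>count_space UNIV)"
    by (intro nn_integral_mono) (auto simp: indicator_def)
  finally show ?thesis .
qed

lemma le_nn_integral_count_space: "f i \<le> (\<integral>\<^sup>+ i. f i \<partial>count_space UNIV)"
  using sum_le_nn_integral_count_space[of "{i}" f] by simp

section \<open>Indices and nesting of dyadic cubes\<close>

definition cidx :: "int \<Rightarrow> real^'n::finite \<Rightarrow> 'n \<Rightarrow> int" where
  "cidx k x = (\<lambda>i. \<lfloor>x $ i / 2 powr real_of_int k\<rfloor>)"

lemma mem_dcube_iff: "x \<in> dcube k j \<longleftrightarrow> cidx k x = j"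
  unfolding dcube_def cidx_def fun_eq_iff mem_Collect_eq floor_eq_iff
  by (simp add: pos_le_divide_eq pos_divide_less_eq mult.commute)

text \<open>With cubes encoded by the index of their points, nesting of the grid is a fact about
  floors: passing to the parent halves the index. Hence a common cube at one scale forces common
  cubes at all coarser scales.\<close>

lemma cidx_Suc: "cidx (k + 1) x = (\<lambda>i. cidx k x i div 2)"
proof
  fix i
  have "cidx (k + 1) x i = \<lfloor>(x $ i / 2 powr real_of_int k) / real_of_int 2\<rfloor>"
    by (simp add: cidx_def powr_add)
  also have "\<dots> = cidx k x i div 2"
    by (subst floor_divide_real_eq_div) (auto simp: cidx_def)
  finally show "cidx (k + 1) x i = cidx k x i div 2" .
qed

lemma cidx_mono:
  assumes "cidx k x = cidx k y" "k \<le> l"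
  shows "cidx l x = cidx l y"
  using assms(2,1) by (induction l rule: int_ge_induct) (simp_all add: cidx_Suc)

lemma cidx_translate: "cidx k (x + 2 powr real_of_int k *\<^sub>R (\<chi> i. real_of_int (j i))) = (\<lambda>i. cidx k x i + j i)"
  unfolding cidx_def by (rule ext) (simp add: add_divide_distrib)

text \<open>Cubes are convex: each coordinate of the intermediate point lies between those of the
  endpoints, and the floor is monotone. This keeps segments inside a cube whenever an increment is
  split or integrated along a segment.\<close>

lemma cidx_convex:
  assumes "cidx k x = cidx k (x + w)" "0 \<le> t" "t \<le> 1"
  shows "cidx k (x + t *\<^sub>R w) = cidx k x"
proof
  fix i
  let ?s = "2 powr real_of_int k"
  have *: "\<lfloor>x $ i / ?s\<rfloor> = \<lfloor>(x $ i + w $ i) / ?s\<rfloor>"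
    using assms(1)[THEN fun_cong, of i] by (simp add: cidx_def)
  have "\<lfloor>(x $ i + t * w $ i) / ?s\<rfloor> = \<lfloor>x $ i / ?s\<rfloor>"
  proof (cases "w $ i \<ge> 0")
    case True
    have "t * w $ i \<le> w $ i" "0 \<le> t * w $ i" using True assms by (auto simp: mult_left_le_one_le)
    hence "x $ i / ?s \<le> (x $ i + t * w $ i) / ?s" "(x $ i + t * w $ i) / ?s \<le> (x $ i + w $ i) / ?s"
      by (auto intro!: divide_right_mono)
    from this[THEN floor_mono] * show ?thesis by simp
  next
    case False
    have "w $ i \<le> t * w $ i" "t * w $ i \<le> 0" using False assms
      by (auto simp: mult_nonneg_nonpos mult_left_le_one_le mult_le_cancel_right1)
    hence "x $ i / ?s \<ge> (x $ i + t * w $ i) / ?s" "(x $ i + t * w $ i) / ?s \<ge> (x $ i + w $ i) / ?s"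
      by (auto intro!: divide_right_mono)
    from this[THEN floor_mono] * show ?thesis by simp
  qed
  thus "cidx k (x + t *\<^sub>R w) i = cidx k x i" by (simp add: cidx_def)
qed

lemma cidx_eq_diff:
  assumes "cidx k x = cidx k (x + w)"
  shows "\<bar>w $ i\<bar> < 2 powr real_of_int k"
proof -
  have "\<lfloor>x $ i / 2 powr real_of_int k\<rfloor> = \<lfloor>(x $ i + w $ i) / 2 powr real_of_int k\<rfloor>"
    using assms[THEN fun_cong, of i] by (simp add: cidx_def)
  hence "\<bar>(x $ i + w $ i) / 2 powr real_of_int k - x $ i / 2 powr real_of_int k\<bar> < 1"
    by linarith
  thus ?thesis by (simp add: add_divide_distrib abs_div)
qed

lemma cidx_measurable [measurable]: "cidx k \<in> borel \<rightarrow>\<^sub>M count_space UNIV"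
proof -
  have "cidx k -` {j} \<in> sets (borel :: (real^'n::finite) measure)" for j
  proof -
    have "cidx k -` {j} = dcube k j" by (auto simp: mem_dcube_iff)
    also have "\<dots> = (\<Inter>i\<in>UNIV. {y::real^'n. 2 powr k * j i \<le> y $ i \<and> y $ i < 2 powr k * (j i + 1)})"
      by (auto simp: dcube_def)
    also have "\<dots> \<in> sets borel" by measurable
    finally show ?thesis .
  qed
  thus ?thesis by (auto simp: measurable_count_space_eq2_countable)
qed

lemma dcube_eq_vimage: "dcube k j = cidx k -` {j}"
  by (auto simp: mem_dcube_iff)

lemma dcube_borel [measurable]: "dcube k j \<in> sets borel"
  using measurable_sets[OF cidx_measurable, of "{j}" k] by (simp add: dcube_eq_vimage)

lemma cidx_eq_measurable [measurable]:
  assumes [measurable]: "f \<in> M \<rightarrow>\<^sub>M borel" "g \<in> M \<rightarrow>\<^sub>M borel"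
  shows "Measurable.pred M (\<lambda>x. cidx k (f x) = cidx k (g x :: real^'n::finite))"
proof -
  have "(\<lambda>x. cidx k (f x) = cidx k (g x)) = (\<lambda>x. \<exists>j. cidx k (f x) = j \<and> cidx k (g x) = j)" by auto
  also have "Measurable.pred M \<dots>" by measurable
  finally show ?thesis .
qed

lemma Basis_vec_eq_range: "Basis = range (\<lambda>i. axis i (1::real) :: real^'n::finite)"
  by (auto simp: Basis_vec_def)

lemma inj_axis_1: "inj (\<lambda>i. axis i (1::real) :: real^'n::finite)"
  by (auto simp: inj_on_def axis_eq_axis)

definition dcorner :: "int \<Rightarrow> ('n::finite \<Rightarrow> int) \<Rightarrow> real^'n" where
  "dcorner k j = (\<chi> i. 2 powr real_of_int k * real_of_int (j i))"

lemma box_subset_dcube: "box (dcorner k j) (dcorner k (\<lambda>i. j i + 1)) \<subseteq> dcube k j"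
  by (auto simp: dcube_def dcorner_def mem_box_cart less_imp_le)

lemma dcube_subset_cbox: "dcube k j \<subseteq> cbox (dcorner k j) (dcorner k (\<lambda>i. j i + 1))"
  by (auto simp: dcube_def dcorner_def mem_box_cart less_imp_le)

lemma emeasure_dcube:
  fixes j :: "'n::finite \<Rightarrow> int"
  shows "emeasure lborel (dcube k j) = ennreal (2 powr (real_of_int k * real CARD('n)))"
proof -
  let ?a = "dcorner k j" and ?b = "dcorner k (\<lambda>i. j i + 1)"
  have "(\<Prod>b\<in>Basis. (?b - ?a) \<bullet> b) = (\<Prod>i\<in>(UNIV::'n set). 2 powr real_of_int k)"
    unfolding Basis_vec_eq_range prod.reindex[OF inj_axis_1] by (simp add: inner_axis dcorner_def ring_distribs)
  also have "\<dots> = 2 powr (real_of_int k * real CARD('n))"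
    by (simp add: powr_powr[symmetric] powr_realpow)
  finally have pr: "(\<Prod>b\<in>Basis. (?b - ?a) \<bullet> b) = 2 powr (real_of_int k * real CARD('n))" .
  have le: "?a \<bullet> b \<le> ?b \<bullet> b" if "b \<in> Basis" for b
    using that by (auto simp: Basis_vec_def inner_axis dcorner_def)
  have "emeasure lborel (box ?a ?b) \<le> emeasure lborel (dcube k j)"
    using box_subset_dcube by (intro emeasure_mono) auto
  moreover have "emeasure lborel (dcube k j) \<le> emeasure lborel (cbox ?a ?b)"
    using dcube_subset_cbox by (intro emeasure_mono) auto
  ultimately show ?thesis using le pr
    by (simp add: emeasure_lborel_box_eq emeasure_lborel_cbox_eq)
qed

lemma measure_dcube:
  fixes j :: "'n::finite \<Rightarrow> int"
  shows "measure lborel (dcube k j) = 2 powr (real_of_int k * real CARD('n))"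
  by (simp add: measure_def emeasure_dcube)

text \<open>The maximal function ranges over closed cubes, whereas the grid is half-open. The
  countably many cube boundaries form a null set, and off this set the closures add no
  cubes.\<close>

lemma AE_not_in_closure_dcube:
  "AE x::real^'n::finite in lborel. \<forall>k j. x \<in> closure (dcube k j) \<longrightarrow> cidx k x = j"
proof -
  have *: "AE x::real^'n in lborel. x \<in> closure (dcube k j) \<longrightarrow> cidx k x = j" for k :: int and j
  proof (rule AE_I'[where N="cbox (dcorner k j) (dcorner k (\<lambda>i. j i + 1)) - box (dcorner k j) (dcorner k (\<lambda>i. j i + 1))"])
    let ?a = "dcorner k j" and ?b = "dcorner k (\<lambda>i. j i + 1)"
    have "negligible (cbox ?a ?b - box ?a ?b)" by (rule negligible_frontier_interval)
    hence "cbox ?a ?b - box ?a ?b \<in> null_sets lebesgue" by (simp add: negligible_iff_null_sets)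
    thus "cbox ?a ?b - box ?a ?b \<in> null_sets lborel"
      by (auto simp: null_sets_def)
    have "closure (dcube k j) \<subseteq> cbox ?a ?b" by (intro closure_minimal dcube_subset_cbox closed_cbox)
    thus "{x \<in> space lborel. \<not> (x \<in> closure (dcube k j) \<longrightarrow> cidx k x = j)} \<subseteq> cbox ?a ?b - box ?a ?b"
      using box_subset_dcube by (auto simp: mem_dcube_iff[symmetric])
  qed
  show ?thesis unfolding AE_all_countable using * by blast
qed

lemma nn_integral_tiling:
  fixes u :: "real^'n::finite \<Rightarrow> ennreal"
  assumes [measurable]: "u \<in> borel_measurable borel"
  shows "(\<integral>\<^sup>+ x. u x \<partial>lborel) = (\<integral>\<^sup>+ j. (\<integral>\<^sup>+ x. u x * indicator (dcube k j) x \<partial>lborel) \<partial>count_space UNIV)"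
proof -
  have "(\<integral>\<^sup>+ j. u x * indicator (dcube k j) x \<partial>count_space UNIV) = u x" for x
  proof -
    have "(\<integral>\<^sup>+ j. u x * indicator (dcube k j) x \<partial>count_space UNIV) = (\<Sum>j\<in>{cidx k x}. u x * indicator (dcube k j) x)"
      by (rule nn_integral_count_space') (auto simp: mem_dcube_iff)
    thus ?thesis by (simp add: mem_dcube_iff)
  qed
  hence "(\<integral>\<^sup>+ x. u x \<partial>lborel) = (\<integral>\<^sup>+ x. \<integral>\<^sup>+ j. u x * indicator (dcube k j) x \<partial>count_space UNIV \<partial>lborel)"
    by simp
  also have "\<dots> = (\<integral>\<^sup>+ j. (\<integral>\<^sup>+ x. u x * indicator (dcube k j) x \<partial>lborel) \<partial>count_space UNIV)"
    by (rule nn_integral_count_space_nn_integral) auto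
  finally show ?thesis .
qed

section \<open>Averages over dyadic cubes\<close>

definition dav :: "int \<Rightarrow> (real^'n::finite \<Rightarrow> ennreal) \<Rightarrow> real^'n \<Rightarrow> ennreal" where
  "dav k h x = (\<integral>\<^sup>+ y. h y * indicator {y. cidx k y = cidx k x} y \<partial>lborel) / ennreal (2 powr (real_of_int k * real CARD('n)))"

lemma dav_cong_cidx: "cidx k x = cidx k y \<Longrightarrow> dav k h x = dav k h y"
  by (simp add: dav_def)

lemma dav_measurable [measurable]:
  assumes [measurable]: "h \<in> borel_measurable borel"
  shows "dav k h \<in> borel_measurable borel"
  unfolding dav_def by measurable

text \<open>Averaging is conditional expectation onto the grid, so weights that are constant on
  cubes pass through. Tonelli exchanges the two points of the cube, and its volume cancels the
  normalisation.\<close>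

lemma nn_integral_dav:
  fixes h :: "real^'n::finite \<Rightarrow> ennreal"
  assumes [measurable]: "h \<in> borel_measurable borel"
  shows "(\<integral>\<^sup>+ x. c (cidx k x) * dav k h x \<partial>lborel) = (\<integral>\<^sup>+ x. c (cidx k x) * h x \<partial>lborel)"
proof -
  let ?v = "ennreal (2 powr (real_of_int k * real CARD('n)))"
  have [measurable]: "(\<lambda>x. c (cidx k x)) \<in> borel_measurable borel"
    by (rule measurable_compose[OF cidx_measurable]) simp
  have "c (cidx k x) * dav k h x = (\<integral>\<^sup>+ y. c (cidx k x) * h y * indicator {y. cidx k y = cidx k x} y / ?v \<partial>lborel)" for x
    unfolding dav_def
    by (simp add: nn_integral_divide nn_integral_cmult mult.assoc ennreal_times_divide)
  hence "(\<integral>\<^sup>+ x. c (cidx k x) * dav k h x \<partial>lborel) = (\<integral>\<^sup>+ x. \<integral>\<^sup>+ y. c (cidx k x) * h y * indicator {y. cidx k y = cidx k x} y / ?v \<partial>lborel \<partial>lborel)"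
    by simp
  also have "\<dots> = (\<integral>\<^sup>+ y. \<integral>\<^sup>+ x. c (cidx k x) * h y * indicator {y. cidx k y = cidx k x} y / ?v \<partial>lborel \<partial>lborel)"
    by (rule lborel_pair.Fubini') measurable
  also have "\<dots> = (\<integral>\<^sup>+ y. \<integral>\<^sup>+ x. c (cidx k y) * h y / ?v * indicator (dcube k (cidx k y)) x \<partial>lborel \<partial>lborel)"
    by (intro nn_integral_cong) (auto simp: indicator_def mem_dcube_iff)
  also have "\<dots> = (\<integral>\<^sup>+ y. c (cidx k y) * h y / ?v * ?v \<partial>lborel)"
    by (simp add: nn_integral_cmult_indicator emeasure_dcube)
  also have "\<dots> = (\<integral>\<^sup>+ y. c (cidx k y) * h y \<partial>lborel)"
    by (simp add: ennreal_divide_times ennreal_mult_divide_eq)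
  finally show ?thesis .
qed

text \<open>A function that is constant on cubes factors through the countable set of indices. This
  makes \<open>favmax\<close> Borel before its supremum is known to be finite.\<close>

lemma borel_measurable_cidx_invariant:
  fixes g :: "real^'n::finite \<Rightarrow> 'b::topological_space"
  assumes "\<And>x y. cidx k x = cidx k y \<Longrightarrow> g x = g y"
  shows "g \<in> borel_measurable borel"
proof -
  define G where "G j = g (SOME x. cidx k x = j)" for j
  have "g = (\<lambda>x. G (cidx k x))"
    unfolding G_def by (rule ext, rule assms, rule sym, rule someI) simp
  moreover have "(\<lambda>x. G (cidx k x)) \<in> borel_measurable borel"
    by (rule measurable_compose[OF cidx_measurable]) simp
  ultimately show ?thesis by simp
qed

lemma dav_mono: "(\<And>y. h y \<le> h' y) \<Longrightarrow> dav k h x \<le> dav k h' x"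
  unfolding dav_def by (intro divide_right_mono_ennreal nn_integral_mono mult_right_mono) auto

lemma dav_add:
  assumes [measurable]: "h \<in> borel_measurable borel" "h' \<in> borel_measurable borel"
  shows "dav k (\<lambda>y. h y + h' y) x = dav k h x + dav k h' x"
  unfolding dav_def by (simp add: ring_distribs nn_integral_add add_divide_distrib_ennreal)

lemma dav_const: "dav k (\<lambda>y. c) x = c"
proof -
  have "(\<integral>\<^sup>+ y. c * indicator {y. cidx k y = cidx k x} y \<partial>lborel) = c * emeasure lborel (dcube k (cidx k x))"
    by (subst nn_integral_cmult_indicator[symmetric]) (auto simp: mem_dcube_iff[symmetric])
  thus ?thesis by (simp add: dav_def emeasure_dcube ennreal_mult_divide_eq)
qed

text \<open>Substitute y = x + 2^k u for the second point. Points of one cube differ by less than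
  2^k in each coordinate, so u ranges over [-1, 1]^d, and the Jacobian 2^(k d) cancels the
  normalisation of \<open>dav\<close>. Oscillations on cubes thereby become translations by fixed
  vectors, to which a modulus of continuity applies.\<close>

lemma nn_integral_dav_pair:
  fixes B :: "real^'n::finite \<Rightarrow> real^'n \<Rightarrow> ennreal"
  assumes [measurable]: "(\<lambda>p. B (fst p) (snd p)) \<in> borel_measurable borel"
  shows "(\<integral>\<^sup>+ x. dav k (B x) x \<partial>lborel) \<le>
    (\<integral>\<^sup>+ u. (\<integral>\<^sup>+ x. B x (x + 2 powr real_of_int k *\<^sub>R u) *
        indicator {x. cidx k x = cidx k (x + 2 powr real_of_int k *\<^sub>R u)} x \<partial>lborel) * indicator (cbox (- 1) 1) u \<partial>lborel)"
proof -
  let ?c = "2 powr real_of_int k"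
  let ?v = "ennreal (2 powr (real_of_int k * real CARD('n)))"
  have Bm [measurable (raw)]: "(\<lambda>z. B (f z) (g z)) \<in> borel_measurable M"
    if "f \<in> M \<rightarrow>\<^sub>M borel" "g \<in> M \<rightarrow>\<^sub>M borel" for f g and M :: "'z measure"
    using measurable_compose[OF borel_measurable_Pair[OF that] assms] by simp
  have v: "?v = ennreal (?c ^ DIM(real^'n))"
    by (simp add: powr_powr[symmetric] powr_realpow)
  have "dav k (B x) x \<le> (\<integral>\<^sup>+ u. B x (x + ?c *\<^sub>R u) * indicator {x. cidx k x = cidx k (x + ?c *\<^sub>R u)} x *
       indicator (cbox (- 1) 1) u \<partial>lborel)" for x
  proof -
    have "{y. cidx k y = cidx k x} = dcube k (cidx k x)" by (auto simp: mem_dcube_iff)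
    hence [measurable]: "{y. cidx k y = cidx k x} \<in> sets borel" by simp
    have "(\<integral>\<^sup>+ y. B x y * indicator {y. cidx k y = cidx k x} y \<partial>lborel)
        = (\<integral>\<^sup>+ w. B x (w + x) * indicator {y. cidx k y = cidx k x} (w + x) \<partial>lborel)"
      by (subst nn_integral_lborel_translate[of _ x]) measurable
    also have "\<dots> = ?v * (\<integral>\<^sup>+ u. B x (?c *\<^sub>R u + x) * indicator {y. cidx k y = cidx k x} (?c *\<^sub>R u + x) \<partial>lborel)"
      unfolding v by (rule nn_integral_lborel_scale[where f="\<lambda>w. B x (w + x) * indicator {y. cidx k y = cidx k x} (w + x)"]) auto
    finally have "dav k (B x) x = (\<integral>\<^sup>+ u. B x (?c *\<^sub>R u + x) * indicator {y. cidx k y = cidx k x} (?c *\<^sub>R u + x) \<partial>lborel)"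
      unfolding dav_def by (simp only:) (subst mult.commute, rule ennreal_mult_divide_eq, auto)
    also have "\<dots> \<le> (\<integral>\<^sup>+ u. B x (x + ?c *\<^sub>R u) * indicator {x. cidx k x = cidx k (x + ?c *\<^sub>R u)} x *
       indicator (cbox (- 1) 1) u \<partial>lborel)"
    proof (intro nn_integral_mono)
      fix u :: "real^'n"
      show "B x (?c *\<^sub>R u + x) * indicator {y. cidx k y = cidx k x} (?c *\<^sub>R u + x)
        \<le> B x (x + ?c *\<^sub>R u) * indicator {x. cidx k x = cidx k (x + ?c *\<^sub>R u)} x * indicator (cbox (- 1) 1) u"
      proof (cases "cidx k x = cidx k (x + ?c *\<^sub>R u)")
        case True
        have "\<bar>u $ i\<bar> < 1" for i
          using cidx_eq_diff[OF True, of i] by (simp add: abs_mult)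
        hence "u \<in> cbox (- 1) 1" by (auto simp: mem_box_cart abs_less_iff less_imp_le minus_le_iff)
        thus ?thesis using True by (simp add: add.commute)
      next
        case False
        thus ?thesis by (simp add: add.commute)
      qed
    qed
    finally show ?thesis .
  qed
  hence "(\<integral>\<^sup>+ x. dav k (B x) x \<partial>lborel) \<le> (\<integral>\<^sup>+ x. \<integral>\<^sup>+ u. B x (x + ?c *\<^sub>R u) * indicator {x. cidx k x = cidx k (x + ?c *\<^sub>R u)} x *
       indicator (cbox (- 1) 1) u \<partial>lborel \<partial>lborel)"
    by (intro nn_integral_mono)
  also have "\<dots> = (\<integral>\<^sup>+ u. \<integral>\<^sup>+ x. B x (x + ?c *\<^sub>R u) * indicator {x. cidx k x = cidx k (x + ?c *\<^sub>R u)} x *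
       indicator (cbox (- 1) 1) u \<partial>lborel \<partial>lborel)"
    by (rule lborel_pair.Fubini') measurable
  also have "\<dots> = (\<integral>\<^sup>+ u. (\<integral>\<^sup>+ x. B x (x + ?c *\<^sub>R u) *
        indicator {x. cidx k x = cidx k (x + ?c *\<^sub>R u)} x \<partial>lborel) * indicator (cbox (- 1) 1) u \<partial>lborel)"
    by (intro nn_integral_cong nn_integral_multc) measurable
  finally show ?thesis .
qed

lemma norm_le_card_cbox:
  fixes u :: "real^'n::finite"
  assumes "u \<in> cbox (- 1) 1"
  shows "norm u \<le> real CARD('n)"
proof -
  have "\<bar>u $ i\<bar> \<le> 1" for i using assms by (auto simp: mem_box_cart abs_le_iff minus_le_iff)
  hence "(\<Sum>i\<in>UNIV. \<bar>u $ i\<bar>) \<le> (\<Sum>i\<in>(UNIV::'n set). 1)" by (intro sum_mono)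
  thus ?thesis using norm_le_l1_cart[of u] by simp
qed

lemma emeasure_cbox_one: "emeasure lborel (cbox (- 1) (1::real^'n::finite)) = ennreal (2 ^ CARD('n))"
proof -
  have "(\<Prod>b\<in>Basis. (1 - (- 1 :: real^'n)) \<bullet> b) = (\<Prod>i\<in>(UNIV::'n set). 2)"
    unfolding Basis_vec_eq_range prod.reindex[OF inj_axis_1] by (simp add: inner_axis)
  moreover have "(- 1 :: real^'n) \<bullet> b \<le> 1 \<bullet> b" if "b \<in> Basis" for b
    using that by (auto simp: Basis_vec_def inner_axis)
  ultimately show ?thesis by (simp add: emeasure_lborel_cbox_eq)
qed

lemma nn_integral_cbox_le:
  fixes h :: "real^'n::finite \<Rightarrow> ennreal"
  assumes "\<And>u. u \<in> cbox (- 1) 1 \<Longrightarrow> h u \<le> c"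
  shows "(\<integral>\<^sup>+ u. h u * indicator (cbox (- 1) 1) u \<partial>lborel) \<le> ennreal (2 ^ CARD('n)) * c"
proof -
  have "(\<integral>\<^sup>+ u. h u * indicator (cbox (- 1) 1) u \<partial>lborel) \<le> (\<integral>\<^sup>+ u. c * indicator (cbox (- 1) (1::real^'n)) u \<partial>lborel)"
    using assms by (intro nn_integral_mono) (auto simp: indicator_def)
  also have "\<dots> = c * emeasure lborel (cbox (- 1) (1::real^'n))" by (intro nn_integral_cmult_indicator) auto
  finally show ?thesis by (simp add: emeasure_cbox_one mult.commute)
qed

lemma nn_integral_int_geometric:
  "(\<integral>\<^sup>+ k. ennreal (2 powr (- real_of_int k)) * indicator {m<..} k \<partial>count_space (UNIV :: int set)) \<le> ennreal (2 powr (- real_of_int m))"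
proof (rule nn_integral_count_space_le)
  fix F :: "int set" assume F: "finite F"
  have tel: "(\<Sum>k\<in>{m<..m + int n}. 2 powr (- real_of_int k)) = 2 powr (- real_of_int m) - 2 powr (- real_of_int (m + int n))" for n
  proof (induction n)
    case (Suc n)
    have "{m<..m + int (Suc n)} = insert (m + int (Suc n)) {m<..m + int n}" by auto
    moreover have "2 powr (- real_of_int (m + int (Suc n))) = 2 powr (- real_of_int (m + int n)) / 2"
    proof -
      have "- real_of_int (m + int (Suc n)) = - real_of_int (m + int n) - 1" by simp
      thus ?thesis by (simp only: powr_diff) simp
    qed
    ultimately show ?case using Suc by simp
  qed simp
  define n where "n = nat (Max (insert m F) - m)"
  have sub: "F \<inter> {m<..} \<subseteq> {m<..m + int n}"
  proof
    fix k assume k: "k \<in> F \<inter> {m<..}"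
    hence "k \<le> Max (insert m F)" using F by (intro Max_ge) auto
    thus "k \<in> {m<..m + int n}" using k by (auto simp: n_def)
  qed
  have "(\<Sum>k\<in>F. ennreal (2 powr (- real_of_int k)) * indicator {m<..} k) = (\<Sum>k\<in>F \<inter> {m<..}. ennreal (2 powr (- real_of_int k)))"
    using F by (intro sum.mono_neutral_cong_right) (auto simp: indicator_def)
  also have "\<dots> \<le> (\<Sum>k\<in>{m<..m + int n}. ennreal (2 powr (- real_of_int k)))"
    by (rule sum_mono2) (use sub in auto)
  also have "\<dots> = ennreal (\<Sum>k\<in>{m<..m + int n}. 2 powr (- real_of_int k))" by (simp add: sum_ennreal)
  also have "\<dots> \<le> ennreal (2 powr (- real_of_int m))" unfolding tel by (intro ennreal_leI) simp
  finally show "(\<Sum>k\<in>F. ennreal (2 powr (- real_of_int k)) * indicator {m<..} k) \<le> ennreal (2 powr (- real_of_int m))" .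
qed

subsection \<open>The layer decomposition at the integrability exponent one\<close>

text \<open>Real values are needed for differences and minima. The default 0 for an infinite mean
  does not occur for locally integrable functions.\<close>

definition fav :: "(real^'n::finite \<Rightarrow> real) \<Rightarrow> int \<Rightarrow> real^'n \<Rightarrow> real" where
  "fav f k x = enn2real (dav k (\<lambda>y. ennreal \<bar>f y\<bar>) x)"

lemma fav_nonneg: "0 \<le> fav f k x" by (simp add: fav_def)

lemma fav_cong_cidx: "cidx k x = cidx k y \<Longrightarrow> fav f k x = fav f k y"
  by (simp add: fav_def dav_cong_cidx[of k x y])

lemma fav_measurable [measurable]: "fav f k \<in> borel_measurable borel"
  by (rule borel_measurable_cidx_invariant[of k]) (rule fav_cong_cidx)

text \<open>The factor is 2^d, the volume of a parent relative to its child, times 2, so that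
  Chebyshev's inequality on the parent leaves half of the child.\<close>

definition favmax :: "(real^'n::finite \<Rightarrow> real) \<Rightarrow> int \<Rightarrow> real^'n \<Rightarrow> real" where
  "favmax f k x = (SUP l\<in>{k..}. 2 ^ (CARD('n) + 1) * fav f l x)"

lemma favmax_cong_cidx:
  assumes "cidx k x = cidx k y" shows "favmax f k x = favmax f k y"
  unfolding favmax_def
proof (intro SUP_cong refl)
  fix l assume "l \<in> {k..}"
  hence "fav f l x = fav f l y" by (intro fav_cong_cidx cidx_mono[OF assms]) simp
  thus "2 ^ (CARD('a) + 1) * fav f l x = 2 ^ (CARD('a) + 1) * fav f l y" by (simp only:)
qed

lemma favmax_measurable [measurable]: "favmax f k \<in> borel_measurable borel"
  by (rule borel_measurable_cidx_invariant[of k]) (rule favmax_cong_cidx)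

definition layer :: "(real^'n::finite \<Rightarrow> real) \<Rightarrow> int \<Rightarrow> real^'n \<Rightarrow> real" where
  "layer f k x = min \<bar>f x\<bar> (favmax f k x) - min \<bar>f x\<bar> (favmax f (k + 1) x)"

lemma sum_layer:
  "(\<Sum>k\<in>{a..<a + int m}. layer f k x) = min \<bar>f x\<bar> (favmax f a x) - min \<bar>f x\<bar> (favmax f (a + int m) x)"
proof (induction m)
  case (Suc m)
  have "{a..<a + int (Suc m)} = insert (a + int m) {a..<a + int m}" by auto
  thus ?case using Suc by (simp add: layer_def add.commute add.left_commute)
qed simp

text \<open>This is all that the argument at exponent one uses of f. A BV function satisfies it with
  V its variation, and a function in W^{1,1} with V the integral of the norm of its
  gradient.\<close>

locale L1_modulus =
  fixes f :: "real^'n::finite \<Rightarrow> real" and V :: real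
  assumes f_int: "integrable lborel f"
    and V_nonneg: "0 \<le> V"
    and modulus: "\<And>w. (\<integral>\<^sup>+ x. ennreal \<bar>f (x + w) - f x\<bar> \<partial>lborel) \<le> ennreal (norm w * V)"
begin

lemma f_meas [measurable]: "f \<in> borel_measurable borel"
  using borel_measurable_integrable[OF f_int] by simp

lemma dav_le: "dav k (\<lambda>y. ennreal \<bar>f y\<bar>) x \<le> ennreal ((\<integral>x. \<bar>f x\<bar> \<partial>lborel) * 2 powr (- real_of_int k * real CARD('n)))"
proof -
  have "dav k (\<lambda>y. ennreal \<bar>f y\<bar>) x \<le> (\<integral>\<^sup>+ x. ennreal \<bar>f x\<bar> \<partial>lborel) / ennreal (2 powr (real_of_int k * real CARD('n)))"
    unfolding dav_def by (intro divide_right_mono_ennreal nn_integral_mono) (auto simp: indicator_def)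
  also have "(\<integral>\<^sup>+ x. ennreal \<bar>f x\<bar> \<partial>lborel) = ennreal (\<integral>x. \<bar>f x\<bar> \<partial>lborel)"
    using f_int by (intro nn_integral_eq_integral) auto
  also have "\<dots> / ennreal (2 powr (real_of_int k * real CARD('n))) = ennreal ((\<integral>x. \<bar>f x\<bar> \<partial>lborel) * 2 powr (- real_of_int k * real CARD('n)))"
    by (simp add: divide_ennreal powr_minus divide_inverse)
  finally show ?thesis .
qed

lemma ennreal_fav: "ennreal (fav f k x) = dav k (\<lambda>y. ennreal \<bar>f y\<bar>) x"
  unfolding fav_def using dav_le[of k x] by (intro ennreal_enn2real) (auto simp: less_top intro: le_less_trans)

lemma fav_le: "fav f k x \<le> (\<integral>x. \<bar>f x\<bar> \<partial>lborel) * 2 powr (- real_of_int k * real CARD('n))"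
  using dav_le[of k x] unfolding ennreal_fav[symmetric]
  by (subst (asm) ennreal_le_iff) auto

text \<open>Each mean is at most the full L1 norm over the volume of the cube, which decreases in
  the scale. Only with this bound does the real supremum in \<open>favmax\<close> have its intended
  value.\<close>

lemma bdd_fav: "bdd_above ((\<lambda>l. 2 ^ (CARD('n) + 1) * fav f l x) ` {k..})"
proof (rule bdd_aboveI2)
  fix l assume "l \<in> {k..}"
  hence "2 powr (- real_of_int l * real CARD('n)) \<le> 2 powr (- real_of_int k * real CARD('n))"
    by (intro powr_mono) (auto intro!: mult_right_mono)
  hence "(\<integral>x. \<bar>f x\<bar> \<partial>lborel) * 2 powr (- real_of_int l * real CARD('n)) \<le> (\<integral>x. \<bar>f x\<bar> \<partial>lborel) * 2 powr (- real_of_int k * real CARD('n))"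
    by (intro mult_left_mono) auto
  with fav_le[of l x] show "2 ^ (CARD('n) + 1) * fav f l x \<le> 2 ^ (CARD('n) + 1) * ((\<integral>x. \<bar>f x\<bar> \<partial>lborel) * 2 powr (- real_of_int k * real CARD('n)))"
    by (intro mult_left_mono) auto
qed

lemma favmax_ge: "k \<le> l \<Longrightarrow> 2 ^ (CARD('n) + 1) * fav f l x \<le> favmax f k x"
  unfolding favmax_def by (rule cSUP_upper[OF _ bdd_fav]) auto

lemma favmax_nonneg: "0 \<le> favmax f k x"
  using favmax_ge[of k k x] fav_nonneg[of f k x] by (auto intro: order_trans[rotated])

lemma favmax_antimono: "k \<le> l \<Longrightarrow> favmax f l x \<le> favmax f k x"
  unfolding favmax_def by (rule cSUP_subset_mono[OF _ bdd_fav]) auto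

lemma favmax_leI: "(\<And>l. k \<le> l \<Longrightarrow> 2 ^ (CARD('n) + 1) * fav f l x \<le> c) \<Longrightarrow> favmax f k x \<le> c"
  unfolding favmax_def by (rule cSUP_least) auto

lemma layer_nonneg: "0 \<le> layer f k x"
  using favmax_antimono[of k "k+1" x] by (auto simp: layer_def min_def)

lemma layer_measurable [measurable]: "layer f k \<in> borel_measurable borel"
  unfolding layer_def by measurable

text \<open>Chebyshev on the parent: the threshold T is at least 2^(d+1) times the mean there, so T
  times the measure of the superlevel set is at most the integral over the parent, that is, the mean
  times 2^d 2^(k d), which is at most T 2^(k d) / 2.\<close>

lemma emeasure_superlevel:
  "emeasure lborel {y. cidx k y = cidx k x \<and> favmax f (k+1) x < \<bar>f y\<bar>} \<le> ennreal (2 powr (real_of_int k * real CARD('n)) / 2)"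
proof -
  define T where "T = favmax f (k+1) x"
  let ?S = "{y. cidx k y = cidx k x \<and> T < \<bar>f y\<bar>}"
  let ?v = "2 powr (real_of_int (k+1) * real CARD('n))"
  have v: "?v = 2 powr (real_of_int k * real CARD('n)) * 2 ^ CARD('n)"
    by (simp add: ring_distribs powr_add powr_realpow)
  have T0: "T \<ge> 0" unfolding T_def by (rule favmax_nonneg)
  have Tge: "2 ^ (CARD('n) + 1) * fav f (k+1) x \<le> T" unfolding T_def by (rule favmax_ge) simp
  have int: "(\<integral>\<^sup>+ y. ennreal \<bar>f y\<bar> * indicator {y. cidx (k+1) y = cidx (k+1) x} y \<partial>lborel) = ennreal (fav f (k+1) x * ?v)"
  proof -
    have "(\<integral>\<^sup>+ y. ennreal \<bar>f y\<bar> * indicator {y. cidx (k+1) y = cidx (k+1) x} y \<partial>lborel) = dav (k+1) (\<lambda>y. ennreal \<bar>f y\<bar>) x * ennreal ?v"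
      unfolding dav_def by (subst ennreal_divide_times) (simp add: ennreal_mult_divide_eq)
    also have "\<dots> = ennreal (fav f (k+1) x) * ennreal ?v" by (simp add: ennreal_fav)
    finally show ?thesis by (simp add: ennreal_mult fav_nonneg)
  qed
  have [measurable]: "?S \<in> sets borel" by measurable
  show ?thesis
  proof (cases "T = 0")
    \<comment> \<open>Chebyshev is void for T = 0. Instead the mean over the parent vanishes, and so
      does f almost everywhere on it.\<close>
    case True
    hence "2 ^ (CARD('n) + 1) * fav f (k+1) x \<le> 0" using Tge by (simp only:)
    moreover have "0 < 2 ^ (CARD('n) + 1) * fav f (k+1) x" if "0 < fav f (k+1) x" using that by simp
    ultimately have "\<not> 0 < fav f (k+1) x" by (meson not_le)
    hence "fav f (k+1) x = 0" using fav_nonneg[of f "k+1" x] by linarith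
    hence "(\<integral>\<^sup>+ y. ennreal \<bar>f y\<bar> * indicator {y. cidx (k+1) y = cidx (k+1) x} y \<partial>lborel) = 0"
      using int by simp
    hence "AE y in lborel. ennreal \<bar>f y\<bar> * indicator {y. cidx (k+1) y = cidx (k+1) x} y = 0"
      by (subst (asm) nn_integral_0_iff_AE) simp_all
    hence "AE y in lborel. y \<notin> ?S"
    proof eventually_elim
      case (elim y)
      show "y \<notin> ?S"
      proof
        assume y: "y \<in> ?S"
        hence "cidx (k+1) y = cidx (k+1) x" by (auto intro: cidx_mono[of k y x])
        thus False using elim y True by simp
      qed
    qed
    hence "emeasure lborel ?S = 0" by (subst (asm) AE_iff_measurable[where N="?S"]) auto
    thus ?thesis by (simp add: T_def)
  next
    case False
    hence T: "T > 0" using T0 by simp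
    have "ennreal T * emeasure lborel ?S = (\<integral>\<^sup>+ y. ennreal T * indicator ?S y \<partial>lborel)"
      by (simp add: nn_integral_cmult_indicator)
    also have "\<dots> \<le> (\<integral>\<^sup>+ y. ennreal \<bar>f y\<bar> * indicator {y. cidx (k+1) y = cidx (k+1) x} y \<partial>lborel)"
    proof (intro nn_integral_mono)
      fix y
      show "ennreal T * indicator ?S y \<le> ennreal \<bar>f y\<bar> * indicator {y. cidx (k+1) y = cidx (k+1) x} y"
      proof (cases "y \<in> ?S")
        case True
        hence "cidx (k+1) y = cidx (k+1) x" by (auto intro: cidx_mono[of k y x])
        thus ?thesis using True by (auto intro!: ennreal_leI)
      qed simp
    qed
    also have "\<dots> = ennreal (fav f (k+1) x * ?v)" by (rule int)
    also have "\<dots> \<le> ennreal (T * (2 powr (real_of_int k * real CARD('n)) / 2))"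
    proof (rule ennreal_leI)
      have "fav f (k+1) x * ?v = 2 ^ (CARD('n) + 1) * fav f (k+1) x * (2 powr (real_of_int k * real CARD('n)) / 2)"
        unfolding v by simp
      also have "\<dots> \<le> T * (2 powr (real_of_int k * real CARD('n)) / 2)"
        by (rule mult_right_mono[OF Tge]) simp
      finally show "fav f (k+1) x * ?v \<le> T * (2 powr (real_of_int k * real CARD('n)) / 2)" .
    qed
    also have "\<dots> = ennreal T * ennreal (2 powr (real_of_int k * real CARD('n)) / 2)" 
      using T by (intro ennreal_mult) simp_all
    finally show ?thesis using T by (simp add: T_def ennreal_mult_le_mult_iff)
  qed
qed

text \<open>Where |f| is at most N_{k+1}, both minima in the layer equal |f| and the layer is 0. The
  threshold is the same for the whole cube, this set fills at least half of it, and there the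
  oscillation against x is the full value of the layer at x.\<close>

lemma layer_le_dav: "ennreal (layer f k x) \<le> 2 * dav k (\<lambda>y. ennreal \<bar>layer f k y - layer f k x\<bar>) x"
proof -
  define T where "T = favmax f (k+1) x"
  let ?v = "2 powr (real_of_int k * real CARD('n))"
  let ?S = "{y. cidx k y = cidx k x \<and> T < \<bar>f y\<bar>}" and ?G = "{y. cidx k y = cidx k x \<and> \<bar>f y\<bar> \<le> T}"
  have [measurable]: "?S \<in> sets borel" "?G \<in> sets borel" by measurable
  have "dcube k (cidx k x) \<subseteq> ?S \<union> ?G" by (auto simp: mem_dcube_iff)
  hence "emeasure lborel (dcube k (cidx k x)) \<le> emeasure lborel (?S \<union> ?G)"
    by (rule emeasure_mono) simp
  also have "\<dots> \<le> emeasure lborel ?S + emeasure lborel ?G"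
    by (rule emeasure_subadditive) simp_all
  also have "\<dots> \<le> ennreal (?v / 2) + emeasure lborel ?G"
    using emeasure_superlevel[of k x] unfolding T_def by (rule add_right_mono)
  finally have "ennreal ?v \<le> ennreal (?v / 2) + emeasure lborel ?G" by (simp only: emeasure_dcube)
  moreover have "ennreal ?v = ennreal (?v / 2) + ennreal (?v / 2)"
    by (simp flip: ennreal_plus)
  ultimately have G: "ennreal (?v / 2) \<le> emeasure lborel ?G"
    unfolding ennreal_add_left_cancel_le by auto
  have "ennreal (layer f k x) * ennreal (?v / 2) \<le> ennreal (layer f k x) * emeasure lborel ?G"
    by (rule mult_left_mono[OF G]) simp
  also have "\<dots> = (\<integral>\<^sup>+ y. ennreal (layer f k x) * indicator ?G y \<partial>lborel)"
    by (simp add: nn_integral_cmult_indicator)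
  also have "\<dots> \<le> (\<integral>\<^sup>+ y. ennreal \<bar>layer f k y - layer f k x\<bar> * indicator {y. cidx k y = cidx k x} y \<partial>lborel)"
  proof (intro nn_integral_mono)
    fix y
    show "ennreal (layer f k x) * indicator ?G y \<le> ennreal \<bar>layer f k y - layer f k x\<bar> * indicator {y. cidx k y = cidx k x} y"
    proof (cases "y \<in> ?G")
      case True
      hence "cidx (k+1) y = cidx (k+1) x" by (auto intro: cidx_mono[of k y x])
      hence "favmax f (k+1) y = T" unfolding T_def by (rule favmax_cong_cidx)
      hence "layer f k y = 0" using True favmax_antimono[of k "k+1" y] by (auto simp: layer_def min_def)
      thus ?thesis using True layer_nonneg[of k x] by simp
    qed simp
  qed
  also have "\<dots> = dav k (\<lambda>y. ennreal \<bar>layer f k y - layer f k x\<bar>) x * ennreal ?v"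
    unfolding dav_def by (subst ennreal_divide_times) (simp add: ennreal_mult_divide_eq)
  also have "\<dots> = 2 * dav k (\<lambda>y. ennreal \<bar>layer f k y - layer f k x\<bar>) x * ennreal (?v / 2)"
  proof -
    have "ennreal ?v = 2 * ennreal (?v / 2)"
      by (subst ennreal_numeral[symmetric], subst ennreal_mult[symmetric]) auto
    thus ?thesis by (simp only: mult_ac)
  qed
  finally have "ennreal (?v / 2) * ennreal (layer f k x) \<le> ennreal (?v / 2) * (2 * dav k (\<lambda>y. ennreal \<bar>layer f k y - layer f k x\<bar>) x)"
    by (simp only: mult.commute[of "ennreal (?v / 2)"])
  thus ?thesis by (subst (asm) ennreal_mult_le_mult_iff) simp_all
qed

text \<open>The layers telescope, and each is a nondecreasing function of the value of \<open>\<bar>f\<bar>\<close> with parameters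
  that agree on common cubes; hence their increments add up without overcounting.\<close>
lemma sum_layer_diff_le:
  assumes "finite K"
  shows "(\<Sum>k\<in>K. \<bar>layer f k x - layer f k y\<bar> * of_bool (cidx k x = cidx k y)) \<le> \<bar>f x - f y\<bar>"
proof -
  have main: "(\<Sum>k\<in>K. \<bar>layer f k x - layer f k y\<bar> * of_bool (cidx k x = cidx k y)) \<le> \<bar>f x\<bar> - \<bar>f y\<bar>"
    if le: "\<bar>f y\<bar> \<le> \<bar>f x\<bar>" for x y
  proof (cases "K \<inter> {k. cidx k x = cidx k y} = {}")
    case True
    hence "(\<Sum>k\<in>K. \<bar>layer f k x - layer f k y\<bar> * of_bool (cidx k x = cidx k y)) = 0"
      by (intro sum.neutral) auto
    thus ?thesis using le by simp
  next
    case False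
    define K' where "K' = K \<inter> {k. cidx k x = cidx k y}"
    \<comment> \<open>From the finest common scale in K on, the two points share all values of
      \<open>favmax\<close>, so all increments of layers have one sign. Filling the gaps of K' only
      adds nonnegative terms and makes the sum telescope.\<close>
    define a where "a = Min K'"
    define n where "n = nat (Max K' + 1 - a)"
    have fin: "finite K'" "K' \<noteq> {}" using assms False by (auto simp: K'_def)
    have a: "cidx a x = cidx a y" using Min_in[OF fin] by (auto simp: a_def K'_def)
    have same: "favmax f k x = favmax f k y" if "a \<le> k" for k
      using favmax_cong_cidx[OF cidx_mono[OF a that]] .
    have pos: "layer f k y \<le> layer f k x" if "a \<le> k" for k
      using same[of k] same[of "k+1"] that le favmax_antimono[of k "k+1" x] by (auto simp: layer_def min_def)
    have sub: "K' \<subseteq> {a..<a + int n}"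
    proof
      fix k assume "k \<in> K'"
      hence "a \<le> k" "k \<le> Max K'" using fin by (auto simp: a_def)
      thus "k \<in> {a..<a + int n}" by (simp add: n_def)
    qed
    have "(\<Sum>k\<in>K. \<bar>layer f k x - layer f k y\<bar> * of_bool (cidx k x = cidx k y)) = (\<Sum>k\<in>K'. \<bar>layer f k x - layer f k y\<bar>)"
      using assms by (intro sum.mono_neutral_cong_right) (auto simp: K'_def)
    also have "\<dots> \<le> (\<Sum>k\<in>{a..<a + int n}. \<bar>layer f k x - layer f k y\<bar>)"
      by (rule sum_mono2) (use sub in auto)
    also have "\<dots> = (\<Sum>k\<in>{a..<a + int n}. layer f k x - layer f k y)"
      using pos by (intro sum.cong) auto
    \<comment> \<open>Truncation at a fixed level is nondecreasing and 1-Lipschitz: the truncated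
      increment at the first scale is at most that of |f|, and the one subtracted at the last scale
      is nonnegative.\<close>
    also have "\<dots> \<le> \<bar>f x\<bar> - \<bar>f y\<bar>"
      unfolding sum_subtractf sum_layer using same[of a] same[of "a + int n"] le by (auto simp: min_def)
    finally show ?thesis .
  qed
  show ?thesis
  proof (cases "\<bar>f y\<bar> \<le> \<bar>f x\<bar>")
    case True
    thus ?thesis using main[OF True] by linarith
  next
    case False
    thus ?thesis using main[of x y] by (simp add: abs_minus_commute eq_commute[of "cidx _ x"])
  qed
qed

section \<open>Increments of the layers under translation\<close>

definition incr :: "int \<Rightarrow> real^'n \<Rightarrow> ennreal" where
  "incr k w = (\<integral>\<^sup>+ x. ennreal \<bar>layer f k (x + w) - layer f k x\<bar> * indicator {x. cidx k x = cidx k (x + w)} x \<partial>lborel)"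

text \<open>The triangle inequality along x, x + w, ..., x + n w. Only pairs in one cube are
  counted, and convexity puts the intermediate points into the same cube, so every link of the chain
  is counted as well.\<close>

lemma incr_scale: "incr k (real n *\<^sub>R w) \<le> of_nat n * incr k w"
proof (induction n)
  case (Suc n)
  let ?v = "real n *\<^sub>R w"
  let ?h = "\<lambda>x. ennreal \<bar>layer f k (x + w) - layer f k x\<bar> * indicator {x. cidx k x = cidx k (x + w)} x"
  have Sn: "real (Suc n) *\<^sub>R w = ?v + w" by (simp add: scaleR_left_distrib add.commute)
  have "incr k (real (Suc n) *\<^sub>R w) \<le> (\<integral>\<^sup>+ x. (ennreal \<bar>layer f k (x + ?v) - layer f k x\<bar> * indicator {x. cidx k x = cidx k (x + ?v)} x + ?h (x + ?v)) \<partial>lborel)"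
    unfolding incr_def
  proof (intro nn_integral_mono)
    fix x
    show "ennreal \<bar>layer f k (x + real (Suc n) *\<^sub>R w) - layer f k x\<bar> * indicator {x. cidx k x = cidx k (x + real (Suc n) *\<^sub>R w)} x
      \<le> ennreal \<bar>layer f k (x + ?v) - layer f k x\<bar> * indicator {x. cidx k x = cidx k (x + ?v)} x + ?h (x + ?v)"
    proof (cases "cidx k x = cidx k (x + real (Suc n) *\<^sub>R w)")
      case True
      have "cidx k (x + (real n / real (Suc n)) *\<^sub>R (real (Suc n) *\<^sub>R w)) = cidx k x"
        by (rule cidx_convex[OF True]) (auto simp: divide_simps)
      hence 1: "cidx k x = cidx k (x + ?v)" by (simp del: of_nat_Suc)
      have 2: "x + ?v + w = x + real (Suc n) *\<^sub>R w" unfolding Sn by simp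
      show ?thesis using True 1 by (simp add: 2 ennreal_plus[symmetric] del: of_nat_Suc ennreal_plus)
    qed simp
  qed
  also have "\<dots> = incr k ?v + (\<integral>\<^sup>+ x. ?h (x + ?v) \<partial>lborel)"
    unfolding incr_def by (rule nn_integral_add) measurable
  also have "(\<integral>\<^sup>+ x. ?h (x + ?v) \<partial>lborel) = incr k w"
    unfolding incr_def by (rule nn_integral_lborel_translate) measurable
  also have "incr k ?v + incr k w \<le> of_nat (Suc n) * incr k w" using Suc by (simp add: ring_distribs add.commute add_mono)
  finally show ?case .
qed (simp add: incr_def)

lemma incr_measurable [measurable]: "incr k \<in> borel_measurable borel"
  unfolding incr_def by measurable

text \<open>For one fixed step w the pointwise bound on the layers shows that all scales together
  cost a single modulus of f. The next lemma has to cope with steps that vary with the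
  scale.\<close>

lemma sum_incr_le:
  assumes "finite K" shows "(\<Sum>k\<in>K. incr k w) \<le> ennreal (norm w * V)"
proof -
  have "(\<Sum>k\<in>K. incr k w) = (\<integral>\<^sup>+ x. (\<Sum>k\<in>K. ennreal \<bar>layer f k (x + w) - layer f k x\<bar> * indicator {x. cidx k x = cidx k (x + w)} x) \<partial>lborel)"
    unfolding incr_def by (rule nn_integral_sum[symmetric]) measurable
  also have "\<dots> \<le> (\<integral>\<^sup>+ x. ennreal \<bar>f (x + w) - f x\<bar> \<partial>lborel)"
  proof (intro nn_integral_mono)
    fix x
    have "(\<Sum>k\<in>K. ennreal \<bar>layer f k (x + w) - layer f k x\<bar> * indicator {x. cidx k x = cidx k (x + w)} x)
       = (\<Sum>k\<in>K. ennreal (\<bar>layer f k (x + w) - layer f k x\<bar> * of_bool (cidx k (x + w) = cidx k x)))"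
      by (intro sum.cong) (auto simp: indicator_def)
    also have "\<dots> = ennreal (\<Sum>k\<in>K. \<bar>layer f k (x + w) - layer f k x\<bar> * of_bool (cidx k (x + w) = cidx k x))"
      by (rule sum_ennreal) auto
    also have "\<dots> \<le> ennreal \<bar>f (x + w) - f x\<bar>"
      by (intro ennreal_leI sum_layer_diff_le assms)
    finally show "(\<Sum>k\<in>K. ennreal \<bar>layer f k (x + w) - layer f k x\<bar> * indicator {x. cidx k x = cidx k (x + w)} x) \<le> ennreal \<bar>f (x + w) - f x\<bar>" .
  qed
  also have "\<dots> \<le> ennreal (norm w * V)" by (rule modulus)
  finally show ?thesis .
qed

text \<open>All scales are compared with one common step \<open>2\<^sup>-\<^sup>m u\<close>, of which \<open>2\<^sup>k u\<close> is an integer multiple.\<close>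
lemma sum_scaled_incr_le:
  assumes "finite K"
  shows "(\<Sum>k\<in>K. ennreal (2 powr (- real_of_int k)) * incr k (2 powr real_of_int k *\<^sub>R u)) \<le> ennreal (norm u * V)"
proof -
  \<comment> \<open>K is finite, so a single m makes k + m a natural number for all its
    scales.\<close>
  define m where "m = nat (- Min (insert 0 K))"
  have m: "0 \<le> k + int m" if "k \<in> K" for k
  proof -
    have "Min (insert 0 K) \<le> k" using assms that by (intro Min_le) auto
    thus ?thesis by (simp add: m_def)
  qed
  let ?w = "2 powr (- real m) *\<^sub>R u"
  have "(\<Sum>k\<in>K. ennreal (2 powr (- real_of_int k)) * incr k (2 powr real_of_int k *\<^sub>R u))
      \<le> (\<Sum>k\<in>K. ennreal (2 powr real m) * incr k ?w)"
  proof (intro sum_mono)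
    fix k assume "k \<in> K"
    define n where "n = nat (k + int m)"
    have n: "real n = real_of_int k + real m" using m[OF \<open>k \<in> K\<close>] by (simp add: n_def)
    have e: "real (2 ^ n) = 2 powr (real_of_int k + real m)"
      by (simp add: n[symmetric] powr_realpow)
    have "2 powr real_of_int k *\<^sub>R u = real (2 ^ n) *\<^sub>R ?w"
      unfolding e by (simp add: powr_add[symmetric])
    hence "incr k (2 powr real_of_int k *\<^sub>R u) \<le> of_nat (2 ^ n) * incr k ?w" using incr_scale by metis
    hence "ennreal (2 powr (- real_of_int k)) * incr k (2 powr real_of_int k *\<^sub>R u) \<le> ennreal (2 powr (- real_of_int k)) * (of_nat (2 ^ n) * incr k ?w)"
      by (rule mult_left_mono) simp
    also have "\<dots> = ennreal (2 powr (- real_of_int k) * real (2 ^ n)) * incr k ?w"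
      by (simp only: ennreal_mult ennreal_of_nat_eq_real_of_nat powr_ge_zero of_nat_0_le_iff mult.assoc)
    \<comment> \<open>The weight 2^(-k) cancels the multiplicity 2^(k+m) up to 2^m. This factor is
      the same for all k and is undone by the length 2^(-m) of the common step.\<close>
    also have "2 powr (- real_of_int k) * real (2 ^ n) = 2 powr real m"
      unfolding e by (simp add: powr_add[symmetric])
    finally show "ennreal (2 powr (- real_of_int k)) * incr k (2 powr real_of_int k *\<^sub>R u) \<le> ennreal (2 powr real m) * incr k ?w" .
  qed
  also have "\<dots> = ennreal (2 powr real m) * (\<Sum>k\<in>K. incr k ?w)" by (simp add: sum_distrib_left)
  also have "\<dots> \<le> ennreal (2 powr real m) * ennreal (norm ?w * V)"
    by (intro mult_left_mono sum_incr_le assms) simp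
  also have "\<dots> = ennreal (norm u * V)"
    using V_nonneg by (simp add: ennreal_mult[symmetric] mult.assoc[symmetric] powr_add[symmetric])
  finally show ?thesis .
qed

text \<open>The weight 2^(-k) fits because displacements within cubes of side 2^k are of the form
  2^k u, and for fixed u the weighted increments sum to at most V times the norm of u. In the
  constant, 2 comes from the vanishing on only half of a cube, 2^d is the volume of [-1, 1]^d, and d
  bounds the norm on it.\<close>

lemma nn_integral_layers_le:
  "(\<integral>\<^sup>+ k. ennreal (2 powr (- real_of_int k)) * (\<integral>\<^sup>+ x. ennreal (layer f k x) \<partial>lborel) \<partial>count_space UNIV)
    \<le> ennreal (2 * 2 ^ CARD('n) * real CARD('n) * V)"
proof (rule nn_integral_count_space_le)
  fix K :: "int set" assume K: "finite K"
  have "(\<integral>\<^sup>+ x. ennreal (layer f k x) \<partial>lborel) \<le> 2 * (\<integral>\<^sup>+ u. incr k (2 powr real_of_int k *\<^sub>R u) * indicator (cbox (- 1) 1) u \<partial>lborel)" for k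
  proof -
    have [measurable]: "(\<lambda>p. ennreal \<bar>layer f k (snd p) - layer f k (fst p)\<bar>) \<in> borel_measurable borel"
      by (subst borel_prod[symmetric]) measurable
    have [measurable]: "(\<lambda>x. dav k (\<lambda>y. ennreal \<bar>layer f k y - layer f k x\<bar>) x) \<in> borel_measurable borel"
      unfolding dav_def by measurable
    have "(\<integral>\<^sup>+ x. ennreal (layer f k x) \<partial>lborel) \<le> (\<integral>\<^sup>+ x. 2 * dav k (\<lambda>y. ennreal \<bar>layer f k y - layer f k x\<bar>) x \<partial>lborel)"
      by (intro nn_integral_mono layer_le_dav)
    also have "\<dots> = 2 * (\<integral>\<^sup>+ x. dav k (\<lambda>y. ennreal \<bar>layer f k y - layer f k x\<bar>) x \<partial>lborel)"
      by (rule nn_integral_cmult) measurable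
    also have "(\<integral>\<^sup>+ x. dav k (\<lambda>y. ennreal \<bar>layer f k y - layer f k x\<bar>) x \<partial>lborel) \<le> (\<integral>\<^sup>+ u. incr k (2 powr real_of_int k *\<^sub>R u) * indicator (cbox (- 1) 1) u \<partial>lborel)"
      unfolding incr_def by (rule nn_integral_dav_pair) measurable
    finally show ?thesis by (simp add: mult_left_mono)
  qed
  hence "(\<Sum>k\<in>K. ennreal (2 powr (- real_of_int k)) * (\<integral>\<^sup>+ x. ennreal (layer f k x) \<partial>lborel))
     \<le> (\<Sum>k\<in>K. ennreal (2 powr (- real_of_int k)) * (2 * (\<integral>\<^sup>+ u. incr k (2 powr real_of_int k *\<^sub>R u) * indicator (cbox (- 1) 1) u \<partial>lborel)))"
    by (intro sum_mono mult_left_mono) auto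
  also have "\<dots> = 2 * (\<Sum>k\<in>K. \<integral>\<^sup>+ u. ennreal (2 powr (- real_of_int k)) * incr k (2 powr real_of_int k *\<^sub>R u) * indicator (cbox (- 1) 1) u \<partial>lborel)"
    by (simp add: nn_integral_cmult sum_distrib_left mult.assoc mult.left_commute)
  also have "\<dots> = 2 * (\<integral>\<^sup>+ u. (\<Sum>k\<in>K. ennreal (2 powr (- real_of_int k)) * incr k (2 powr real_of_int k *\<^sub>R u)) * indicator (cbox (- 1) 1) u \<partial>lborel)"
    by (subst nn_integral_sum[symmetric]) (auto simp: sum_distrib_right)
  also have "\<dots> \<le> 2 * (ennreal (2 ^ CARD('n)) * ennreal (real CARD('n) * V))"
  proof (intro mult_left_mono nn_integral_cbox_le)
    fix u :: "real^'n" assume "u \<in> cbox (- 1) 1"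
    thus "(\<Sum>k\<in>K. ennreal (2 powr (- real_of_int k)) * incr k (2 powr real_of_int k *\<^sub>R u)) \<le> ennreal (real CARD('n) * V)"
      by (intro order_trans[OF sum_scaled_incr_le[OF K]] ennreal_leI mult_right_mono norm_le_card_cbox V_nonneg)
  qed simp
  also have "\<dots> = ennreal (2 * 2 ^ CARD('n) * real CARD('n) * V)"
    using V_nonneg by (simp add: ennreal_mult mult.assoc)
  finally show "(\<Sum>k\<in>K. ennreal (2 powr (- real_of_int k)) * (\<integral>\<^sup>+ x. ennreal (layer f k x) \<partial>lborel)) \<le> ennreal (2 * 2 ^ CARD('n) * real CARD('n) * V)" .
qed

text \<open>After weighting by 2^(-k) the oscillation of f itself costs a multiple of V at every
  scale, so it cannot be summed. It serves only in the limit of small cubes.\<close>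

lemma nn_integral_osc_le:
  "(\<integral>\<^sup>+ x. dav k (\<lambda>y. ennreal \<bar>f y - f x\<bar>) x \<partial>lborel) \<le> ennreal (2 ^ CARD('n) * real CARD('n) * V * 2 powr real_of_int k)"
proof -
  let ?c = "2 powr real_of_int k"
  have [measurable]: "(\<lambda>p. ennreal \<bar>f (snd p) - f (fst p)\<bar>) \<in> borel_measurable borel"
    by (subst borel_prod[symmetric]) measurable
  have "(\<integral>\<^sup>+ x. dav k (\<lambda>y. ennreal \<bar>f y - f x\<bar>) x \<partial>lborel) \<le>
    (\<integral>\<^sup>+ u. (\<integral>\<^sup>+ x. ennreal \<bar>f (x + ?c *\<^sub>R u) - f x\<bar> *
        indicator {x. cidx k x = cidx k (x + ?c *\<^sub>R u)} x \<partial>lborel) * indicator (cbox (- 1) 1) u \<partial>lborel)"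
    by (rule nn_integral_dav_pair) measurable
  also have "\<dots> \<le> ennreal (2 ^ CARD('n)) * ennreal (?c * real CARD('n) * V)"
  proof (intro nn_integral_cbox_le)
    fix u :: "real^'n" assume u: "u \<in> cbox (- 1) 1"
    have "(\<integral>\<^sup>+ x. ennreal \<bar>f (x + ?c *\<^sub>R u) - f x\<bar> * indicator {x. cidx k x = cidx k (x + ?c *\<^sub>R u)} x \<partial>lborel)
      \<le> (\<integral>\<^sup>+ x. ennreal \<bar>f (x + ?c *\<^sub>R u) - f x\<bar> \<partial>lborel)"
      by (intro nn_integral_mono) (auto simp: indicator_def)
    also have "\<dots> \<le> ennreal (norm (?c *\<^sub>R u) * V)" by (rule modulus)
    also have "\<dots> \<le> ennreal (?c * real CARD('n) * V)"
      using norm_le_card_cbox[OF u] V_nonneg by (intro ennreal_leI mult_right_mono) auto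
    finally show "(\<integral>\<^sup>+ x. ennreal \<bar>f (x + ?c *\<^sub>R u) - f x\<bar> * indicator {x. cidx k x = cidx k (x + ?c *\<^sub>R u)} x \<partial>lborel) \<le> ennreal (?c * real CARD('n) * V)" .
  qed
  also have "\<dots> = ennreal (2 ^ CARD('n) * real CARD('n) * V * ?c)"
    using V_nonneg by (simp add: ennreal_mult[symmetric] mult_ac)
  finally show ?thesis .
qed

text \<open>A weak form of Lebesgue differentiation, drawn from the modulus. Where all means up to
  scale K stay below |f| / 2, the oscillation at each of these scales is at least |f| / 2, but its
  integral is O(2^k) and tends to 0 as k decreases.\<close>

lemma AE_ex_fav_ge: "AE x in lborel. \<forall>K. f x = 0 \<or> (\<exists>k\<le>K. \<bar>f x\<bar> / 2 \<le> fav f k x)"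
  unfolding AE_all_countable
proof
  fix K :: int
  define E where "E = {x. \<forall>k\<in>{..K}. fav f k x < \<bar>f x\<bar> / 2}"
  have [measurable]: "E \<in> sets borel" unfolding E_def by measurable
  let ?C = "2 ^ CARD('n) * real CARD('n) * V"
  have bound: "(\<integral>\<^sup>+ x. ennreal (\<bar>f x\<bar> / 2) * indicator E x \<partial>lborel) \<le> ennreal (?C * 2 powr real_of_int k)" if "k \<le> K" for k
  proof -
    have "(\<integral>\<^sup>+ x. ennreal (\<bar>f x\<bar> / 2) * indicator E x \<partial>lborel) \<le> (\<integral>\<^sup>+ x. dav k (\<lambda>y. ennreal \<bar>f y - f x\<bar>) x \<partial>lborel)"
    proof (intro nn_integral_mono)
      fix x
      show "ennreal (\<bar>f x\<bar> / 2) * indicator E x \<le> dav k (\<lambda>y. ennreal \<bar>f y - f x\<bar>) x"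
      proof (cases "x \<in> E")
        case True
        hence lt: "fav f k x < \<bar>f x\<bar> / 2" using that by (auto simp: E_def)
        have "ennreal \<bar>f x\<bar> = dav k (\<lambda>y. ennreal \<bar>f x\<bar>) x" by (simp add: dav_const)
        also have "\<dots> \<le> dav k (\<lambda>y. ennreal \<bar>f y\<bar> + ennreal \<bar>f y - f x\<bar>) x"
          by (intro dav_mono) (simp add: ennreal_plus[symmetric] del: ennreal_plus)
        also have "\<dots> = ennreal (fav f k x) + dav k (\<lambda>y. ennreal \<bar>f y - f x\<bar>) x"
          by (simp add: dav_add ennreal_fav)
        also have "\<dots> \<le> ennreal (\<bar>f x\<bar> / 2) + dav k (\<lambda>y. ennreal \<bar>f y - f x\<bar>) x"
          using lt by (intro add_right_mono ennreal_leI) simp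
        finally have "ennreal (\<bar>f x\<bar> / 2) + ennreal (\<bar>f x\<bar> / 2) \<le> ennreal (\<bar>f x\<bar> / 2) + dav k (\<lambda>y. ennreal \<bar>f y - f x\<bar>) x"
          by (simp add: ennreal_plus[symmetric] del: ennreal_plus)
        thus ?thesis using True unfolding ennreal_add_left_cancel_le by auto
      qed simp
    qed
    also have "\<dots> \<le> ennreal (?C * 2 powr real_of_int k)" by (rule nn_integral_osc_le)
    finally show ?thesis .
  qed
  have lim: "(\<lambda>n. ennreal (?C * 2 powr real_of_int K * (1/2) ^ n)) \<longlonglongrightarrow> ennreal 0"
  proof (rule tendsto_ennrealI)
    have "(\<lambda>n. ?C * 2 powr real_of_int K * (1/2) ^ n) \<longlonglongrightarrow> ?C * 2 powr real_of_int K * 0"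
      by (intro tendsto_intros LIMSEQ_power_zero) auto
    thus "(\<lambda>n. ?C * 2 powr real_of_int K * (1/2) ^ n) \<longlonglongrightarrow> 0" by simp
  qed
  have le: "(\<integral>\<^sup>+ x. ennreal (\<bar>f x\<bar> / 2) * indicator E x \<partial>lborel) \<le> ennreal (?C * 2 powr real_of_int K * (1/2) ^ n)" for n
  proof -
    have "2 powr real_of_int (K - int n) = 2 powr real_of_int K * (1/2) ^ n"
    proof -
      have "2 powr real_of_int (K - int n) = 2 powr real_of_int K / 2 powr real n" by (simp add: powr_diff)
      thus ?thesis by (simp add: powr_realpow power_one_over)
    qed
    thus ?thesis using bound[of "K - int n"] by (simp add: mult.assoc)
  qed
  have "(\<integral>\<^sup>+ x. ennreal (\<bar>f x\<bar> / 2) * indicator E x \<partial>lborel) \<le> ennreal 0"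
    by (rule tendsto_lowerbound[OF lim always_eventually[OF allI] sequentially_bot]) (rule le)
  hence "(\<integral>\<^sup>+ x. ennreal (\<bar>f x\<bar> / 2) * indicator E x \<partial>lborel) = 0" by simp
  hence ae: "AE x in lborel. ennreal (\<bar>f x\<bar> / 2) * indicator E x = 0"
    by (subst (asm) nn_integral_0_iff_AE) simp_all
  have in_E: "f x = 0" if "ennreal (\<bar>f x\<bar> / 2) * indicator E x = 0" "x \<in> E" for x
  proof -
    have "ennreal (\<bar>f x\<bar> / 2) = 0" using that by simp
    thus ?thesis unfolding ennreal_eq_0_iff by simp
  qed
  have not_in_E: "\<exists>k\<le>K. \<bar>f x\<bar> / 2 \<le> fav f k x" if "x \<notin> E" for x
  proof (rule ccontr)
    assume no: "\<not> (\<exists>k\<le>K. \<bar>f x\<bar> / 2 \<le> fav f k x)"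
    have "fav f k x < \<bar>f x\<bar> / 2" if "k \<in> {..K}" for k
    proof (rule ccontr)
      assume "\<not> fav f k x < \<bar>f x\<bar> / 2"
      hence "k \<le> K \<and> \<bar>f x\<bar> / 2 \<le> fav f k x" using that by simp
      thus False using no by blast
    qed
    thus False using \<open>x \<notin> E\<close> unfolding E_def by blast
  qed
  show "AE x in lborel. f x = 0 \<or> (\<exists>k\<le>K. \<bar>f x\<bar> / 2 \<le> fav f k x)"
    using ae
  proof eventually_elim
    fix x assume "ennreal (\<bar>f x\<bar> / 2) * indicator E x = 0"
    thus "f x = 0 \<or> (\<exists>k\<le>K. \<bar>f x\<bar> / 2 \<le> fav f k x)"
      using in_E[of x] not_in_E[of x] by argo
  qed
qed

text \<open>At a scale whose mean is at least |f| / 2 the maximum N_k is at least |f|. The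
  telescoping sum of layers therefore starts from the full value |f| and leaves exactly the part
  above N_K.\<close>

lemma AE_le_sum_layers:
  "AE x in lborel. \<forall>K. ennreal (max 0 (\<bar>f x\<bar> - favmax f K x)) \<le> (\<integral>\<^sup>+ k. ennreal (layer f k x) * indicator {..<K} k \<partial>count_space UNIV)"
  using AE_ex_fav_ge
proof eventually_elim
  case (elim x)
  show ?case
  proof
    fix K :: int
    show "ennreal (max 0 (\<bar>f x\<bar> - favmax f K x)) \<le> (\<integral>\<^sup>+ k. ennreal (layer f k x) * indicator {..<K} k \<partial>count_space UNIV)"
    proof (cases "f x = 0")
      case True
      thus ?thesis using favmax_nonneg[of K x] by simp
    next
      case False
      then obtain k where k: "k \<le> K" "\<bar>f x\<bar> / 2 \<le> fav f k x" using elim by blast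
      have "\<bar>f x\<bar> \<le> 2 * fav f k x" using k by simp
      also have "\<dots> \<le> 2 ^ (CARD('n) + 1) * fav f k x"
        by (intro mult_right_mono fav_nonneg) simp
      also have "\<dots> \<le> favmax f k x" by (rule favmax_ge) simp
      finally have ge: "\<bar>f x\<bar> \<le> favmax f k x" .
      define m where "m = nat (K - k)"
      have K: "K = k + int m" using k by (simp add: m_def)
      have "max 0 (\<bar>f x\<bar> - favmax f K x) = (\<Sum>l\<in>{k..<k + int m}. layer f l x)"
        using sum_layer[of f x k m] ge unfolding K[symmetric] by (simp add: min_def max_def)
      hence "ennreal (max 0 (\<bar>f x\<bar> - favmax f K x)) = (\<Sum>l\<in>{k..<K}. ennreal (layer f l x))"
        by (simp add: K sum_ennreal layer_nonneg)
      also have "\<dots> = (\<Sum>l\<in>{k..<K}. ennreal (layer f l x) * indicator {..<K} l)"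
        by (intro sum.cong) auto
      also have "\<dots> \<le> (\<integral>\<^sup>+ k. ennreal (layer f k x) * indicator {..<K} k \<partial>count_space UNIV)"
        by (intro sum_le_nn_integral_count_space) simp
      finally show ?thesis .
    qed
  qed
qed

text \<open>On the selected cubes the means have the same integral as |f|. There |f| is at most its
  excess over N_{k+n}, which consists of layers below k + n, plus N_{k+n}, which is at most half the
  mean and is absorbed into the left-hand side.\<close>

lemma nn_integral_fav_stopping_le:
  assumes "\<And>k l x. cidx k x \<in> J k \<Longrightarrow> k + int n \<le> l \<Longrightarrow> 2 ^ (CARD('n) + 1) * fav f l x \<le> fav f k x / 2"
  shows "(\<integral>\<^sup>+ x. ennreal (fav f k x) * indicator (J k) (cidx k x) \<partial>lborel) \<le>
     2 * (\<integral>\<^sup>+ l. (\<integral>\<^sup>+ x. ennreal (layer f l x) \<partial>lborel) * indicator {..<k + int n} l \<partial>count_space UNIV)"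
proof -
  let ?Z = "\<lambda>x. indicator (J k) (cidx k x) :: ennreal"
  have [measurable]: "(\<lambda>x. ?Z x) \<in> borel_measurable borel"
    by (rule measurable_compose[OF cidx_measurable]) simp
  let ?A = "\<integral>\<^sup>+ x. ennreal (fav f k x) * ?Z x \<partial>lborel"
  \<comment> \<open>The excess is integrated over the whole space and not only over the selected
    cubes. The weights 2^(-k) make this affordable when the scales are summed.\<close>
  let ?R = "\<integral>\<^sup>+ x. ennreal (max 0 (\<bar>f x\<bar> - favmax f (k + int n) x)) \<partial>lborel"
  have "?A = (\<integral>\<^sup>+ x. ?Z x * dav k (\<lambda>y. ennreal \<bar>f y\<bar>) x \<partial>lborel)"
    by (simp add: ennreal_fav mult.commute)
  also have "\<dots> = (\<integral>\<^sup>+ x. ?Z x * ennreal \<bar>f x\<bar> \<partial>lborel)" by (rule nn_integral_dav) measurable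
  finally have A: "?A = (\<integral>\<^sup>+ x. ?Z x * ennreal \<bar>f x\<bar> \<partial>lborel)" .
  \<comment> \<open>Absorbing half of the left-hand side requires that it is finite.\<close>
  have "?A \<le> (\<integral>\<^sup>+ x. ennreal \<bar>f x\<bar> \<partial>lborel)" unfolding A by (intro nn_integral_mono) (auto simp: indicator_def)
  also have "\<dots> < \<infinity>" using f_int by (simp add: integrable_iff_bounded)
  finally have fin: "?A < \<infinity>" .
  have "?A \<le> (\<integral>\<^sup>+ x. ennreal (max 0 (\<bar>f x\<bar> - favmax f (k + int n) x)) + ennreal (1 / 2) * (ennreal (fav f k x) * ?Z x) \<partial>lborel)"
    unfolding A
  proof (intro nn_integral_mono)
    fix x
    show "?Z x * ennreal \<bar>f x\<bar> \<le> ennreal (max 0 (\<bar>f x\<bar> - favmax f (k + int n) x)) + ennreal (1 / 2) * (ennreal (fav f k x) * ?Z x)"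
    proof (cases "cidx k x \<in> J k")
      case True
      have "favmax f (k + int n) x \<le> fav f k x / 2" by (intro favmax_leI assms True)
      hence "\<bar>f x\<bar> \<le> max 0 (\<bar>f x\<bar> - favmax f (k + int n) x) + (1/2) * fav f k x" by linarith
      hence "ennreal \<bar>f x\<bar> \<le> ennreal (max 0 (\<bar>f x\<bar> - favmax f (k + int n) x) + (1/2) * fav f k x)" by (rule ennreal_leI)
      also have "\<dots> = ennreal (max 0 (\<bar>f x\<bar> - favmax f (k + int n) x)) + ennreal (1/2) * ennreal (fav f k x)"
        using fav_nonneg[of f k x] by (subst ennreal_mult[symmetric], simp, simp, subst ennreal_plus[symmetric]) simp_all
      finally show ?thesis using True by simp
    qed simp
  qed
  also have "\<dots> = ?R + ennreal (1/2) * ?A"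
    by (subst nn_integral_add) (auto simp: nn_integral_cmult)
  finally have le: "?A \<le> ?R + ennreal (1/2) * ?A" .
  obtain a where a: "?A = ennreal a" "a \<ge> 0" using fin by (cases ?A) auto
  have "?A \<le> 2 * ?R"
  proof (cases ?R)
    case (real r)
    have "ennreal (1/2) * ?A = ennreal (a / 2)" unfolding a(1) using a(2) by (subst ennreal_mult[symmetric]) simp_all
    hence "ennreal a \<le> ennreal r + ennreal (a / 2)" using le unfolding real(2) a(1) by (simp only:)
    also have "\<dots> = ennreal (r + a / 2)" using real(1) a(2) by (subst ennreal_plus) simp_all
    finally have "a \<le> r + a / 2" using real(1) a(2) by (subst (asm) ennreal_le_iff) simp_all
    hence "a \<le> 2 * r" by simp
    hence "ennreal a \<le> ennreal (2 * r)" by (rule ennreal_leI)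
    thus ?thesis using real a by (simp add: ennreal_mult)
  next
    case top
    thus ?thesis by (simp add: ennreal_mult_top)
  qed
  also have "?R \<le> (\<integral>\<^sup>+ x. \<integral>\<^sup>+ l. ennreal (layer f l x) * indicator {..<k + int n} l \<partial>count_space UNIV \<partial>lborel)"
    using AE_le_sum_layers by (intro nn_integral_mono_AE) auto
  also have "\<dots> = (\<integral>\<^sup>+ l. (\<integral>\<^sup>+ x. ennreal (layer f l x) * indicator {..<k + int n} l \<partial>lborel) \<partial>count_space UNIV)"
    by (rule nn_integral_count_space_nn_integral) auto
  also have "\<dots> = (\<integral>\<^sup>+ l. (\<integral>\<^sup>+ x. ennreal (layer f l x) \<partial>lborel) * indicator {..<k + int n} l \<partial>count_space UNIV)"
    by (intro nn_integral_cong nn_integral_multc) auto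
  finally show ?thesis by (simp add: mult_left_mono)
qed

text \<open>After the sums are exchanged, the layer of index l is charged by every k > l - n with
  weight 2^(-k), in total by 2^(n-l). The selected cubes thus cost a factor 2^n over the weighted
  sum of the layers, besides the 2 from the absorption.\<close>

lemma nn_integral_stopping_sum_le:
  assumes "\<And>k l x. cidx k x \<in> J k \<Longrightarrow> k + int n \<le> l \<Longrightarrow> 2 ^ (CARD('n) + 1) * fav f l x \<le> fav f k x / 2"
  shows "(\<integral>\<^sup>+ x. \<integral>\<^sup>+ k. ennreal (2 powr (- real_of_int k)) * ennreal (fav f k x) * indicator (J k) (cidx k x) \<partial>count_space UNIV \<partial>lborel)
     \<le> ennreal (2 ^ n * 4 * 2 ^ CARD('n) * real CARD('n) * V)"
proof -
  have [measurable]: "(\<lambda>x. indicator (J k) (cidx k x) :: ennreal) \<in> borel_measurable borel" for k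
    by (rule measurable_compose[OF cidx_measurable]) simp
  let ?I = "\<lambda>l. \<integral>\<^sup>+ x. ennreal (layer f l x) \<partial>lborel"
  let ?c = "\<lambda>k. ennreal (2 powr (- real_of_int k))"
  have "(\<integral>\<^sup>+ x. \<integral>\<^sup>+ k. ?c k * ennreal (fav f k x) * indicator (J k) (cidx k x) \<partial>count_space UNIV \<partial>lborel)
     = (\<integral>\<^sup>+ k. \<integral>\<^sup>+ x. ?c k * ennreal (fav f k x) * indicator (J k) (cidx k x) \<partial>lborel \<partial>count_space UNIV)"
    by (rule nn_integral_count_space_nn_integral) auto
  also have "\<dots> = (\<integral>\<^sup>+ k. ?c k * (\<integral>\<^sup>+ x. ennreal (fav f k x) * indicator (J k) (cidx k x) \<partial>lborel) \<partial>count_space UNIV)"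
    by (intro nn_integral_cong) (simp add: nn_integral_cmult mult.assoc)
  also have "\<dots> \<le> (\<integral>\<^sup>+ k. ?c k * (2 * (\<integral>\<^sup>+ l. ?I l * indicator {..<k + int n} l \<partial>count_space UNIV)) \<partial>count_space UNIV)"
    by (intro nn_integral_mono mult_left_mono nn_integral_fav_stopping_le assms) auto
  also have "\<dots> = (\<integral>\<^sup>+ k. \<integral>\<^sup>+ l. 2 * ?I l * (?c k * indicator {l - int n<..} k) \<partial>count_space UNIV \<partial>count_space UNIV)"
  proof (intro nn_integral_cong)
    fix k
    have "?c k * (2 * (\<integral>\<^sup>+ l. ?I l * indicator {..<k + int n} l \<partial>count_space UNIV)) = (\<integral>\<^sup>+ l. ?c k * (2 * (?I l * indicator {..<k + int n} l)) \<partial>count_space UNIV)"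
      by (simp add: nn_integral_cmult)
    also have "\<dots> = (\<integral>\<^sup>+ l. 2 * ?I l * (?c k * indicator {l - int n<..} k) \<partial>count_space UNIV)"
      by (intro nn_integral_cong) (auto simp: indicator_def mult_ac)
    finally show "?c k * (2 * (\<integral>\<^sup>+ l. ?I l * indicator {..<k + int n} l \<partial>count_space UNIV)) = (\<integral>\<^sup>+ l. 2 * ?I l * (?c k * indicator {l - int n<..} k) \<partial>count_space UNIV)" .
  qed
  also have "\<dots> = (\<integral>\<^sup>+ l. \<integral>\<^sup>+ k. 2 * ?I l * (?c k * indicator {l - int n<..} k) \<partial>count_space UNIV \<partial>count_space UNIV)"
    by (rule nn_integral_count_space_nn_integral) auto
  also have "\<dots> = (\<integral>\<^sup>+ l. 2 * ?I l * (\<integral>\<^sup>+ k. ?c k * indicator {l - int n<..} k \<partial>count_space UNIV) \<partial>count_space UNIV)"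
    by (intro nn_integral_cong nn_integral_cmult) auto
  also have "\<dots> \<le> (\<integral>\<^sup>+ l. 2 * ?I l * ?c (l - int n) \<partial>count_space UNIV)"
    by (intro nn_integral_mono mult_left_mono nn_integral_int_geometric) auto
  also have "\<dots> = (\<integral>\<^sup>+ l. ennreal (2 * 2 ^ n) * (?c l * ?I l) \<partial>count_space UNIV)"
  proof (intro nn_integral_cong)
    fix l
    have "2 powr (- real_of_int (l - int n)) = 2 ^ n * 2 powr (- real_of_int l)"
      by (simp add: powr_diff powr_minus powr_realpow divide_inverse)
    thus "2 * ?I l * ?c (l - int n) = ennreal (2 * 2 ^ n) * (?c l * ?I l)"
      by (simp add: ennreal_mult mult_ac)
  qed
  also have "\<dots> = ennreal (2 * 2 ^ n) * (\<integral>\<^sup>+ l. ?c l * ?I l \<partial>count_space UNIV)" by (rule nn_integral_cmult) simp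
  also have "\<dots> \<le> ennreal (2 * 2 ^ n) * ennreal (2 * 2 ^ CARD('n) * real CARD('n) * V)"
    by (intro mult_left_mono nn_integral_layers_le) simp
  also have "\<dots> = ennreal (2 ^ n * 4 * 2 ^ CARD('n) * real CARD('n) * V)"
    using V_nonneg by (simp add: ennreal_mult[symmetric] mult_ac)
  finally show ?thesis .
qed

end

subsection \<open>Duality with smooth bumps\<close>

definition locally_integrable :: "('a::euclidean_space \<Rightarrow> real) \<Rightarrow> bool" where
  "locally_integrable f \<longleftrightarrow> f \<in> borel_measurable borel \<and> (\<forall>R. integrable lborel (\<lambda>x. f x * indicator (cball 0 R) x))"

lemma locally_integrable_measurable: "locally_integrable f \<Longrightarrow> f \<in> borel_measurable borel"
  by (simp add: locally_integrable_def)

lemma locally_integrable_mult: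
  assumes "locally_integrable f" "h \<in> borel_measurable borel" "\<And>x. \<bar>h x\<bar> \<le> B * indicator (cball 0 R) x"
  shows "integrable lborel (\<lambda>x. f x * h x)"
proof (rule Bochner_Integration.integrable_bound)
  show "integrable lborel (\<lambda>x. B * (f x * indicator (cball 0 R) x))"
    using assms(1) by (auto simp: locally_integrable_def)
  show "(\<lambda>x. f x * h x) \<in> borel_measurable lborel"
    using assms(1,2) by (auto simp: locally_integrable_def)
  show "AE x in lborel. norm (f x * h x) \<le> norm (B * (f x * indicator (cball 0 R) x))"
  proof (rule AE_I2)
    fix x
    have "\<bar>f x\<bar> * \<bar>h x\<bar> \<le> \<bar>f x\<bar> * \<bar>B * indicator (cball 0 R) x\<bar>"
      using assms(3)[of x] by (intro mult_left_mono) auto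
    thus "norm (f x * h x) \<le> norm (B * (f x * indicator (cball 0 R) x))"
      by (simp add: abs_mult mult_ac)
  qed
qed

lemma locally_integrable_mult_bump:
  assumes "locally_integrable f" "bump_test \<phi>"
  shows "integrable lborel (\<lambda>x. f x * \<phi> x)"
proof -
  obtain B R where "\<And>x. \<bar>\<phi> x\<bar> \<le> B * indicator (cball 0 R) x" using bump_test_bounded[OF assms(2)] by metis
  moreover have "\<phi> \<in> borel_measurable borel" using assms(2) by (simp add: bump_test_def bump_algebra_measurable)
  ultimately show ?thesis using locally_integrable_mult[OF assms(1)] by metis
qed

lemma locally_integrable_translate:
  assumes "locally_integrable f"
  shows "locally_integrable (\<lambda>x. f (x + w))"
  unfolding locally_integrable_def
proof (intro conjI allI)
  have [measurable]: "f \<in> borel_measurable borel" using assms by (rule locally_integrable_measurable)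
  have [measurable]: "cball (0::'a) r \<in> sets borel" for r by simp
  show "(\<lambda>x. f (x + w)) \<in> borel_measurable borel" by measurable
  fix R
  show "integrable lborel (\<lambda>x. f (x + w) * indicator (cball 0 R) x)"
  proof (rule Bochner_Integration.integrable_bound)
    have "integrable lborel (\<lambda>x. f x * indicator (cball 0 (R + norm w)) x)"
      using assms by (simp add: locally_integrable_def)
    thus "integrable lborel (\<lambda>x. f (x + w) * indicator (cball 0 (R + norm w)) (x + w))"
      by (rule integrable_lborel_translate)
    have sub: "norm (x + w) \<le> R + norm w" if "norm x \<le> R" for x
      using norm_triangle_ineq[of x w] that by linarith
    show "AE x in lborel. norm (f (x + w) * indicator (cball 0 R) x) \<le> norm (f (x + w) * indicator (cball 0 (R + norm w)) (x + w))"
      using sub by (intro AE_I2) (auto simp: indicator_def)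
  qed measurable
qed

lemma locally_integrable_diff:
  "locally_integrable f \<Longrightarrow> locally_integrable g \<Longrightarrow> locally_integrable (\<lambda>x. f x - g x)"
  by (auto simp: locally_integrable_def left_diff_distrib)

lemma locally_integrable_sum_cmult:
  assumes "\<And>i. i \<in> I \<Longrightarrow> locally_integrable (f i)"
  shows "locally_integrable (\<lambda>x. \<Sum>i\<in>I. c i * f i x)"
  unfolding locally_integrable_def
proof (intro conjI allI)
  show "(\<lambda>x. \<Sum>i\<in>I. c i * f i x) \<in> borel_measurable borel"
    using assms by (intro borel_measurable_sum borel_measurable_times) (auto simp: locally_integrable_def)
  fix R
  have "integrable lborel (\<lambda>x. \<Sum>i\<in>I. c i * (f i x * indicator (cball 0 R) x))"
    using assms by (intro Bochner_Integration.integrable_sum integrable_mult_right) (auto simp: locally_integrable_def)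
  thus "integrable lborel (\<lambda>x. (\<Sum>i\<in>I. c i * f i x) * indicator (cball 0 R) x)"
    by (simp add: sum_distrib_right mult.assoc)
qed

text \<open>Give the bump of each box the sign of the integral over that box. The boxes are
  disjoint, so the signed sum of bumps is bounded by 1 and admissible, and dominated convergence
  replaces the bumps by indicators.\<close>

lemma sum_abs_integral_boxes_le:
  fixes k :: "real^'n::finite \<Rightarrow> real"
  assumes k: "locally_integrable k"
    and dual: "\<And>\<phi>. bump_test \<phi> \<Longrightarrow> (\<And>x. \<bar>\<phi> x\<bar> \<le> 1) \<Longrightarrow> (\<integral>x. k x * \<phi> x \<partial>lborel) \<le> W"
    and J: "finite J" and disj: "disjoint_family_on (\<lambda>j. box (a j) (b j)) J"
  shows "(\<Sum>j\<in>J. \<bar>\<integral>x. k x * indicator (box (a j) (b j)) x \<partial>lborel\<bar>) \<le> W"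
proof -
  have [measurable]: "k \<in> borel_measurable borel" using k by (rule locally_integrable_measurable)
  define \<epsilon> where "\<epsilon> j = sgn (\<integral>x. k x * indicator (box (a j) (b j)) x \<partial>lborel)" for j
  define \<phi> where "\<phi> m x = (\<Sum>j\<in>J. \<epsilon> j * box_bump (real (Suc m)) (a j) (b j) x)" for m x
  have bt: "bump_test (\<phi> m)" for m
    unfolding \<phi>_def by (intro bump_test_sum bump_test_cmult box_bump_bump_test) simp
  have eps: "\<bar>\<epsilon> j\<bar> \<le> 1" for j by (auto simp: \<epsilon>_def sgn_if)
  let ?U = "\<Union>j\<in>J. box (a j) (b j)"
  have le: "\<bar>\<phi> m x\<bar> \<le> indicator ?U x" for m x
  proof -
    have "\<bar>\<phi> m x\<bar> \<le> (\<Sum>j\<in>J. \<bar>\<epsilon> j * box_bump (real (Suc m)) (a j) (b j) x\<bar>)"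
      unfolding \<phi>_def by (rule sum_abs)
    also have "\<dots> \<le> (\<Sum>j\<in>J. indicator (box (a j) (b j)) x)"
    proof (rule sum_mono)
      fix j
      have "\<bar>\<epsilon> j * box_bump (real (Suc m)) (a j) (b j) x\<bar> \<le> 1 * box_bump (real (Suc m)) (a j) (b j) x"
        unfolding abs_mult using eps[of j] box_bump_bounds(1)[of "real (Suc m)" "a j" "b j" x]
        by (intro mult_mono) auto
      also have "\<dots> \<le> indicator (box (a j) (b j)) x" using box_bump_bounds(2)[of "real (Suc m)" "a j" "b j" x] by simp
      finally show "\<bar>\<epsilon> j * box_bump (real (Suc m)) (a j) (b j) x\<bar> \<le> indicator (box (a j) (b j)) x" .
    qed
    also have "\<dots> = indicator ?U x" by (rule indicator_UN_disjoint[OF J disj, symmetric])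
    finally show ?thesis .
  qed
  have le1: "\<bar>\<phi> m x\<bar> \<le> 1" for m x
    by (rule order_trans[OF le]) (simp add: indicator_def)
  have "bounded ?U" using J by (intro bounded_UN) auto
  then obtain R where R: "?U \<subseteq> cball 0 R"
    using bounded_subset_ballD[of ?U 0] ball_subset_cball[of 0] by (meson order_trans)
  have "(\<lambda>m. \<integral>x. k x * \<phi> m x \<partial>lborel) \<longlonglongrightarrow> (\<integral>x. k x * (\<Sum>j\<in>J. \<epsilon> j * indicator (box (a j) (b j)) x) \<partial>lborel)"
  proof (rule integral_dominated_convergence[where w="\<lambda>x. \<bar>k x * indicator (cball 0 R) x\<bar>"])
    show "integrable lborel (\<lambda>x. \<bar>k x * indicator (cball 0 R) x\<bar>)"
      using k by (intro integrable_abs) (auto simp: locally_integrable_def)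
    show "(\<lambda>x. k x * \<phi> m x) \<in> borel_measurable lborel" for m
    proof -
      have [measurable]: "\<phi> m \<in> borel_measurable borel"
        using bt[of m] unfolding bump_test_def by (intro bump_algebra_measurable) simp
      show ?thesis by measurable
    qed
    show "AE x in lborel. (\<lambda>m. k x * \<phi> m x) \<longlonglongrightarrow> k x * (\<Sum>j\<in>J. \<epsilon> j * indicator (box (a j) (b j)) x)"
      unfolding \<phi>_def by (intro AE_I2 tendsto_mult_left tendsto_sum box_bump_tendsto)
    show "AE x in lborel. norm (k x * \<phi> m x) \<le> \<bar>k x * indicator (cball 0 R) x\<bar>" for m
    proof (rule AE_I2)
      fix x
      have "indicator ?U x \<le> (indicator (cball 0 R) x :: real)" using R by (auto simp: indicator_def)
      hence "\<bar>\<phi> m x\<bar> \<le> indicator (cball 0 R) x" using le[of m x] by linarith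
      thus "norm (k x * \<phi> m x) \<le> \<bar>k x * indicator (cball 0 R) x\<bar>"
        by (simp add: abs_mult mult_left_mono)
    qed
  qed measurable
  hence lim: "(\<integral>x. k x * (\<Sum>j\<in>J. \<epsilon> j * indicator (box (a j) (b j)) x) \<partial>lborel) \<le> W"
    by (rule LIMSEQ_le_const2) (use dual[OF bt le1] in blast)
  have int: "integrable lborel (\<lambda>x. k x * indicator (box (a j) (b j)) x)" if "j \<in> J" for j
    using R that by (intro locally_integrable_mult[OF k, where B=1 and R=R]) (auto simp: indicator_def)
  have "(\<integral>x. k x * (\<Sum>j\<in>J. \<epsilon> j * indicator (box (a j) (b j)) x) \<partial>lborel) = (\<integral>x. (\<Sum>j\<in>J. \<epsilon> j * (k x * indicator (box (a j) (b j)) x)) \<partial>lborel)"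
    by (simp add: sum_distrib_left mult_ac)
  also have "\<dots> = (\<Sum>j\<in>J. \<epsilon> j * (\<integral>x. k x * indicator (box (a j) (b j)) x \<partial>lborel))"
    using int by (subst Bochner_Integration.integral_sum) auto
  also have "\<dots> = (\<Sum>j\<in>J. \<bar>\<integral>x. k x * indicator (box (a j) (b j)) x \<partial>lborel\<bar>)"
    unfolding \<epsilon>_def by (simp add: sgn_mult_self_eq abs_sgn mult.commute)
  finally show ?thesis using lim by simp
qed

lemma One_vec: "One = (1 :: real^'n::finite)"
  unfolding Basis_vec_eq_range sum.reindex[OF inj_axis_1] by (simp add: vec_eq_iff axis_def)

text \<open>For a fixed offset x the boxes at x plus the grid corners are disjoint, so their
  absolute integrals sum to at most W. Letting the offset range over one cube covers the space once
  and contributes its volume 2^(n d).\<close>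

lemma nn_integral_box_averages_le:
  fixes k :: "real^'n::finite \<Rightarrow> real"
  assumes k: "locally_integrable k"
    and dual: "\<And>\<phi>. bump_test \<phi> \<Longrightarrow> (\<And>x. \<bar>\<phi> x\<bar> \<le> 1) \<Longrightarrow> (\<integral>x. k x * \<phi> x \<partial>lborel) \<le> W"
  defines "K \<equiv> \<lambda>n x. \<integral>y. k y * indicator (box x (x + 2 powr real_of_int n *\<^sub>R 1)) y \<partial>lborel"
  shows "K n \<in> borel_measurable borel"
    and "(\<integral>\<^sup>+ x. ennreal \<bar>K n x\<bar> \<partial>lborel) \<le> ennreal (W * 2 powr (real_of_int n * real CARD('n)))"
proof -
  let ?h = "2 powr real_of_int n"
  have [measurable]: "k \<in> borel_measurable borel" using k by (rule locally_integrable_measurable)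
  show [measurable]: "K n \<in> borel_measurable borel"
    unfolding K_def box_def mem_Collect_eq
    by (rule lborel.borel_measurable_lebesgue_integral) measurable
  have W: "0 \<le> W" using dual[of "\<lambda>_. 0"] by (simp add: bump_test_def bump_algebra.const)
  have sum_le: "(\<integral>\<^sup>+ j. ennreal \<bar>K n (x + dcorner n j)\<bar> \<partial>count_space UNIV) \<le> ennreal W" for x
  proof (rule nn_integral_count_space_le)
    fix J :: "('n \<Rightarrow> int) set" assume J: "finite J"
    have in_box: "cidx n (y - x) = j" if "y \<in> box (x + dcorner n j) (x + dcorner n j + ?h *\<^sub>R 1)" for y j
    proof -
      have "y - x \<in> box (dcorner n j) (dcorner n (\<lambda>i. j i + 1))"
        using that by (auto simp: mem_box_cart dcorner_def algebra_simps)
      thus ?thesis using box_subset_dcube mem_dcube_iff by blast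
    qed
    have "(\<Sum>j\<in>J. \<bar>K n (x + dcorner n j)\<bar>) \<le> W"
      unfolding K_def
    proof (rule sum_abs_integral_boxes_le[OF k dual J])
      show "disjoint_family_on (\<lambda>j. box (x + dcorner n j) (x + dcorner n j + ?h *\<^sub>R 1)) J"
        unfolding disjoint_family_on_def
      proof (intro ballI impI equals0I)
        fix j j' y
        assume "j \<noteq> j'" "y \<in> box (x + dcorner n j) (x + dcorner n j + ?h *\<^sub>R 1) \<inter> box (x + dcorner n j') (x + dcorner n j' + ?h *\<^sub>R 1)"
        thus False using in_box[of y j] in_box[of y j'] by auto
      qed
    qed
    thus "(\<Sum>j\<in>J. ennreal \<bar>K n (x + dcorner n j)\<bar>) \<le> ennreal W" by (simp add: sum_ennreal ennreal_leI)
  qed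
  have "(\<integral>\<^sup>+ x. ennreal \<bar>K n x\<bar> \<partial>lborel) = (\<integral>\<^sup>+ j. (\<integral>\<^sup>+ x. ennreal \<bar>K n x\<bar> * indicator (dcube n j) x \<partial>lborel) \<partial>count_space UNIV)"
    by (rule nn_integral_tiling) measurable
  also have "\<dots> = (\<integral>\<^sup>+ j. (\<integral>\<^sup>+ x. ennreal \<bar>K n (x + dcorner n j)\<bar> * indicator (dcube n (\<lambda>_. 0)) x \<partial>lborel) \<partial>count_space UNIV)"
  proof (rule nn_integral_cong)
    fix j :: "'n \<Rightarrow> int"
    have c: "dcorner n j = ?h *\<^sub>R (\<chi> i. real_of_int (j i))" by (simp add: dcorner_def vec_eq_iff)
    have "x + dcorner n j \<in> dcube n j \<longleftrightarrow> x \<in> dcube n (\<lambda>_. 0)" for x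
      unfolding mem_dcube_iff c cidx_translate by (auto simp: fun_eq_iff)
    hence "(indicator (dcube n j) (x + dcorner n j) :: ennreal) = indicator (dcube n (\<lambda>_. 0)) x" for x
      by (simp add: indicator_def)
    thus "(\<integral>\<^sup>+ x. ennreal \<bar>K n x\<bar> * indicator (dcube n j) x \<partial>lborel) = (\<integral>\<^sup>+ x. ennreal \<bar>K n (x + dcorner n j)\<bar> * indicator (dcube n (\<lambda>_. 0)) x \<partial>lborel)"
      using nn_integral_lborel_translate[of "\<lambda>x. ennreal \<bar>K n x\<bar> * indicator (dcube n j) x" "dcorner n j"] by simp
  qed
  also have "\<dots> = (\<integral>\<^sup>+ x. (\<integral>\<^sup>+ j. ennreal \<bar>K n (x + dcorner n j)\<bar> * indicator (dcube n (\<lambda>_. 0)) x \<partial>count_space UNIV) \<partial>lborel)"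
    by (rule nn_integral_count_space_nn_integral[symmetric]) auto
  also have "\<dots> \<le> (\<integral>\<^sup>+ x. ennreal W * indicator (dcube n (\<lambda>_. 0)) (x::real^'n) \<partial>lborel)"
    by (intro nn_integral_mono) (simp add: nn_integral_multc mult_right_mono sum_le)
  also have "\<dots> = ennreal (W * 2 powr (real_of_int n * real CARD('n)))"
    using W by (simp add: nn_integral_cmult_indicator emeasure_dcube ennreal_mult)
  finally show "(\<integral>\<^sup>+ x. ennreal \<bar>K n x\<bar> \<partial>lborel) \<le> ennreal (W * 2 powr (real_of_int n * real CARD('n)))" .
qed

text \<open>Averages over shrinking boxes with corner x converge to k x almost everywhere, and
  Fatou's lemma carries their L1 bound to the limit. For W = 0 this is the fundamental lemma of the
  calculus of variations, in which form \<open>sobolev_translate\<close> uses it.\<close>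

lemma nn_integral_abs_le_dual:
  fixes k :: "real^'n::finite \<Rightarrow> real"
  assumes k: "locally_integrable k"
    and dual: "\<And>\<phi>. bump_test \<phi> \<Longrightarrow> (\<And>x. \<bar>\<phi> x\<bar> \<le> 1) \<Longrightarrow> (\<integral>x. k x * \<phi> x \<partial>lborel) \<le> W"
  shows "(\<integral>\<^sup>+ x. ennreal \<bar>k x\<bar> \<partial>lborel) \<le> ennreal W"
proof -
  have [measurable]: "k \<in> borel_measurable borel" using k by (rule locally_integrable_measurable)
  define K where "K n x = (\<integral>y. k y * indicator (box x (x + 2 powr real_of_int n *\<^sub>R 1)) y \<partial>lborel)" for n x
  have Km [measurable]: "K n \<in> borel_measurable borel" for n
    unfolding K_def by (rule nn_integral_box_averages_le(1)[OF k dual])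
  have Kle: "(\<integral>\<^sup>+ x. ennreal \<bar>K n x\<bar> \<partial>lborel) \<le> ennreal (W * 2 powr (real_of_int n * real CARD('n)))" for n
    unfolding K_def by (rule nn_integral_box_averages_le(2)[OF k dual])
  have int_cbox: "set_integrable lborel (cbox a b) k" for a b
  proof -
    obtain R where R: "cbox a b \<subseteq> cball 0 R"
      using bounded_subset_ballD[OF bounded_cbox[of a b], of 0] ball_subset_cball[of 0] by (meson order_trans)
    have "integrable lborel (\<lambda>x. k x * indicator (cbox a b) x)"
      using R by (intro locally_integrable_mult[OF k, where B=1 and R=R]) (auto simp: indicator_def)
    thus ?thesis by (simp add: set_integrable_def mult.commute)
  qed
  obtain N where N: "negligible N" and conv: "\<And>x e. \<lbrakk>x \<notin> N; 0 < e\<rbrakk> \<Longrightarrow>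
     \<exists>d>0. \<forall>h. 0 < h \<and> h < d \<longrightarrow> norm (integral (cbox x (x + h *\<^sub>R One)) k /\<^sub>R h ^ DIM(real^'n) - k x) < e"
  proof (rule integrable_ccontinuous_explicit)
    show "k integrable_on cbox a b" for a b using set_borel_integral_eq_integral(1)[OF int_cbox] .
  qed blast
  have Keq: "integral (cbox x (x + 2 powr real_of_int n *\<^sub>R One)) k = K n x" for n x
  proof -
    let ?b = "x + 2 powr real_of_int n *\<^sub>R 1"
    have "integral (cbox x ?b) k = (LINT y:cbox x ?b|lborel. k y)"
      using set_borel_integral_eq_integral(2)[OF int_cbox] by simp
    also have "\<dots> = (LINT y:box x ?b|lborel. k y)"
      unfolding set_lebesgue_integral_def
    proof (rule integral_cong_AE)
      have "negligible (cbox x ?b - box x ?b)" by (rule negligible_frontier_interval)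
      hence "cbox x ?b - box x ?b \<in> null_sets lborel"
        by (auto simp: negligible_iff_null_sets null_sets_def)
      hence "AE y in lborel. y \<notin> cbox x ?b - box x ?b" by (rule AE_not_in)
      thus "AE y in lborel. indicator (cbox x ?b) y *\<^sub>R k y = indicator (box x ?b) y *\<^sub>R k y"
        by eventually_elim (use box_subset_cbox[of x ?b] in \<open>auto simp: indicator_def\<close>)
    qed measurable
    finally show ?thesis by (simp add: K_def One_vec set_lebesgue_integral_def mult.commute)
  qed
  let ?u = "\<lambda>m x. ennreal (\<bar>K (- int m) x\<bar> / (2 powr (- real m)) ^ CARD('n))"
  have ae: "AE x in lborel. ennreal \<bar>k x\<bar> = liminf (\<lambda>m. ?u m x)"
  proof -
    have "N \<in> null_sets lebesgue" using N by (simp add: negligible_iff_null_sets)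
    hence "AE x in lebesgue. x \<notin> N" by (rule AE_not_in)
    hence "AE x in lborel. x \<notin> N" by (simp add: AE_completion_iff)
    thus ?thesis
    proof eventually_elim
      fix x assume x: "x \<notin> N"
      have "(\<lambda>m. K (- int m) x / (2 powr (- real m)) ^ CARD('n)) \<longlonglongrightarrow> k x"
      proof (rule LIMSEQ_I)
        fix e :: real assume "0 < e"
        from conv[OF x this] obtain d where d: "d > 0" and
          conv': "\<And>h. 0 < h \<Longrightarrow> h < d \<Longrightarrow> norm (integral (cbox x (x + h *\<^sub>R One)) k /\<^sub>R h ^ DIM(real^'n) - k x) < e" by blast
        obtain M where M: "(1/2::real) ^ M < d" using real_arch_pow_inv[OF d, of "1/2"] by auto
        have "norm (K (- int m) x / (2 powr (- real m)) ^ CARD('n) - k x) < e" if "M \<le> m" for m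
        proof -
          have e: "2 powr (- real m) = (1/2) ^ m" by (simp add: powr_minus powr_realpow power_one_over inverse_eq_divide)
          have "(1/2::real) ^ m \<le> (1/2) ^ M" using that by (intro power_decreasing) auto
          hence "2 powr (- real m) < d" unfolding e using M by linarith
          from conv'[OF _ this] show ?thesis using Keq[of x "- int m"] by (simp add: divide_inverse mult.commute)
        qed
        thus "\<exists>no. \<forall>m\<ge>no. norm (K (- int m) x / (2 powr (- real m)) ^ CARD('n) - k x) < e" by blast
      qed
      hence "(\<lambda>m. \<bar>K (- int m) x / (2 powr (- real m)) ^ CARD('n)\<bar>) \<longlonglongrightarrow> \<bar>k x\<bar>" by (rule tendsto_rabs)
      hence "(\<lambda>m. ?u m x) \<longlonglongrightarrow> ennreal \<bar>k x\<bar>" by (intro tendsto_ennrealI) (simp add: abs_divide)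
      thus "ennreal \<bar>k x\<bar> = liminf (\<lambda>m. ?u m x)" using lim_imp_Liminf[OF trivial_limit_sequentially] by metis
    qed
  qed
  have u_le: "(\<integral>\<^sup>+ x. ?u m x \<partial>lborel) \<le> ennreal W" for m
  proof -
    have e: "(2 powr (- real m)) ^ CARD('n) = 2 powr (real_of_int (- int m) * real CARD('n))"
      by (simp add: powr_power mult.commute)
    have W: "0 \<le> W" using dual[of "\<lambda>_. 0"] by (simp add: bump_test_def bump_algebra.const)
    let ?c = "2 powr (real_of_int (- int m) * real CARD('n))"
    have "(\<integral>\<^sup>+ x. ?u m x \<partial>lborel) = (\<integral>\<^sup>+ x. ennreal (1 / ?c) * ennreal \<bar>K (- int m) x\<bar> \<partial>lborel)"
      unfolding e by (simp add: ennreal_mult[symmetric])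
    also have "\<dots> = ennreal (1 / ?c) * (\<integral>\<^sup>+ x. ennreal \<bar>K (- int m) x\<bar> \<partial>lborel)" by (rule nn_integral_cmult) measurable
    also have "\<dots> \<le> ennreal (1 / ?c) * ennreal (W * ?c)" by (intro mult_left_mono Kle) simp
    also have "\<dots> = ennreal (1 / ?c * (W * ?c))" using W by (intro ennreal_mult[symmetric]) auto
    also have "1 / ?c * (W * ?c) = W" by simp
    finally show ?thesis .
  qed
  have "(\<integral>\<^sup>+ x. ennreal \<bar>k x\<bar> \<partial>lborel) = (\<integral>\<^sup>+ x. liminf (\<lambda>m. ?u m x) \<partial>lborel)"
    by (rule nn_integral_cong_AE[OF ae])
  also have "\<dots> \<le> liminf (\<lambda>m. \<integral>\<^sup>+ x. ?u m x \<partial>lborel)"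
    by (rule nn_integral_liminf) measurable
  also have "\<dots> \<le> limsup (\<lambda>m. \<integral>\<^sup>+ x. ?u m x \<partial>lborel)" by (rule Liminf_le_Limsup) simp
  also have "\<dots> \<le> ennreal W" by (intro Limsup_bounded always_eventually allI u_le)
  finally show ?thesis .
qed

section \<open>Translations of BV and Sobolev functions\<close>

lemma pd_translate: "pd i (\<lambda>y. \<phi> (y - v)) y = pd i \<phi> (y - v)"
  unfolding pd_def by (simp add: algebra_simps)

lemma pd_cmult:
  assumes "\<phi> differentiable (at x)"
  shows "pd i (\<lambda>y. c * \<phi> y) x = c * pd i \<phi> x"
  by (rule pd_eqI, rule DERIV_cmult, rule pd_has_derivative[OF assms])

definition ddir :: "real^'n::finite \<Rightarrow> (real^'n \<Rightarrow> real) \<Rightarrow> real^'n \<Rightarrow> real" where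
  "ddir w \<phi> z = (\<Sum>i\<in>UNIV. w $ i * pd i \<phi> z)"

lemma bump_test_ddir: "bump_test \<phi> \<Longrightarrow> bump_test (ddir w \<phi>)"
  unfolding ddir_def by (intro bump_test_sum bump_test_cmult bump_test_pd)

lemma bump_test_continuous: "bump_test \<phi> \<Longrightarrow> continuous_on S \<phi>"
  by (simp add: bump_test_def bump_algebra_continuous)

lemma bump_test_measurable: "bump_test \<phi> \<Longrightarrow> \<phi> \<in> borel_measurable borel"
  by (simp add: bump_test_def bump_algebra_measurable)

lemma bump_test_FTC:
  assumes "bump_test \<phi>"
  shows "(\<integral>t. indicator {0..1::real} t * ddir w \<phi> (y - t *\<^sub>R w) \<partial>lborel) = \<phi> y - \<phi> (y - w)"
proof -
  have der: "((\<lambda>t. - \<phi> (y - t *\<^sub>R w)) has_real_derivative ddir w \<phi> (y - t *\<^sub>R w)) (at t)" for t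
  proof -
    have "\<phi> differentiable (at (y - t *\<^sub>R w))"
      using assms by (simp add: bump_test_def bump_algebra_differentiable)
    then obtain D where D: "(\<phi> has_derivative D) (at (y - t *\<^sub>R w))" by (auto simp: differentiable_def)
    have l: "linear D" using D has_derivative_linear by blast
    have "((\<lambda>t. y - t *\<^sub>R w) has_derivative (\<lambda>s. - (s *\<^sub>R w))) (at t)"
      by (auto intro!: derivative_eq_intros)
    hence "((\<lambda>t. \<phi> (y - t *\<^sub>R w)) has_derivative (\<lambda>s. D (- (s *\<^sub>R w)))) (at t)"
      using D by (rule has_derivative_compose)
    hence "((\<lambda>t. - \<phi> (y - t *\<^sub>R w)) has_derivative (\<lambda>s. - D (- (s *\<^sub>R w)))) (at t)"
      by (rule has_derivative_minus)
    moreover have "(\<lambda>s. - D (- (s *\<^sub>R w))) = (*) (ddir w \<phi> (y - t *\<^sub>R w))"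
    proof
      fix s
      have "- D (- (s *\<^sub>R w)) = s * D w" by (simp add: linear_neg[OF l] linear_cmul[OF l])
      thus "- D (- (s *\<^sub>R w)) = ddir w \<phi> (y - t *\<^sub>R w) * s"
        unfolding ddir_def frechet_eq_sum_pd[OF D, symmetric] by simp
    qed
    ultimately show ?thesis by (simp add: has_field_derivative_def)
  qed
  have "continuous_on UNIV (\<lambda>t. ddir w \<phi> (y - t *\<^sub>R w))"
    by (intro continuous_on_compose2[OF bump_test_continuous[OF bump_test_ddir[OF assms], of UNIV]] continuous_intros) auto
  hence cont: "isCont (\<lambda>t. ddir w \<phi> (y - t *\<^sub>R w)) t" for t
    by (simp add: continuous_on_eq_continuous_at)
  have "(\<integral>t. ddir w \<phi> (y - t *\<^sub>R w) * indicator {0..1::real} t \<partial>lborel) = - \<phi> (y - 1 *\<^sub>R w) - - \<phi> (y - 0 *\<^sub>R w)"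
    by (rule integral_FTC_Icc_real) (use der cont in auto)
  thus ?thesis by (simp add: mult.commute)
qed

lemma integrable_unit_interval_product:
  fixes H :: "'a::euclidean_space \<Rightarrow> real"
  assumes "integrable lborel H"
  shows "integrable (lborel \<Otimes>\<^sub>M lborel) (\<lambda>(t, y). indicator {0..1::real} t * H y)"
proof -
  have [measurable]: "H \<in> borel_measurable borel" using assms by auto
  show ?thesis
  proof (rule lborel_pair.Fubini_integrable)
    have "integrable lborel (\<lambda>t. (\<integral>y. \<bar>H y\<bar> \<partial>lborel) * indicator {0..1::real} t)"
      by (intro integrable_mult_right integrable_real_indicator) auto
    thus "integrable lborel (\<lambda>t. \<integral>y. norm (case (t, y) of (t, y) \<Rightarrow> indicator {0..1::real} t * H y) \<partial>lborel)"
      by (simp add: abs_mult mult.commute)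
    show "AE t in lborel. integrable lborel (\<lambda>y. case (t, y) of (t, y) \<Rightarrow> indicator {0..1::real} t * H y)"
      using assms by (intro AE_I2) auto
  qed measurable
qed

text \<open>For t in [0, 1] the supports of the shifted bumps all lie in the ball enlarged by the
  norm of w. This gives one dominating function and the joint integrability that Fubini asks
  for.\<close>

lemma integrable_bump_shift_product:
  fixes f :: "real^'n::finite \<Rightarrow> real"
  assumes f: "locally_integrable f" and \<phi>: "bump_test \<phi>"
  shows "integrable (lborel \<Otimes>\<^sub>M lborel) (\<lambda>(t, y). indicator {0..1::real} t * (f y * \<phi> (y - t *\<^sub>R w)))"
proof -
  have [measurable]: "f \<in> borel_measurable borel" "\<phi> \<in> borel_measurable borel"
    using f \<phi> by (auto intro: locally_integrable_measurable bump_test_measurable)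
  obtain B R where B: "B \<ge> 0" "\<And>x. \<bar>\<phi> x\<bar> \<le> B * indicator (cball 0 R) x" using bump_test_bounded[OF \<phi>] by metis
  let ?H = "\<lambda>y. B * (f y * indicator (cball 0 (R + norm w)) y)"
  have "integrable (lborel \<Otimes>\<^sub>M lborel) (\<lambda>(t, y). indicator {0..1::real} t * ?H y)"
    using f by (intro integrable_unit_interval_product integrable_mult_right) (simp add: locally_integrable_def)
  thus ?thesis
  proof (rule Bochner_Integration.integrable_bound)
    show "(\<lambda>(t, y). indicator {0..1::real} t * (f y * \<phi> (y - t *\<^sub>R w))) \<in> borel_measurable (lborel \<Otimes>\<^sub>M lborel)"
      by measurable
    have "\<bar>\<phi> (y - t *\<^sub>R w)\<bar> \<le> B * indicator (cball 0 (R + norm w)) y" if "t \<in> {0..1}" for t y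
    proof -
      have "norm y \<le> R + norm w" if "norm (y - t *\<^sub>R w) \<le> R"
      proof -
        have "norm (t *\<^sub>R w) \<le> norm w" using \<open>t \<in> {0..1}\<close> by (simp add: mult_left_le_one_le)
        thus ?thesis using that norm_triangle_ineq[of "y - t *\<^sub>R w" "t *\<^sub>R w"] by simp
      qed
      hence "indicator (cball 0 R) (y - t *\<^sub>R w) \<le> (indicator (cball 0 (R + norm w)) y :: real)"
        by (auto simp: indicator_def)
      hence "B * indicator (cball 0 R) (y - t *\<^sub>R w) \<le> B * indicator (cball 0 (R + norm w)) y"
        using B(1) by (rule mult_left_mono)
      thus ?thesis using B(2)[of "y - t *\<^sub>R w"] by linarith
    qed
    hence "\<bar>f y\<bar> * \<bar>\<phi> (y - t *\<^sub>R w)\<bar> \<le> \<bar>f y\<bar> * (B * indicator (cball 0 (R + norm w)) y)" if "t \<in> {0..1}" for t y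
      using that by (intro mult_left_mono) auto
    hence "\<bar>indicator {0..1} t * (f y * \<phi> (y - t *\<^sub>R w))\<bar> \<le> \<bar>indicator {0..1} t * ?H y\<bar>" for t y
      using B(1) by (auto simp: indicator_def abs_mult mult_ac)
    thus "AE z in lborel \<Otimes>\<^sub>M lborel. norm (case z of (t, y) \<Rightarrow> indicator {0..1::real} t * (f y * \<phi> (y - t *\<^sub>R w)))
       \<le> norm (case z of (t, y) \<Rightarrow> indicator {0..1::real} t * ?H y)"
      by (intro AE_I2) (auto split: prod.split)
  qed
qed

text \<open>The translation is moved onto the bump, whose increment is the integral of a directional
  derivative, and Fubini brings the pairing of f with derivatives inside. That pairing is what the
  variation or the weak gradient controls. Integrability in t permits comparing the outer integral
  with a bound.\<close>

lemma integral_translate_diff: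
  fixes f :: "real^'n::finite \<Rightarrow> real"
  assumes f: "locally_integrable f" and \<phi>: "bump_test \<phi>"
  shows "(\<integral>x. (f (x + w) - f x) * \<phi> x \<partial>lborel) =
      - (\<integral>t. indicator {0..1::real} t * (\<integral>y. f y * ddir w \<phi> (y - t *\<^sub>R w) \<partial>lborel) \<partial>lborel)"
    and "integrable lborel (\<lambda>t. indicator {0..1::real} t * (\<integral>y. f y * ddir w \<phi> (y - t *\<^sub>R w) \<partial>lborel))"
proof -
  have [measurable]: "f \<in> borel_measurable borel" "\<phi> \<in> borel_measurable borel"
    using f \<phi> by (auto intro: locally_integrable_measurable bump_test_measurable)
  let ?g = "\<lambda>t y. indicator {0..1::real} t * (f y * ddir w \<phi> (y - t *\<^sub>R w))"
  have int: "integrable (lborel \<Otimes>\<^sub>M lborel) (\<lambda>(t, y). ?g t y)"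
    by (rule integrable_bump_shift_product[OF f bump_test_ddir[OF \<phi>]])
  have 1: "(\<integral>x. f (x + w) * \<phi> x \<partial>lborel) = (\<integral>y. f y * \<phi> (y - w) \<partial>lborel)"
    using integral_lborel_translate[of "\<lambda>y. f y * \<phi> (y - w)" w] by simp
  have i1: "integrable lborel (\<lambda>x. f (x + w) * \<phi> x)"
    by (rule locally_integrable_mult_bump[OF locally_integrable_translate[OF f] \<phi>])
  have i2: "integrable lborel (\<lambda>x. f x * \<phi> x)" by (rule locally_integrable_mult_bump[OF f \<phi>])
  have i3: "integrable lborel (\<lambda>x. f x * \<phi> (x - w))" by (rule locally_integrable_mult_bump[OF f bump_test_translate[OF \<phi>]])
  have "(\<integral>x. (f (x + w) - f x) * \<phi> x \<partial>lborel) = (\<integral>y. f y * \<phi> (y - w) \<partial>lborel) - (\<integral>y. f y * \<phi> y \<partial>lborel)"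
    using i1 i2 by (simp add: left_diff_distrib Bochner_Integration.integral_diff 1)
  also have "\<dots> = (\<integral>y. f y * \<phi> (y - w) - f y * \<phi> y \<partial>lborel)"
    using i2 i3 by simp
  also have "\<dots> = (\<integral>y. - (\<integral>t. ?g t y \<partial>lborel) \<partial>lborel)"
  proof (rule Bochner_Integration.integral_cong[OF refl])
    fix y
    have "(\<integral>t. ?g t y \<partial>lborel) = f y * (\<integral>t. indicator {0..1::real} t * ddir w \<phi> (y - t *\<^sub>R w) \<partial>lborel)"
      by (subst integral_mult_right_zero[symmetric]) (simp add: mult_ac)
    thus "f y * \<phi> (y - w) - f y * \<phi> y = - (\<integral>t. ?g t y \<partial>lborel)"
      unfolding bump_test_FTC[OF \<phi>] by (simp add: algebra_simps)
  qed
  also have "\<dots> = - (\<integral>y. (\<integral>t. ?g t y \<partial>lborel) \<partial>lborel)" by simp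
  also have "\<dots> = - (\<integral>t. (\<integral>y. ?g t y \<partial>lborel) \<partial>lborel)"
    using lborel_pair.Fubini_integral[OF int] by simp
  finally show "(\<integral>x. (f (x + w) - f x) * \<phi> x \<partial>lborel) =
      - (\<integral>t. indicator {0..1::real} t * (\<integral>y. f y * ddir w \<phi> (y - t *\<^sub>R w) \<partial>lborel) \<partial>lborel)"
    by simp
  show "integrable lborel (\<lambda>t. indicator {0..1::real} t * (\<integral>y. f y * ddir w \<phi> (y - t *\<^sub>R w) \<partial>lborel))"
    using lborel_pair.integrable_fst[OF int] by simp
qed

text \<open>A shifted bump times the unit vector opposite to w is an admissible field, and its
  divergence is minus the directional derivative over the norm of w. The variation therefore bounds
  the inner pairing for each t, and duality turns the bound for all bumps into an L1 bound.\<close>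

lemma BV_modulus:
  fixes f :: "real^'n::finite \<Rightarrow> real"
  assumes f: "integrable lborel f" and V: "total_var f \<le> ennreal V" "V \<ge> 0"
  shows "(\<integral>\<^sup>+ x. ennreal \<bar>f (x + w) - f x\<bar> \<partial>lborel) \<le> ennreal (norm w * V)"
proof (cases "w = 0")
  case False
  have [measurable]: "f \<in> borel_measurable borel" using f by auto
  have floc: "locally_integrable f"
    unfolding locally_integrable_def
    by (auto intro!: integrable_mult_indicator[where f=f, simplified] f simp: mult.commute[of "f _"])
  show ?thesis
  proof (rule nn_integral_abs_le_dual)
    show "locally_integrable (\<lambda>x. f (x + w) - f x)"
      by (intro locally_integrable_diff locally_integrable_translate floc)
    fix \<phi> :: "real^'n \<Rightarrow> real" assume \<phi>: "bump_test \<phi>" and le1: "\<And>x. \<bar>\<phi> x\<bar> \<le> 1"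
    have bound: "- (\<integral>y. f y * ddir w \<phi> (y - t *\<^sub>R w) \<partial>lborel) \<le> norm w * V" for t
    proof -
      define \<psi> where "\<psi> = (\<lambda>y. \<phi> (y - t *\<^sub>R w))"
      have \<psi>: "bump_test \<psi>" unfolding \<psi>_def by (rule bump_test_translate[OF \<phi>])
      define \<Phi> where "\<Phi> = (\<lambda>y. \<psi> y *\<^sub>R (- (w /\<^sub>R norm w)))"
      have comp: "(\<lambda>y. \<Phi> y $ i) = (\<lambda>y. - (w $ i / norm w) * \<psi> y)" for i
        by (auto simp: \<Phi>_def divide_inverse mult_ac)
      have "norm (\<Phi> y) \<le> 1" for y using le1[of "y - t *\<^sub>R w"] False by (simp add: \<Phi>_def \<psi>_def abs_mult mult.assoc)
      hence mem: "\<Phi> \<in> test_fields"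
        unfolding test_fields_def mem_Collect_eq comp
        by (intro conjI allI bump_test_test_fun bump_test_cmult \<psi>)
      have pdm: "pd i \<psi> y = pd i \<phi> (y - t *\<^sub>R w)" for i y unfolding \<psi>_def by (rule pd_translate)
      have diff: "\<psi> differentiable (at y)" for y using \<psi> by (simp add: bump_test_def bump_algebra_differentiable)
      have div: "divergence \<Phi> y = - (ddir w \<phi> (y - t *\<^sub>R w) / norm w)" for y
        unfolding divergence_def comp pd_cmult[OF diff] pdm ddir_def
        by (simp add: sum_negf sum_divide_distrib)
      have "continuous_on UNIV (\<lambda>y. ddir w \<phi> (y - t *\<^sub>R w))"
        by (intro continuous_on_compose2[OF bump_test_continuous[OF bump_test_ddir[OF \<phi>], of UNIV]] continuous_intros) auto
      hence [measurable]: "(\<lambda>y. ddir w \<phi> (y - t *\<^sub>R w)) \<in> borel_measurable borel"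
        by (rule borel_measurable_continuous_onI)
      have "ennreal (\<integral>x. f x * divergence \<Phi> x \<partial>lebesgue) \<le> total_var f"
        unfolding total_var_def by (rule SUP_upper[OF mem])
      also have "\<dots> \<le> ennreal V" by (rule V)
      finally have "(\<integral>x. f x * divergence \<Phi> x \<partial>lebesgue) \<le> V" using V(2) by (simp add: ennreal_le_iff)
      moreover have "(\<integral>x. f x * divergence \<Phi> x \<partial>lebesgue) = (\<integral>x. f x * divergence \<Phi> x \<partial>lborel)"
        unfolding div by (rule integral_completion) measurable
      moreover have "(\<integral>x. f x * divergence \<Phi> x \<partial>lborel) = - (\<integral>y. f y * ddir w \<phi> (y - t *\<^sub>R w) \<partial>lborel) / norm w"
        unfolding div by simp
      ultimately have "- (\<integral>y. f y * ddir w \<phi> (y - t *\<^sub>R w) \<partial>lborel) / norm w \<le> V" by (simp only:)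
      thus ?thesis using False by (simp only: pos_divide_le_eq zero_less_norm_iff mult.commute simp_thms)
    qed
    let ?q = "\<lambda>t. indicator {0..1::real} t * (\<integral>y. f y * ddir w \<phi> (y - t *\<^sub>R w) \<partial>lborel)"
    have "(\<integral>x. (f (x + w) - f x) * \<phi> x \<partial>lborel) = (\<integral>t. - ?q t \<partial>lborel)"
      unfolding integral_translate_diff(1)[OF floc \<phi>] by simp
    also have "\<dots> \<le> (\<integral>t. (norm w * V) * indicator {0..1::real} t \<partial>lborel)"
    proof (rule integral_mono)
      show "integrable lborel (\<lambda>t. - ?q t)" using integral_translate_diff(2)[OF floc \<phi>] by simp
      show "integrable lborel (\<lambda>t. (norm w * V) * indicator {0..1::real} t)"
        by (intro integrable_mult_right integrable_real_indicator) auto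
      show "- ?q t \<le> (norm w * V) * indicator {0..1::real} t" for t
        using bound[of t] by (simp add: indicator_def)
    qed
    also have "\<dots> = norm w * V" by simp
    finally show "(\<integral>x. (f (x + w) - f x) * \<phi> x \<partial>lborel) \<le> norm w * V" .
  qed
qed simp

text \<open>Let S be the integral along the segment of the gradient in direction w. By the weak
  gradient identity, f (x + w) - f x - S x pairs to 0 with every bump and so vanishes almost
  everywhere. A pointwise bound, unlike an L1 modulus, can be localised to a cube.\<close>

lemma sobolev_translate:
  fixes f :: "real^'n::finite \<Rightarrow> real" and g :: "real^'n \<Rightarrow> real^'n"
  assumes f: "locally_integrable f" and g: "\<And>i. locally_integrable (\<lambda>x. g x $ i)"
    and gm [measurable]: "g \<in> borel_measurable borel"
    and weak: "\<And>i \<phi>. bump_test \<phi> \<Longrightarrow> (\<integral>x. f x * pd i \<phi> x \<partial>lborel) = - (\<integral>x. g x $ i * \<phi> x \<partial>lborel)"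
  shows "AE x in lborel. ennreal \<bar>f (x + w) - f x\<bar> \<le> ennreal (norm w) * (\<integral>\<^sup>+ t. indicator {0..1::real} t * ennreal (norm (g (x + t *\<^sub>R w))) \<partial>lborel)"
proof -
  define G where "G y = (\<Sum>i\<in>UNIV. w $ i * g y $ i)" for y
  have G: "locally_integrable G" unfolding G_def by (intro locally_integrable_sum_cmult g)
  have [measurable]: "f \<in> borel_measurable borel" "G \<in> borel_measurable borel"
    using f G by (auto intro: locally_integrable_measurable)
  have [measurable]: "cball (0::real^'n) r \<in> sets borel" for r by simp
  have Gle: "\<bar>G y\<bar> \<le> norm w * norm (g y)" for y
    using Cauchy_Schwarz_ineq2[of w "g y"] by (simp add: G_def inner_vec_def)
  define S where "S x = (\<integral>t. indicator {0..1::real} t * G (x + t *\<^sub>R w) \<partial>lborel)" for x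
  have Sm [measurable]: "S \<in> borel_measurable borel"
    unfolding S_def by (rule lborel.borel_measurable_lebesgue_integral) measurable
  have S_le: "ennreal \<bar>S x\<bar> \<le> (\<integral>\<^sup>+ t. indicator {0..1::real} t * ennreal \<bar>G (x + t *\<^sub>R w)\<bar> \<partial>lborel)" for x
  proof (cases "integrable lborel (\<lambda>t. indicator {0..1::real} t * G (x + t *\<^sub>R w))")
    case True
    have "ennreal (norm (S x)) \<le> (\<integral>\<^sup>+ t. ennreal (norm (indicator {0..1::real} t * G (x + t *\<^sub>R w))) \<partial>lborel)"
      unfolding S_def by (rule integral_norm_bound_ennreal[OF True])
    also have "\<dots> = (\<integral>\<^sup>+ t. indicator {0..1::real} t * ennreal \<bar>G (x + t *\<^sub>R w)\<bar> \<partial>lborel)"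
      by (intro nn_integral_cong) (auto simp: indicator_def)
    finally show ?thesis by simp
  next
    case False
    \<comment> \<open>If G is not integrable along the segment, then S is 0 by the convention for
      Bochner integrals.\<close>
    thus ?thesis by (simp add: S_def not_integrable_integral_eq)
  qed
  \<comment> \<open>Over a ball of starting points the integrals along the segments have a finite
    total, by Tonelli and local integrability of G. This yields both local integrability of S and
    the joint integrability for Fubini below.\<close>
  have fin: "(\<integral>\<^sup>+ x. (\<integral>\<^sup>+ t. indicator {0..1::real} t * (ennreal \<bar>G (x + t *\<^sub>R w)\<bar> * indicator (cball 0 R) x) \<partial>lborel) \<partial>lborel) < \<infinity>" for R
  proof -
    have "(\<integral>\<^sup>+ x. (\<integral>\<^sup>+ t. indicator {0..1::real} t * (ennreal \<bar>G (x + t *\<^sub>R w)\<bar> * indicator (cball 0 R) x) \<partial>lborel) \<partial>lborel)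
       = (\<integral>\<^sup>+ t. (\<integral>\<^sup>+ x. indicator {0..1::real} t * (ennreal \<bar>G (x + t *\<^sub>R w)\<bar> * indicator (cball 0 R) x) \<partial>lborel) \<partial>lborel)"
      by (rule lborel_pair.Fubini') measurable
    also have "\<dots> \<le> (\<integral>\<^sup>+ t. (\<integral>\<^sup>+ x. ennreal \<bar>G x\<bar> * indicator (cball 0 (R + norm w)) x \<partial>lborel) * indicator {0..1::real} t \<partial>lborel)"
    proof (intro nn_integral_mono)
      fix t :: real
      show "(\<integral>\<^sup>+ x. indicator {0..1::real} t * (ennreal \<bar>G (x + t *\<^sub>R w)\<bar> * indicator (cball 0 R) x) \<partial>lborel)
        \<le> (\<integral>\<^sup>+ x. ennreal \<bar>G x\<bar> * indicator (cball 0 (R + norm w)) x \<partial>lborel) * indicator {0..1::real} t"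
      proof (cases "t \<in> {0..1}")
        case True
        have "norm (x + t *\<^sub>R w) \<le> R + norm w" if "norm x \<le> R" for x
        proof -
          have "norm (t *\<^sub>R w) \<le> norm w" using True by (simp add: mult_left_le_one_le)
          thus ?thesis using that norm_triangle_ineq[of x "t *\<^sub>R w"] by linarith
        qed
        hence "(\<integral>\<^sup>+ x. ennreal \<bar>G (x + t *\<^sub>R w)\<bar> * indicator (cball 0 R) x \<partial>lborel)
          \<le> (\<integral>\<^sup>+ x. ennreal \<bar>G (x + t *\<^sub>R w)\<bar> * indicator (cball 0 (R + norm w)) (x + t *\<^sub>R w) \<partial>lborel)"
          by (intro nn_integral_mono mult_left_mono) (auto simp: indicator_def)
        also have "\<dots> = (\<integral>\<^sup>+ x. ennreal \<bar>G x\<bar> * indicator (cball 0 (R + norm w)) x \<partial>lborel)"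
          by (rule nn_integral_lborel_translate) simp
        finally show ?thesis using True by simp
      qed simp
    qed
    also have "\<dots> = (\<integral>\<^sup>+ x. ennreal \<bar>G x\<bar> * indicator (cball 0 (R + norm w)) x \<partial>lborel)"
      by (subst nn_integral_cmult_indicator) auto
    also have "\<dots> = (\<integral>\<^sup>+ x. ennreal (norm (G x * indicator (cball 0 (R + norm w)) x)) \<partial>lborel)"
      by (intro nn_integral_cong) (auto simp: indicator_def)
    also have "\<dots> < \<infinity>" using G by (simp add: locally_integrable_def integrable_iff_bounded)
    finally show ?thesis .
  qed
  have S: "locally_integrable S"
    unfolding locally_integrable_def
  proof (intro conjI allI Sm)
    fix R
    have "(\<integral>\<^sup>+ x. ennreal (norm (S x * indicator (cball 0 R) x)) \<partial>lborel) \<le> (\<integral>\<^sup>+ x. (\<integral>\<^sup>+ t. indicator {0..1::real} t * (ennreal \<bar>G (x + t *\<^sub>R w)\<bar> * indicator (cball 0 R) x) \<partial>lborel) \<partial>lborel)"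
    proof (intro nn_integral_mono)
      fix x
      show "ennreal (norm (S x * indicator (cball 0 R) x)) \<le> (\<integral>\<^sup>+ t. indicator {0..1::real} t * (ennreal \<bar>G (x + t *\<^sub>R w)\<bar> * indicator (cball 0 R) x) \<partial>lborel)"
        using S_le[of x] by (cases "x \<in> cball 0 R") auto
    qed
    also have "\<dots> < \<infinity>" by (rule fin)
    finally show "integrable lborel (\<lambda>x. S x * indicator (cball 0 R) x)"
      by (intro integrableI_bounded) auto
  qed
  have zero: "(\<integral>x. (f (x + w) - f x - S x) * \<phi> x \<partial>lborel) = 0" if \<phi>: "bump_test \<phi>" for \<phi>
  proof -
    have [measurable]: "\<phi> \<in> borel_measurable borel" by (rule bump_test_measurable[OF \<phi>])
    have inner: "(\<integral>y. f y * ddir w \<phi> (y - t *\<^sub>R w) \<partial>lborel) = - (\<integral>x. G (x + t *\<^sub>R w) * \<phi> x \<partial>lborel)" for t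
    proof -
      define \<psi> where "\<psi> = (\<lambda>y. \<phi> (y - t *\<^sub>R w))"
      have \<psi>: "bump_test \<psi>" unfolding \<psi>_def by (rule bump_test_translate[OF \<phi>])
      have pdm: "pd i \<phi> (y - t *\<^sub>R w) = pd i \<psi> y" for i y unfolding \<psi>_def by (rule pd_translate[symmetric])
      have "(\<integral>y. f y * ddir w \<phi> (y - t *\<^sub>R w) \<partial>lborel) = (\<integral>y. (\<Sum>i\<in>UNIV. w $ i * (f y * pd i \<psi> y)) \<partial>lborel)"
        by (simp add: ddir_def pdm sum_distrib_left mult_ac)
      also have "\<dots> = (\<Sum>i\<in>UNIV. w $ i * (\<integral>y. f y * pd i \<psi> y \<partial>lborel))"
        by (subst Bochner_Integration.integral_sum)
           (auto intro!: integrable_mult_right locally_integrable_mult_bump f bump_test_pd \<psi>)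
      also have "\<dots> = - (\<Sum>i\<in>UNIV. w $ i * (\<integral>y. g y $ i * \<psi> y \<partial>lborel))"
        by (simp add: weak[OF \<psi>] sum_negf)
      also have "(\<Sum>i\<in>UNIV. w $ i * (\<integral>y. g y $ i * \<psi> y \<partial>lborel)) = (\<integral>y. (\<Sum>i\<in>UNIV. w $ i * (g y $ i * \<psi> y)) \<partial>lborel)"
        by (subst Bochner_Integration.integral_sum)
           (auto intro!: integrable_mult_right locally_integrable_mult_bump g \<psi>)
      also have "\<dots> = (\<integral>y. G y * \<phi> (y - t *\<^sub>R w) \<partial>lborel)"
        by (simp add: G_def \<psi>_def sum_distrib_right mult.assoc)
      also have "\<dots> = (\<integral>x. G (x + t *\<^sub>R w) * \<phi> x \<partial>lborel)"
        using integral_lborel_translate[of "\<lambda>y. G y * \<phi> (y - t *\<^sub>R w)" "t *\<^sub>R w"] by simp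
      finally show ?thesis .
    qed
    obtain B R where B: "B \<ge> 0" "\<And>x. \<bar>\<phi> x\<bar> \<le> B * indicator (cball 0 R) x" using bump_test_bounded[OF \<phi>] by metis
    have int: "integrable (lborel \<Otimes>\<^sub>M lborel) (\<lambda>(x, t). indicator {0..1::real} t * (G (x + t *\<^sub>R w) * \<phi> x))"
    proof (rule integrableI_bounded)
      have "(\<integral>\<^sup>+ z. ennreal (norm (case z of (x, t) \<Rightarrow> indicator {0..1::real} t * (G (x + t *\<^sub>R w) * \<phi> x))) \<partial>(lborel \<Otimes>\<^sub>M lborel))
        = (\<integral>\<^sup>+ x. (\<integral>\<^sup>+ t. ennreal (norm (indicator {0..1::real} t * (G (x + t *\<^sub>R w) * \<phi> x))) \<partial>lborel) \<partial>lborel)"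
        by (subst lborel.nn_integral_fst[symmetric]) auto
      also have "\<dots> \<le> (\<integral>\<^sup>+ x. (\<integral>\<^sup>+ t. ennreal B * (indicator {0..1::real} t * (ennreal \<bar>G (x + t *\<^sub>R w)\<bar> * indicator (cball 0 R) x)) \<partial>lborel) \<partial>lborel)"
      proof (intro nn_integral_mono)
        fix x :: "real^'n" and t :: real
        have "\<bar>G (x + t *\<^sub>R w)\<bar> * \<bar>\<phi> x\<bar> \<le> \<bar>G (x + t *\<^sub>R w)\<bar> * (B * indicator (cball 0 R) x)"
          by (intro mult_left_mono B) auto
        hence "ennreal (\<bar>G (x + t *\<^sub>R w)\<bar> * \<bar>\<phi> x\<bar>) \<le> ennreal (B * (\<bar>G (x + t *\<^sub>R w)\<bar> * indicator (cball 0 R) x))"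
          by (intro ennreal_leI) (simp add: mult_ac)
        also have "\<dots> = ennreal B * (ennreal \<bar>G (x + t *\<^sub>R w)\<bar> * indicator (cball 0 R) x)"
          using B(1) by (auto simp: indicator_def ennreal_mult)
        finally show "ennreal (norm (indicator {0..1::real} t * (G (x + t *\<^sub>R w) * \<phi> x))) \<le> ennreal B * (indicator {0..1::real} t * (ennreal \<bar>G (x + t *\<^sub>R w)\<bar> * indicator (cball 0 R) x))"
          by (auto simp: indicator_def abs_mult)
      qed
      also have "\<dots> = ennreal B * (\<integral>\<^sup>+ x. (\<integral>\<^sup>+ t. (indicator {0..1::real} t * (ennreal \<bar>G (x + t *\<^sub>R w)\<bar> * indicator (cball 0 R) x)) \<partial>lborel) \<partial>lborel)"
        by (simp add: nn_integral_cmult)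
      also have "\<dots> < \<infinity>" using fin[of R] by (simp add: ennreal_mult_less_top)
      finally show "(\<integral>\<^sup>+ z. ennreal (norm (case z of (x, t) \<Rightarrow> indicator {0..1::real} t * (G (x + t *\<^sub>R w) * \<phi> x))) \<partial>(lborel \<Otimes>\<^sub>M lborel)) < \<infinity>" .
    qed measurable
    have "(\<integral>x. (f (x + w) - f x) * \<phi> x \<partial>lborel) = (\<integral>t. indicator {0..1::real} t * (\<integral>x. G (x + t *\<^sub>R w) * \<phi> x \<partial>lborel) \<partial>lborel)"
      unfolding integral_translate_diff(1)[OF f \<phi>] inner by simp
    also have "\<dots> = (\<integral>t. (\<integral>x. indicator {0..1::real} t * (G (x + t *\<^sub>R w) * \<phi> x) \<partial>lborel) \<partial>lborel)" by simp
    also have "\<dots> = (\<integral>x. (\<integral>t. indicator {0..1::real} t * (G (x + t *\<^sub>R w) * \<phi> x) \<partial>lborel) \<partial>lborel)"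
      by (rule lborel_pair.Fubini_integral[OF int])
    also have "\<dots> = (\<integral>x. S x * \<phi> x \<partial>lborel)"
      unfolding S_def by (simp add: mult.assoc[symmetric])
    finally have eq: "(\<integral>x. (f (x + w) - f x) * \<phi> x \<partial>lborel) = (\<integral>x. S x * \<phi> x \<partial>lborel)" .
    have "integrable lborel (\<lambda>x. (f (x + w) - f x) * \<phi> x)" "integrable lborel (\<lambda>x. S x * \<phi> x)"
      by (intro locally_integrable_mult_bump locally_integrable_diff locally_integrable_translate f S \<phi>)+
    thus ?thesis using eq by (simp add: left_diff_distrib[of _ "S _"])
  qed
  have "(\<integral>\<^sup>+ x. ennreal \<bar>f (x + w) - f x - S x\<bar> \<partial>lborel) \<le> ennreal 0"
    by (rule nn_integral_abs_le_dual)
       (auto intro!: locally_integrable_diff locally_integrable_translate f S simp: zero)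
  hence "(\<integral>\<^sup>+ x. ennreal \<bar>f (x + w) - f x - S x\<bar> \<partial>lborel) = 0" by simp
  hence "AE x in lborel. ennreal \<bar>f (x + w) - f x - S x\<bar> = 0"
    by (subst (asm) nn_integral_0_iff_AE) simp_all
  thus ?thesis
  proof eventually_elim
    fix x assume "ennreal \<bar>f (x + w) - f x - S x\<bar> = 0"
    hence "f (x + w) - f x = S x" by (simp add: ennreal_eq_0_iff)
    hence "ennreal \<bar>f (x + w) - f x\<bar> \<le> (\<integral>\<^sup>+ t. indicator {0..1::real} t * ennreal \<bar>G (x + t *\<^sub>R w)\<bar> \<partial>lborel)"
      using S_le[of x] by simp
    also have "\<dots> \<le> (\<integral>\<^sup>+ t. ennreal (norm w) * (indicator {0..1::real} t * ennreal (norm (g (x + t *\<^sub>R w)))) \<partial>lborel)"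
      using Gle by (intro nn_integral_mono) (auto simp: indicator_def ennreal_mult[symmetric] intro!: ennreal_leI)
    also have "\<dots> = ennreal (norm w) * (\<integral>\<^sup>+ t. indicator {0..1::real} t * ennreal (norm (g (x + t *\<^sub>R w))) \<partial>lborel)"
      by (rule nn_integral_cmult) measurable
    finally show "ennreal \<bar>f (x + w) - f x\<bar> \<le> ennreal (norm w) * (\<integral>\<^sup>+ t. indicator {0..1::real} t * ennreal (norm (g (x + t *\<^sub>R w))) \<partial>lborel)" .
  qed
qed

subsection \<open>Poincare inequality on dyadic cubes\<close>

lemma bounded_dcube: "bounded (dcube k j)"
  using dcube_subset_cbox bounded_cbox bounded_subset by metis

lemma nn_integral_dcube_dav:
  fixes h :: "real^'n::finite \<Rightarrow> ennreal"
  shows "(\<integral>\<^sup>+ y. h y * indicator (dcube k (cidx k x)) y \<partial>lborel) = dav k h x * ennreal (2 powr (real_of_int k * real CARD('n)))"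
proof -
  have "{y. cidx k y = cidx k x} = dcube k (cidx k x)" by (auto simp: mem_dcube_iff)
  thus ?thesis unfolding dav_def by (subst ennreal_divide_times) (simp add: ennreal_mult_divide_eq)
qed

lemma dav_eq_dcube:
  fixes h :: "real^'n::finite \<Rightarrow> ennreal"
  shows "dav k h x = ennreal (2 powr (- real_of_int k * real CARD('n))) * (\<integral>\<^sup>+ y. h y * indicator (dcube k (cidx k x)) y \<partial>lborel)"
  unfolding nn_integral_dcube_dav
  by (simp add: mult.left_commute[of _ "dav k h x"] ennreal_mult[symmetric] powr_add[symmetric])

lemma locally_integrable_dav_finite:
  assumes "locally_integrable f"
  shows "dav k (\<lambda>y. ennreal \<bar>f y\<bar>) x < \<infinity>"
proof -
  obtain R where R: "dcube k (cidx k x) \<subseteq> cball 0 R"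
    using bounded_subset_ballD[OF bounded_dcube, of k "cidx k x" 0] ball_subset_cball[of 0] by (meson order_trans)
  have "(\<integral>\<^sup>+ y. ennreal \<bar>f y\<bar> * indicator (dcube k (cidx k x)) y \<partial>lborel) \<le> (\<integral>\<^sup>+ y. ennreal (norm (f y * indicator (cball 0 R) y)) \<partial>lborel)"
    using R by (intro nn_integral_mono) (auto simp: indicator_def)
  also have "\<dots> < \<infinity>" using assms by (simp add: locally_integrable_def integrable_iff_bounded)
  finally show ?thesis unfolding dav_eq_dcube by (simp add: ennreal_mult_less_top)
qed

lemma locally_integrable_ennreal_fav:
  "locally_integrable f \<Longrightarrow> ennreal (fav f k x) = dav k (\<lambda>y. ennreal \<bar>f y\<bar>) x"
  unfolding fav_def using locally_integrable_dav_finite[of f k x] by (intro ennreal_enn2real) simp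

text \<open>The local counterpart of \<open>L1_modulus\<close>, with h in the role of the norm of
  the gradient. The null set may depend on w, which is harmless since w is fixed whenever the bound
  is integrated in x.\<close>

locale translate_bound =
  fixes f :: "real^'n::finite \<Rightarrow> real" and h :: "real^'n \<Rightarrow> ennreal"
  assumes f_loc: "locally_integrable f"
    and h_meas [measurable]: "h \<in> borel_measurable borel"
    and trans: "\<And>w. AE x in lborel. ennreal \<bar>f (x + w) - f x\<bar> \<le> ennreal (norm w) * (\<integral>\<^sup>+ t. indicator {0..1::real} t * h (x + t *\<^sub>R w) \<partial>lborel)"
begin

lemma f_meas [measurable]: "f \<in> borel_measurable borel"
  by (rule locally_integrable_measurable[OF f_loc])

text \<open>D consists of starting points whose segments stay in A, so h is seen on A only. By
  Tonelli and translation invariance every t in [0, 1] contributes at most the integral of h over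
  A.\<close>

lemma nn_integral_translate_local:
  assumes [measurable]: "A \<in> sets borel" "D \<in> sets borel"
    and D: "\<And>x t. x \<in> D \<Longrightarrow> 0 \<le> t \<Longrightarrow> t \<le> 1 \<Longrightarrow> x + t *\<^sub>R w \<in> A"
  shows "(\<integral>\<^sup>+ x. ennreal \<bar>f (x + w) - f x\<bar> * indicator D x \<partial>lborel) \<le> ennreal (norm w) * (\<integral>\<^sup>+ x. h x * indicator A x \<partial>lborel)"
proof -
  have "(\<integral>\<^sup>+ x. ennreal \<bar>f (x + w) - f x\<bar> * indicator D x \<partial>lborel)
     \<le> (\<integral>\<^sup>+ x. ennreal (norm w) * (\<integral>\<^sup>+ t. indicator {0..1::real} t * (h (x + t *\<^sub>R w) * indicator A (x + t *\<^sub>R w)) \<partial>lborel) \<partial>lborel)"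
    using trans[of w]
  proof (intro nn_integral_mono_AE, eventually_elim)
    fix x
    assume *: "ennreal \<bar>f (x + w) - f x\<bar> \<le> ennreal (norm w) * (\<integral>\<^sup>+ t. indicator {0..1::real} t * h (x + t *\<^sub>R w) \<partial>lborel)"
    show "ennreal \<bar>f (x + w) - f x\<bar> * indicator D x \<le> ennreal (norm w) * (\<integral>\<^sup>+ t. indicator {0..1::real} t * (h (x + t *\<^sub>R w) * indicator A (x + t *\<^sub>R w)) \<partial>lborel)"
    proof (cases "x \<in> D")
      case True
      have "(\<integral>\<^sup>+ t. indicator {0..1::real} t * h (x + t *\<^sub>R w) \<partial>lborel) = (\<integral>\<^sup>+ t. indicator {0..1::real} t * (h (x + t *\<^sub>R w) * indicator A (x + t *\<^sub>R w)) \<partial>lborel)"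
        using D[OF True] by (intro nn_integral_cong) (auto simp: indicator_def)
      thus ?thesis using True * by simp
    qed simp
  qed
  also have "\<dots> = ennreal (norm w) * (\<integral>\<^sup>+ x. \<integral>\<^sup>+ t. indicator {0..1::real} t * (h (x + t *\<^sub>R w) * indicator A (x + t *\<^sub>R w)) \<partial>lborel \<partial>lborel)"
    by (rule nn_integral_cmult) measurable
  also have "(\<integral>\<^sup>+ x. \<integral>\<^sup>+ t. indicator {0..1::real} t * (h (x + t *\<^sub>R w) * indicator A (x + t *\<^sub>R w)) \<partial>lborel \<partial>lborel)
     = (\<integral>\<^sup>+ t. \<integral>\<^sup>+ x. indicator {0..1::real} t * (h (x + t *\<^sub>R w) * indicator A (x + t *\<^sub>R w)) \<partial>lborel \<partial>lborel)"
    by (rule lborel_pair.Fubini') measurable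
  also have "\<dots> = (\<integral>\<^sup>+ t. (\<integral>\<^sup>+ x. h x * indicator A x \<partial>lborel) * indicator {0..1::real} t \<partial>lborel)"
  proof (rule nn_integral_cong)
    fix t :: real
    have "(\<integral>\<^sup>+ x. indicator {0..1::real} t * (h (x + t *\<^sub>R w) * indicator A (x + t *\<^sub>R w)) \<partial>lborel) = indicator {0..1::real} t * (\<integral>\<^sup>+ x. h (x + t *\<^sub>R w) * indicator A (x + t *\<^sub>R w) \<partial>lborel)"
      by (rule nn_integral_cmult) measurable
    also have "(\<integral>\<^sup>+ x. h (x + t *\<^sub>R w) * indicator A (x + t *\<^sub>R w) \<partial>lborel) = (\<integral>\<^sup>+ x. h x * indicator A x \<partial>lborel)"
      by (rule nn_integral_lborel_translate) measurable
    finally show "(\<integral>\<^sup>+ x. indicator {0..1::real} t * (h (x + t *\<^sub>R w) * indicator A (x + t *\<^sub>R w)) \<partial>lborel) = (\<integral>\<^sup>+ x. h x * indicator A x \<partial>lborel) * indicator {0..1::real} t"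
      by (simp add: mult.commute)
  qed
  also have "\<dots> = (\<integral>\<^sup>+ x. h x * indicator A x \<partial>lborel)" by (subst nn_integral_cmult_indicator) auto
  finally show ?thesis .
qed

lemma nn_integral_translate_le:
  "(\<integral>\<^sup>+ x. ennreal \<bar>f (x + w) - f x\<bar> \<partial>lborel) \<le> ennreal (norm w) * (\<integral>\<^sup>+ x. h x \<partial>lborel)"
  using nn_integral_translate_local[of UNIV UNIV w] by simp

text \<open>For a fixed displacement 2^k u, pairs with both ends in the cube have their segment in
  it by convexity, so only h on the cube is charged. The factor d 2^k bounds the length of the
  displacement, and 2^d is the volume of [-1, 1]^d.\<close>

lemma poincare_dcube:
  "(\<integral>\<^sup>+ x. dav k (\<lambda>y. ennreal \<bar>f y - f x\<bar>) x * indicator (dcube k j) x \<partial>lborel) \<le>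
     ennreal (2 ^ CARD('n) * real CARD('n) * 2 powr real_of_int k) * (\<integral>\<^sup>+ x. h x * indicator (dcube k j) x \<partial>lborel)"
proof -
  let ?c = "2 powr real_of_int k"
  let ?H = "\<integral>\<^sup>+ x. h x * indicator (dcube k j) x \<partial>lborel"
  have "dav k (\<lambda>y. ennreal \<bar>f y - f x\<bar>) x * indicator (dcube k j) x = dav k (\<lambda>y. ennreal \<bar>f y - f x\<bar> * indicator (dcube k j) x) x" for x
    by (cases "x \<in> dcube k j") (auto simp: dav_def)
  hence "(\<integral>\<^sup>+ x. dav k (\<lambda>y. ennreal \<bar>f y - f x\<bar>) x * indicator (dcube k j) x \<partial>lborel) = (\<integral>\<^sup>+ x. dav k (\<lambda>y. ennreal \<bar>f y - f x\<bar> * indicator (dcube k j) x) x \<partial>lborel)"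
    by simp
  also have "\<dots> \<le> (\<integral>\<^sup>+ u. (\<integral>\<^sup>+ x. ennreal \<bar>f (x + ?c *\<^sub>R u) - f x\<bar> * indicator (dcube k j) x *
        indicator {x. cidx k x = cidx k (x + ?c *\<^sub>R u)} x \<partial>lborel) * indicator (cbox (- 1) 1) u \<partial>lborel)"
  proof (rule nn_integral_dav_pair)
    show "(\<lambda>p. ennreal \<bar>f (snd p) - f (fst p)\<bar> * indicator (dcube k j) (fst p)) \<in> borel_measurable borel"
      by (subst borel_prod[symmetric]) measurable
  qed
  also have "\<dots> \<le> ennreal (2 ^ CARD('n)) * (ennreal (?c * real CARD('n)) * ?H)"
  proof (rule nn_integral_cbox_le)
    fix u :: "real^'n" assume u: "u \<in> cbox (- 1) 1"
    let ?D = "{x. cidx k x = j \<and> cidx k x = cidx k (x + ?c *\<^sub>R u)}"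
    have "(\<integral>\<^sup>+ x. ennreal \<bar>f (x + ?c *\<^sub>R u) - f x\<bar> * indicator (dcube k j) x * indicator {x. cidx k x = cidx k (x + ?c *\<^sub>R u)} x \<partial>lborel)
       = (\<integral>\<^sup>+ x. ennreal \<bar>f (x + ?c *\<^sub>R u) - f x\<bar> * indicator ?D x \<partial>lborel)"
      by (intro nn_integral_cong) (auto simp: indicator_def mem_dcube_iff)
    also have "\<dots> \<le> ennreal (norm (?c *\<^sub>R u)) * ?H"
    proof (rule nn_integral_translate_local)
      show "?D \<in> sets borel" by measurable
      fix x t assume x: "x \<in> ?D" and t: "0 \<le> t" "t \<le> (1::real)"
      have "cidx k x = cidx k (x + ?c *\<^sub>R u)" "cidx k x = j" using x by auto
      hence "cidx k (x + t *\<^sub>R (?c *\<^sub>R u)) = j" using cidx_convex[OF _ t] by metis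
      thus "x + t *\<^sub>R (?c *\<^sub>R u) \<in> dcube k j" by (simp add: mem_dcube_iff)
    qed measurable
    also have "\<dots> \<le> ennreal (?c * real CARD('n)) * ?H"
      using norm_le_card_cbox[OF u] by (intro mult_right_mono ennreal_leI) auto
    finally show "(\<integral>\<^sup>+ x. ennreal \<bar>f (x + ?c *\<^sub>R u) - f x\<bar> * indicator (dcube k j) x * indicator {x. cidx k x = cidx k (x + ?c *\<^sub>R u)} x \<partial>lborel)
      \<le> ennreal (?c * real CARD('n)) * ?H" .
  qed
  also have "\<dots> = ennreal (2 ^ CARD('n) * real CARD('n) * ?c) * ?H"
    by (simp add: mult.assoc[symmetric] ennreal_mult[symmetric]) (simp add: mult_ac)
  finally show ?thesis .
qed

text \<open>At each point of the child |f| is at most the mean over the parent plus the oscillation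
  there. Averaging over the child and then enlarging to the parent costs 2^d, the Poincare
  inequality costs 2^d d, and the parent has twice the side.\<close>

lemma fav_le_parent:
  "ennreal (fav f k x) \<le> ennreal (fav f (k+1) x) + ennreal (2 * 4 ^ CARD('n) * real CARD('n) * 2 powr real_of_int k) * dav (k+1) h x"
proof -
  let ?K = "k + 1"
  let ?osc = "\<lambda>z. dav ?K (\<lambda>y. ennreal \<bar>f y - f z\<bar>) z"
  have [measurable]: "?osc \<in> borel_measurable borel" unfolding dav_def by measurable
  have pt: "ennreal \<bar>f z\<bar> \<le> dav ?K (\<lambda>y. ennreal \<bar>f y\<bar>) x + ?osc z" if "cidx k z = cidx k x" for z
  proof -
    have z: "cidx ?K z = cidx ?K x" using cidx_mono[OF that, of ?K] by simp
    have "ennreal \<bar>f z\<bar> = dav ?K (\<lambda>y. ennreal \<bar>f z\<bar>) z" by (simp add: dav_const)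
    also have "\<dots> \<le> dav ?K (\<lambda>y. ennreal \<bar>f y\<bar> + ennreal \<bar>f y - f z\<bar>) z"
      by (intro dav_mono) (simp add: ennreal_plus[symmetric] del: ennreal_plus)
    also have "\<dots> = dav ?K (\<lambda>y. ennreal \<bar>f y\<bar>) z + ?osc z" by (simp add: dav_add)
    also have "dav ?K (\<lambda>y. ennreal \<bar>f y\<bar>) z = dav ?K (\<lambda>y. ennreal \<bar>f y\<bar>) x" by (rule dav_cong_cidx[OF z])
    finally show ?thesis .
  qed
  have "dav k (\<lambda>y. ennreal \<bar>f y\<bar>) x \<le> dav k (\<lambda>z. dav ?K (\<lambda>y. ennreal \<bar>f y\<bar>) x + ?osc z) x"
    unfolding dav_def[of k] using pt
    by (intro divide_right_mono_ennreal nn_integral_mono) (auto simp: indicator_def)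
  also have "\<dots> = dav ?K (\<lambda>y. ennreal \<bar>f y\<bar>) x + dav k ?osc x"
    by (simp add: dav_add dav_const)
  also have "dav k ?osc x \<le> ennreal (2 * 4 ^ CARD('n) * real CARD('n) * 2 powr real_of_int k) * dav ?K h x"
  proof -
    have sub: "dcube k (cidx k x) \<subseteq> dcube ?K (cidx ?K x)"
    proof
      fix z assume "z \<in> dcube k (cidx k x)"
      hence "cidx k z = cidx k x" by (simp add: mem_dcube_iff)
      hence "cidx ?K z = cidx ?K x" by (rule cidx_mono) simp
      thus "z \<in> dcube ?K (cidx ?K x)" by (simp add: mem_dcube_iff)
    qed
    have "dav k ?osc x = ennreal (2 powr (- real_of_int k * real CARD('n))) * (\<integral>\<^sup>+ z. ?osc z * indicator (dcube k (cidx k x)) z \<partial>lborel)"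
      by (rule dav_eq_dcube)
    also have "\<dots> \<le> ennreal (2 powr (- real_of_int k * real CARD('n))) * (\<integral>\<^sup>+ z. ?osc z * indicator (dcube ?K (cidx ?K x)) z \<partial>lborel)"
      using sub by (intro mult_left_mono nn_integral_mono) (auto simp: indicator_def)
    also have "\<dots> \<le> ennreal (2 powr (- real_of_int k * real CARD('n))) * (ennreal (2 ^ CARD('n) * real CARD('n) * 2 powr real_of_int ?K) *
        (\<integral>\<^sup>+ z. h z * indicator (dcube ?K (cidx ?K x)) z \<partial>lborel))"
      by (intro mult_left_mono poincare_dcube) auto
    also have "\<dots> = ennreal (2 powr (- real_of_int k * real CARD('n))) * (ennreal (2 ^ CARD('n) * real CARD('n) * 2 powr real_of_int ?K) *
        (dav ?K h x * ennreal (2 powr (real_of_int ?K * real CARD('n)))))"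
      by (simp only: nn_integral_dcube_dav)
    also have "\<dots> = ennreal (2 powr (- real_of_int k * real CARD('n)) * (2 ^ CARD('n) * real CARD('n) * 2 powr real_of_int ?K) * 2 powr (real_of_int ?K * real CARD('n))) * dav ?K h x"
    proof -
      have "ennreal a * (ennreal b * (z * ennreal c)) = ennreal (a * b * c) * z" if "a \<ge> 0" "b \<ge> 0" "c \<ge> 0" for a b c :: real and z
        using that by (simp add: ennreal_mult mult_ac)
      thus ?thesis by simp
    qed
    also have "2 powr (- real_of_int k * real CARD('n)) * (2 ^ CARD('n) * real CARD('n) * 2 powr real_of_int ?K) * 2 powr (real_of_int ?K * real CARD('n))
       = 2 * 4 ^ CARD('n) * real CARD('n) * 2 powr real_of_int k"
    proof -
      have "2 powr (- real_of_int k * real CARD('n)) * 2 powr (real_of_int ?K * real CARD('n)) = 2 ^ CARD('n)"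
      proof -
        have "- real_of_int k * real CARD('n) + real_of_int ?K * real CARD('n) = real CARD('n)" by (simp add: ring_distribs)
        thus ?thesis by (simp only: powr_add[symmetric]) (simp add: powr_realpow)
      qed
      moreover have "2 powr real_of_int ?K = 2 * 2 powr real_of_int k" by (simp add: powr_add)
      moreover have "(4::real) ^ CARD('n) = 2 ^ CARD('n) * 2 ^ CARD('n)" by (simp add: power_mult_distrib[symmetric])
      moreover have "a * (q * d * s') * c = 2 * F * d * s" if "a * c = q" "s' = 2 * s" "F = q * q" for a q d s s' c F :: real
        using that by (simp add: mult_ac)
      ultimately show ?thesis by blast
    qed
    finally show ?thesis .
  qed
  finally show ?thesis by (simp add: locally_integrable_ennreal_fav[OF f_loc] add_left_mono)
qed

end

subsection \<open>The dyadic maximal theorem\<close>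

text \<open>The coarsest scale up to K with mean above c splits the superlevel set into disjoint
  pieces. Each piece is a union of cubes of its own scale, so on it the mean may be replaced by h
  under the integral. The cap K guarantees that a coarsest scale exists.\<close>

lemma dyadic_weak_type_bounded_scale:
  fixes h :: "real^'n::finite \<Rightarrow> ennreal"
  assumes [measurable]: "h \<in> borel_measurable borel"
  shows "c * emeasure lborel {x. \<exists>k\<le>K. c < dav k h x} \<le> (\<integral>\<^sup>+ x. h x \<partial>lborel)"
proof -
  define E where "E k = {x. k \<le> K \<and> c < dav k h x \<and> (\<forall>l\<in>{k<..K}. dav l h x \<le> c)}" for k
  define J where "J k = cidx k ` E k" for k
  have EJ: "x \<in> E k \<longleftrightarrow> cidx k x \<in> J k" for x k
  proof
    assume "cidx k x \<in> J k"
    then obtain y where y: "y \<in> E k" "cidx k x = cidx k y" by (auto simp: J_def)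
    have "dav l h x = dav l h y" if "k \<le> l" for l
      by (rule dav_cong_cidx, rule cidx_mono[OF y(2) that])
    thus "x \<in> E k" using y(1) by (simp add: E_def)
  qed (auto simp: J_def)
  have [measurable]: "E k \<in> sets borel" for k unfolding E_def by measurable
  have [measurable]: "{x. \<exists>k\<le>K. c < dav k h x} \<in> sets borel" by measurable
  have ex: "\<exists>k. x \<in> E k" if "\<exists>k\<le>K. c < dav k h x" for x
  proof -
    from that obtain k0 where k0: "k0 \<le> K" "c < dav k0 h x" by blast
    define S where "S = {k0..K} \<inter> {k. c < dav k h x}"
    have S: "finite S" "k0 \<in> S" unfolding S_def using k0 by auto
    define k where "k = Max S"
    have k: "k \<in> S" unfolding k_def using S by (intro Max_in) auto
    have "dav l h x \<le> c" if l: "l \<in> {k<..K}" for l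
    proof (rule ccontr)
      assume "\<not> dav l h x \<le> c"
      hence "l \<in> S" using l k by (auto simp: S_def)
      hence "l \<le> k" unfolding k_def using S by (intro Max_ge) auto
      thus False using l by simp
    qed
    hence "x \<in> E k" using k by (auto simp: E_def S_def)
    thus ?thesis by blast
  qed
  have uniq: "k = l" if "x \<in> E k" "x \<in> E l" for x k l
  proof (rule ccontr)
    assume "k \<noteq> l"
    hence "k < l \<or> l < k" by auto
    thus False using that by (auto simp: E_def not_less[symmetric])
  qed
  have "c * emeasure lborel {x. \<exists>k\<le>K. c < dav k h x} = (\<integral>\<^sup>+ x. c * indicator {x. \<exists>k\<le>K. c < dav k h x} x \<partial>lborel)"
    by (simp add: nn_integral_cmult_indicator)
  also have "\<dots> \<le> (\<integral>\<^sup>+ x. \<integral>\<^sup>+ k. indicator (E k) x * dav k h x \<partial>count_space UNIV \<partial>lborel)"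
  proof (intro nn_integral_mono)
    fix x
    show "c * indicator {x. \<exists>k\<le>K. c < dav k h x} x \<le> (\<integral>\<^sup>+ k. indicator (E k) x * dav k h x \<partial>count_space UNIV)"
    proof (cases "\<exists>k\<le>K. c < dav k h x")
      case True
      then obtain k where k: "x \<in> E k" using ex by blast
      have "c * indicator {x. \<exists>k\<le>K. c < dav k h x} x \<le> indicator (E k) x * dav k h x"
        using k True by (simp add: E_def less_imp_le)
      also have "\<dots> \<le> (\<integral>\<^sup>+ k. indicator (E k) x * dav k h x \<partial>count_space UNIV)"
        by (rule le_nn_integral_count_space)
      finally show ?thesis .
    qed simp
  qed
  also have "\<dots> = (\<integral>\<^sup>+ k. \<integral>\<^sup>+ x. indicator (E k) x * dav k h x \<partial>lborel \<partial>count_space UNIV)"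
    by (rule nn_integral_count_space_nn_integral) auto
  also have "\<dots> = (\<integral>\<^sup>+ k. \<integral>\<^sup>+ x. indicator (E k) x * h x \<partial>lborel \<partial>count_space UNIV)"
  proof (rule nn_integral_cong)
    fix k
    have "(indicator (E k) x :: ennreal) = indicator (J k) (cidx k x)" for x using EJ[of x k] by (auto simp: indicator_def)
    thus "(\<integral>\<^sup>+ x. indicator (E k) x * dav k h x \<partial>lborel) = (\<integral>\<^sup>+ x. indicator (E k) x * h x \<partial>lborel)"
      using nn_integral_dav[of h "indicator (J k)" k] by simp
  qed
  also have "\<dots> = (\<integral>\<^sup>+ x. \<integral>\<^sup>+ k. indicator (E k) x * h x \<partial>count_space UNIV \<partial>lborel)"
    by (rule nn_integral_count_space_nn_integral[symmetric]) auto
  also have "\<dots> \<le> (\<integral>\<^sup>+ x. h x \<partial>lborel)"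
  proof (intro nn_integral_mono nn_integral_count_space_le)
    fix x and F :: "int set" assume "finite F"
    show "(\<Sum>k\<in>F. indicator (E k) x * h x) \<le> h x"
    proof (cases "\<exists>k\<in>F. x \<in> E k")
      case True
      then obtain k where k: "k \<in> F" "x \<in> E k" by blast
      have "(\<Sum>k\<in>F. indicator (E k) x * h x) = (\<Sum>k\<in>{k}. indicator (E k) x * h x)"
        using k uniq \<open>finite F\<close> by (intro sum.mono_neutral_right) (auto simp: indicator_def)
      thus ?thesis using k by simp
    next
      case False
      hence "(\<Sum>k\<in>F. indicator (E k) x * h x) = 0" by (intro sum.neutral) auto
      thus ?thesis by simp
    qed
  qed
  finally show ?thesis .
qed

lemma dyadic_weak_type:
  fixes h :: "real^'n::finite \<Rightarrow> ennreal"
  assumes [measurable]: "h \<in> borel_measurable borel"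
  shows "c * emeasure lborel {x. \<exists>k. c < dav k h x} \<le> (\<integral>\<^sup>+ x. h x \<partial>lborel)"
proof -
  let ?A = "\<lambda>n::nat. {x. \<exists>k\<le>int n. c < dav k h x}"
  have "{x. \<exists>k. c < dav k h x} = (\<Union>n. ?A n)"
  proof (intro set_eqI iffI)
    fix x assume "x \<in> {x. \<exists>k. c < dav k h x}"
    then obtain k where "c < dav k h x" by blast
    hence "x \<in> ?A (nat k)" by (auto intro!: exI[of _ k])
    thus "x \<in> (\<Union>n. ?A n)" by blast
  qed auto
  moreover have "(SUP n. emeasure lborel (?A n)) = emeasure lborel (\<Union>n. ?A n)"
  proof (rule SUP_emeasure_incseq)
    show "range ?A \<subseteq> sets lborel" by auto
    show "incseq ?A"
    proof (rule incseq_SucI, rule subsetI)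
      fix n x assume "x \<in> ?A n"
      then obtain k where "k \<le> int n" "c < dav k h x" by blast
      hence "k \<le> int (Suc n) \<and> c < dav k h x" by simp
      thus "x \<in> ?A (Suc n)" by blast
    qed
  qed
  ultimately have "c * emeasure lborel {x. \<exists>k. c < dav k h x} = (SUP n. c * emeasure lborel (?A n))"
    by (simp only: SUP_mult_left_ennreal[symmetric])
  also have "\<dots> \<le> (\<integral>\<^sup>+ x. h x \<partial>lborel)"
    by (intro SUP_least dyadic_weak_type_bounded_scale) simp
  finally show ?thesis .
qed

text \<open>Values of h up to c contribute at most c to any mean, so a mean above 2c needs a mean
  above c of the remaining part. This truncation is what lets the sum over levels converge.\<close>

lemma dyadic_weak_type_truncated:
  fixes h :: "real^'n::finite \<Rightarrow> ennreal"
  assumes [measurable]: "h \<in> borel_measurable borel" and "c > 0"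
  shows "emeasure lborel {x. \<exists>k. ennreal (2 * c) < dav k h x} \<le> ennreal (1 / c) * (\<integral>\<^sup>+ x. h x * indicator {x. ennreal c < h x} x \<partial>lborel)"
proof -
  let ?h = "\<lambda>x. h x * indicator {x. ennreal c < h x} x"
  have "dav k h x \<le> ennreal c + dav k ?h x" for k x
  proof -
    have "dav k h x \<le> dav k (\<lambda>y. ennreal c + ?h y) x"
      by (intro dav_mono) (auto simp: indicator_def not_less)
    also have "\<dots> = ennreal c + dav k ?h x" by (simp add: dav_add dav_const)
    finally show ?thesis .
  qed
  hence sub: "ennreal c < dav k ?h x" if "ennreal (2 * c) < dav k h x" for k x
  proof -
    have "ennreal c + ennreal c = ennreal (2 * c)" using \<open>c > 0\<close> by (simp add: ennreal_plus[symmetric] del: ennreal_plus)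
    also have "\<dots> < dav k h x" by (rule that)
    also have "\<dots> \<le> ennreal c + dav k ?h x" by fact
    finally show ?thesis by (simp add: ennreal_add_left_cancel_less)
  qed
  hence "{x. \<exists>k. ennreal (2 * c) < dav k h x} \<subseteq> {x. \<exists>k. ennreal c < dav k ?h x}" by blast
  hence "emeasure lborel {x. \<exists>k. ennreal (2 * c) < dav k h x} \<le> emeasure lborel {x. \<exists>k. ennreal c < dav k ?h x}"
    by (rule emeasure_mono) measurable
  also have "\<dots> = ennreal (1 / c) * (ennreal c * emeasure lborel {x. \<exists>k. ennreal c < dav k ?h x})"
    using \<open>c > 0\<close> by (simp add: mult.assoc[symmetric] ennreal_mult[symmetric])
  also have "\<dots> \<le> ennreal (1 / c) * (\<integral>\<^sup>+ x. ?h x \<partial>lborel)"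
    by (intro mult_left_mono dyadic_weak_type) auto
  finally show ?thesis .
qed

lemma nn_integral_int_geometric_atMost:
  assumes "r > 0"
  shows "(\<integral>\<^sup>+ i. ennreal (2 powr (r * real_of_int i)) * indicator {..m} i \<partial>count_space (UNIV :: int set)) \<le> ennreal (2 powr (r * real_of_int m) / (1 - 2 powr (- r)))"
proof (rule nn_integral_count_space_le)
  fix F :: "int set" assume F: "finite F"
  define q where "q = 1 - 2 powr (- r)"
  have q: "q > 0" using assms by (simp add: q_def powr_less_one)
  have tel: "(\<Sum>i\<in>{a<..a + int n}. 2 powr (r * real_of_int i)) = (2 powr (r * real_of_int (a + int n)) - 2 powr (r * real_of_int a)) / q" for a n
  proof (induction n)
    case (Suc n)
    have "{a<..a + int (Suc n)} = insert (a + int (Suc n)) {a<..a + int n}" by auto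
    moreover have "2 powr (r * real_of_int (a + int n)) = 2 powr (r * real_of_int (a + int (Suc n))) * 2 powr (- r)"
      by (simp add: powr_add[symmetric] ring_distribs)
    hence "2 powr (r * real_of_int (a + int (Suc n))) = (2 powr (r * real_of_int (a + int (Suc n))) - 2 powr (r * real_of_int (a + int n))) / q"
    proof -
      let ?P = "2 powr (r * real_of_int (a + int (Suc n)))"
      have "?P - 2 powr (r * real_of_int (a + int n)) = ?P * q" unfolding \<open>2 powr (r * real_of_int (a + int n)) = _\<close> q_def by (simp only: right_diff_distrib mult_1_right)
      thus ?thesis using q by simp
    qed
    ultimately show ?case using Suc by (simp add: add_divide_distrib diff_divide_distrib)
  qed simp
  define a where "a = Min (insert m F) - 1"
  define n where "n = nat (m - a)"
  have "Min (insert m F) \<le> m" using F by (intro Min_le) auto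
  hence am: "a < m" by (simp add: a_def)
  have sub: "F \<inter> {..m} \<subseteq> {a<..a + int n}"
  proof
    fix k assume k: "k \<in> F \<inter> {..m}"
    hence "Min (insert m F) \<le> k" using F by (intro Min_le) auto
    thus "k \<in> {a<..a + int n}" using k am by (auto simp: n_def a_def)
  qed
  have "(\<Sum>i\<in>F. ennreal (2 powr (r * real_of_int i)) * indicator {..m} i) = (\<Sum>i\<in>F \<inter> {..m}. ennreal (2 powr (r * real_of_int i)))"
    using F by (intro sum.mono_neutral_cong_right) (auto simp: indicator_def)
  also have "\<dots> \<le> (\<Sum>i\<in>{a<..a + int n}. ennreal (2 powr (r * real_of_int i)))"
    by (rule sum_mono2) (use sub in auto)
  also have "\<dots> = ennreal (\<Sum>i\<in>{a<..a + int n}. 2 powr (r * real_of_int i))" by (simp add: sum_ennreal)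
  also have "\<dots> \<le> ennreal (2 powr (r * real_of_int m) / q)"
    unfolding tel using q am by (intro ennreal_leI divide_right_mono) (auto simp: n_def)
  finally show "(\<Sum>i\<in>F. ennreal (2 powr (r * real_of_int i)) * indicator {..m} i) \<le> ennreal (2 powr (r * real_of_int m) / (1 - 2 powr (- r)))"
    by (simp add: q_def)
qed

text \<open>Marcinkiewicz interpolation over the levels 2^i. Level i has weight 2^(p (i+1)), the
  truncated weak type bound costs 2^(1-i), and at a given x only levels with 2^(i-1) below the value
  of \<eta> contribute. What remains is a geometric sum of ratio 2^(p-1), convergent towards small
  levels because p > 1.\<close>

lemma dyadic_maximal_strong_type:
  fixes \<eta> :: "real^'n::finite \<Rightarrow> real"
  assumes [measurable]: "\<eta> \<in> borel_measurable borel" and \<eta>0: "\<And>x. 0 \<le> \<eta> x" and p: "1 < p"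
  shows "(\<integral>\<^sup>+ x. (SUP k. ennreal (enn2real (dav k (\<lambda>y. ennreal (\<eta> y)) x) powr p)) \<partial>lborel)
    \<le> ennreal (4 powr p * 2 / (1 - 2 powr (- (p - 1)))) * (\<integral>\<^sup>+ x. ennreal (\<eta> x powr p) \<partial>lborel)"
proof -
  let ?h = "\<lambda>y. ennreal (\<eta> y)"
  let ?A = "\<lambda>i::int. {x. \<exists>k. ennreal (2 powr real_of_int i) < dav k ?h x}"
  let ?w = "\<lambda>i::int. 2 powr (p * (real_of_int i + 1))"
  have pt: "(SUP k. ennreal (enn2real (dav k ?h x) powr p)) \<le> (\<integral>\<^sup>+ i. ennreal (?w i) * indicator (?A i) x \<partial>count_space UNIV)" for x
  proof (rule SUP_least)
    fix k
    define s where "s = enn2real (dav k ?h x)"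
    show "ennreal (enn2real (dav k ?h x) powr p) \<le> (\<integral>\<^sup>+ i. ennreal (?w i) * indicator (?A i) x \<partial>count_space UNIV)"
    proof (cases "s = 0")
      \<comment> \<open>This case includes an infinite mean, which \<open>enn2real\<close> maps to
        0.\<close>
      case True
      thus ?thesis by (simp add: s_def[symmetric])
    next
      case False
      hence s: "s > 0" by (simp add: s_def less_le)
      have ds: "dav k ?h x = ennreal s"
        using False unfolding s_def by (metis ennreal_enn2real_if enn2real_top)
      define i where "i = \<lceil>log 2 s\<rceil> - 1"
      have "real_of_int i < log 2 s" "log 2 s \<le> real_of_int i + 1" unfolding i_def by linarith+
      hence i: "2 powr real_of_int i < s" "s \<le> 2 powr (real_of_int i + 1)"
        using s by (simp_all add: less_log_iff log_le_iff)
      have "s powr p \<le> (2 powr (real_of_int i + 1)) powr p" using i s p by (intro powr_mono2) auto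
      also have "\<dots> = ?w i" by (simp add: powr_powr mult.commute)
      finally have "ennreal (s powr p) \<le> ennreal (?w i) * indicator (?A i) x"
        using i ds s by (auto simp: indicator_def ennreal_less_iff intro!: ennreal_leI exI[of _ k])
      also have "\<dots> \<le> (\<integral>\<^sup>+ i. ennreal (?w i) * indicator (?A i) x \<partial>count_space UNIV)"
        by (rule le_nn_integral_count_space)
      finally show ?thesis by (simp add: s_def)
    qed
  qed
  have "(\<integral>\<^sup>+ x. (SUP k. ennreal (enn2real (dav k ?h x) powr p)) \<partial>lborel) \<le> (\<integral>\<^sup>+ x. \<integral>\<^sup>+ i. ennreal (?w i) * indicator (?A i) x \<partial>count_space UNIV \<partial>lborel)"
    by (intro nn_integral_mono pt)
  also have "\<dots> = (\<integral>\<^sup>+ i. \<integral>\<^sup>+ x. ennreal (?w i) * indicator (?A i) x \<partial>lborel \<partial>count_space UNIV)"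
    by (rule nn_integral_count_space_nn_integral) auto
  also have "\<dots> = (\<integral>\<^sup>+ i. ennreal (?w i) * emeasure lborel (?A i) \<partial>count_space UNIV)"
    by (intro nn_integral_cong nn_integral_cmult_indicator) measurable
  also have "\<dots> \<le> (\<integral>\<^sup>+ i. \<integral>\<^sup>+ x. ennreal (?w i * 2 powr (1 - real_of_int i)) * (?h x * indicator {x. 2 powr (real_of_int i - 1) < \<eta> x} x) \<partial>lborel \<partial>count_space UNIV)"
  proof (intro nn_integral_mono)
    fix i :: int
    let ?c = "2 powr (real_of_int i - 1)"
    have e: "2 * ?c = 2 powr real_of_int i" "1 / ?c = 2 powr (1 - real_of_int i)"
      by (simp_all add: powr_diff)
    have "emeasure lborel (?A i) \<le> ennreal (1 / ?c) * (\<integral>\<^sup>+ x. ?h x * indicator {x. ennreal ?c < ?h x} x \<partial>lborel)"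
      using dyadic_weak_type_truncated[of ?h ?c] unfolding e by simp
    also have "(\<integral>\<^sup>+ x. ?h x * indicator {x. ennreal ?c < ?h x} x \<partial>lborel) = (\<integral>\<^sup>+ x. ?h x * indicator {x. ?c < \<eta> x} x \<partial>lborel)"
      by (intro nn_integral_cong) (auto simp: indicator_def ennreal_less_iff)
    finally have "ennreal (?w i) * emeasure lborel (?A i) \<le> ennreal (?w i) * (ennreal (2 powr (1 - real_of_int i)) * (\<integral>\<^sup>+ x. ?h x * indicator {x. ?c < \<eta> x} x \<partial>lborel))"
      unfolding e by (intro mult_left_mono) auto
    also have "\<dots> = (\<integral>\<^sup>+ x. ennreal (?w i * 2 powr (1 - real_of_int i)) * (?h x * indicator {x. ?c < \<eta> x} x) \<partial>lborel)"
      by (simp add: nn_integral_cmult ennreal_mult mult.assoc)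
    finally show "ennreal (?w i) * emeasure lborel (?A i) \<le> (\<integral>\<^sup>+ x. ennreal (?w i * 2 powr (1 - real_of_int i)) * (?h x * indicator {x. ?c < \<eta> x} x) \<partial>lborel)" .
  qed
  also have "\<dots> = (\<integral>\<^sup>+ x. \<integral>\<^sup>+ i. ennreal (?w i * 2 powr (1 - real_of_int i)) * (?h x * indicator {x. 2 powr (real_of_int i - 1) < \<eta> x} x) \<partial>count_space UNIV \<partial>lborel)"
    by (rule nn_integral_count_space_nn_integral[symmetric]) auto
  also have "\<dots> \<le> (\<integral>\<^sup>+ x. ennreal (4 powr p * 2 / (1 - 2 powr (- (p - 1)))) * ennreal (\<eta> x powr p) \<partial>lborel)"
  proof (intro nn_integral_mono)
    fix x
    show "(\<integral>\<^sup>+ i. ennreal (?w i * 2 powr (1 - real_of_int i)) * (?h x * indicator {x. 2 powr (real_of_int i - 1) < \<eta> x} x) \<partial>count_space UNIV)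
      \<le> ennreal (4 powr p * 2 / (1 - 2 powr (- (p - 1)))) * ennreal (\<eta> x powr p)"
    proof (cases "\<eta> x = 0")
      case True
      thus ?thesis by simp
    next
      case False
      hence pos: "\<eta> x > 0" using \<eta>0[of x] by simp
      define m where "m = \<lceil>log 2 (\<eta> x)\<rceil>"
      have m: "real_of_int m \<le> log 2 (\<eta> x) + 1" unfolding m_def by linarith
      have m2: "2 powr real_of_int m \<le> 2 * \<eta> x"
      proof -
        have "2 powr real_of_int m \<le> 2 powr (log 2 (\<eta> x) + 1)" using m by simp
        also have "\<dots> = 2 * \<eta> x" using pos by (simp add: powr_add)
        finally show ?thesis .
      qed
      have q: "0 < 1 - 2 powr (- (p - 1))" using p by (simp add: powr_less_one)
      have ind: "indicator {x. 2 powr (real_of_int i - 1) < \<eta> x} x \<le> (indicator {..m} i :: ennreal)" for i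
      proof (cases "2 powr (real_of_int i - 1) < \<eta> x")
        case True
        hence "real_of_int i - 1 < log 2 (\<eta> x)" using pos by (simp add: less_log_iff)
        hence "i \<le> m" unfolding m_def by linarith
        thus ?thesis using True by simp
      qed simp
      have w: "?w i * 2 powr (1 - real_of_int i) = 2 powr (p + 1) * 2 powr ((p - 1) * real_of_int i)" for i
        by (simp add: powr_add[symmetric] algebra_simps)
      have "(\<integral>\<^sup>+ i. ennreal (?w i * 2 powr (1 - real_of_int i)) * (?h x * indicator {x. 2 powr (real_of_int i - 1) < \<eta> x} x) \<partial>count_space UNIV)
        \<le> (\<integral>\<^sup>+ i. ennreal (2 powr (p + 1) * \<eta> x) * (ennreal (2 powr ((p - 1) * real_of_int i)) * indicator {..m} i) \<partial>count_space UNIV)"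
      proof (intro nn_integral_mono)
        fix i
        have "ennreal (?w i * 2 powr (1 - real_of_int i)) * (?h x * indicator {x. 2 powr (real_of_int i - 1) < \<eta> x} x)
          \<le> ennreal (?w i * 2 powr (1 - real_of_int i)) * (?h x * indicator {..m} i)"
          by (intro mult_left_mono ind) auto
        also have "\<dots> = ennreal (2 powr (p + 1) * \<eta> x) * (ennreal (2 powr ((p - 1) * real_of_int i)) * indicator {..m} i)"
          unfolding w using pos by (simp add: ennreal_mult mult_ac)
        finally show "ennreal (?w i * 2 powr (1 - real_of_int i)) * (?h x * indicator {x. 2 powr (real_of_int i - 1) < \<eta> x} x)
          \<le> ennreal (2 powr (p + 1) * \<eta> x) * (ennreal (2 powr ((p - 1) * real_of_int i)) * indicator {..m} i)" .
      qed
      also have "\<dots> = ennreal (2 powr (p + 1) * \<eta> x) * (\<integral>\<^sup>+ i. ennreal (2 powr ((p - 1) * real_of_int i)) * indicator {..m} i \<partial>count_space UNIV)"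
        by (rule nn_integral_cmult) simp
      also have "\<dots> \<le> ennreal (2 powr (p + 1) * \<eta> x) * ennreal (2 powr ((p - 1) * real_of_int m) / (1 - 2 powr (- (p - 1))))"
        using p by (intro mult_left_mono nn_integral_int_geometric_atMost) auto
      also have "\<dots> = ennreal (2 powr (p + 1) * \<eta> x * (2 powr ((p - 1) * real_of_int m) / (1 - 2 powr (- (p - 1)))))"
        using q pos by (intro ennreal_mult[symmetric]) auto
      also have "\<dots> \<le> ennreal (4 powr p * 2 / (1 - 2 powr (- (p - 1))) * \<eta> x powr p)"
      proof (rule ennreal_leI)
        have "2 powr ((p - 1) * real_of_int m) = (2 powr real_of_int m) powr (p - 1)" by (simp add: powr_powr mult.commute)
        also have "\<dots> \<le> (2 * \<eta> x) powr (p - 1)" using m2 p by (intro powr_mono2) auto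
        also have "\<dots> = 2 powr (p - 1) * \<eta> x powr (p - 1)" using pos by (simp add: powr_mult)
        finally have "2 powr (p + 1) * \<eta> x * 2 powr ((p - 1) * real_of_int m) \<le> 2 powr (p + 1) * \<eta> x * (2 powr (p - 1) * \<eta> x powr (p - 1))"
          using pos by (intro mult_left_mono) auto
        also have "\<dots> = 2 powr (p + 1) * 2 powr (p - 1) * (\<eta> x powr 1 * \<eta> x powr (p - 1))" using pos by simp
        also have "2 powr (p + 1) * 2 powr (p - 1) = 4 powr p"
          by (simp add: powr_add[symmetric] powr_powr[of 2 2 p, symmetric])
        also have "\<eta> x powr 1 * \<eta> x powr (p - 1) = \<eta> x powr p" unfolding powr_add[symmetric] by simp
        also have "4 powr p * \<eta> x powr p \<le> 4 powr p * 2 * \<eta> x powr p" by simp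
        finally have "2 powr (p + 1) * \<eta> x * 2 powr ((p - 1) * real_of_int m) / (1 - 2 powr (- (p - 1))) \<le> 4 powr p * 2 * \<eta> x powr p / (1 - 2 powr (- (p - 1)))"
          using q by (intro divide_right_mono) auto
        thus "2 powr (p + 1) * \<eta> x * (2 powr ((p - 1) * real_of_int m) / (1 - 2 powr (- (p - 1)))) \<le> 4 powr p * 2 / (1 - 2 powr (- (p - 1))) * \<eta> x powr p"
          by simp
      qed
      also have "\<dots> = ennreal (4 powr p * 2 / (1 - 2 powr (- (p - 1)))) * ennreal (\<eta> x powr p)"
        using q by (intro ennreal_mult) auto
      finally show ?thesis .
    qed
  qed
  also have "\<dots> = ennreal (4 powr p * 2 / (1 - 2 powr (- (p - 1)))) * (\<integral>\<^sup>+ x. ennreal (\<eta> x powr p) \<partial>lborel)"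
    by (rule nn_integral_cmult) measurable
  finally show ?thesis .
qed

subsection \<open>Stopping cubes and the endpoint estimates\<close>

lemma epowr_mono: "x \<le> y \<Longrightarrow> 0 \<le> q \<Longrightarrow> epowr x q \<le> epowr y q"
proof (cases "y = \<infinity>")
  case False
  assume "x \<le> y" "0 \<le> q"
  moreover from this False have "x \<noteq> \<infinity>" by (metis neq_top_trans infinity_ennreal_def)
  ultimately show ?thesis using False
    unfolding epowr_def by (auto intro!: ennreal_leI powr_mono2 enn2real_mono simp: less_top)
qed (simp add: epowr_def)

lemma epowr_ennreal: "0 \<le> t \<Longrightarrow> epowr (ennreal t) q = ennreal (t powr q)"
  by (simp add: epowr_def)

lemma avg_eq_fav:
  assumes f: "f \<in> borel_measurable lebesgue" and [measurable]: "f' \<in> borel_measurable borel"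
    and eq: "AE x in lborel. f x = f' x"
  shows "avg f (dcube k (cidx k x)) = fav f' k x"
proof -
  let ?Q = "dcube k (cidx k x)"
  have Q: "{y. cidx k y = cidx k x} = ?Q" by (auto simp: mem_dcube_iff)
  have eq': "AE y in lebesgue. f y = f' y" using eq by (rule AE_completion)
  have f'l: "f' \<in> borel_measurable lebesgue" by (rule measurable_completion) simp
  have Ql: "?Q \<in> sets lebesgue" by simp
  have "(LINT y:?Q|lebesgue. \<bar>f y\<bar>) = (LINT y:?Q|lebesgue. \<bar>f' y\<bar>)"
    unfolding set_lebesgue_integral_def
  proof (rule integral_cong_AE)
    show "AE y in lebesgue. indicator ?Q y *\<^sub>R \<bar>f y\<bar> = indicator ?Q y *\<^sub>R \<bar>f' y\<bar>" using eq' by eventually_elim simp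
  qed (use f f'l Ql in measurable)
  also have "\<dots> = (LINT y:?Q|lborel. \<bar>f' y\<bar>)"
    unfolding set_lebesgue_integral_def by (rule integral_completion) measurable
  also have "\<dots> = enn2real (\<integral>\<^sup>+ y. ennreal (indicator ?Q y *\<^sub>R \<bar>f' y\<bar>) \<partial>lborel)"
    unfolding set_lebesgue_integral_def by (rule integral_eq_nn_integral) auto
  also have "(\<integral>\<^sup>+ y. ennreal (indicator ?Q y *\<^sub>R \<bar>f' y\<bar>) \<partial>lborel) = (\<integral>\<^sup>+ y. ennreal \<bar>f' y\<bar> * indicator ?Q y \<partial>lborel)"
    by (intro nn_integral_cong) (auto simp: indicator_def)
  finally have num: "(LINT y:?Q|lebesgue. \<bar>f y\<bar>) = enn2real (\<integral>\<^sup>+ y. ennreal \<bar>f' y\<bar> * indicator ?Q y \<partial>lborel)" .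
  show ?thesis
    unfolding avg_def num fav_def nn_integral_dcube_dav
    by (simp add: enn2real_mult measure_dcube)
qed

lemma Q_alpha_avg_less:
  fixes x :: "real^'n::finite"
  assumes "(k, cidx k x) \<in> Q_alpha \<alpha> f" "k < l"
  shows "2 powr (real_of_int l * \<alpha>) * avg f (dcube l (cidx l x)) < 2 powr (real_of_int k * \<alpha>) * avg f (dcube k (cidx k x))"
proof -
  have sub: "dcube k (cidx k x) \<subseteq> dcube l (cidx l x)"
  proof
    fix z assume "z \<in> dcube k (cidx k x)"
    hence "cidx k z = cidx k x" by (simp add: mem_dcube_iff)
    hence "cidx l z = cidx l x" by (rule cidx_mono) (use assms(2) in simp)
    thus "z \<in> dcube l (cidx l x)" by (simp add: mem_dcube_iff)
  qed
  \<comment> \<open>\<open>Q_alpha\<close> compares with strictly larger cubes; strictness is read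
    off from the volumes.\<close>
  have "real_of_int k * real CARD('n) < real_of_int l * real CARD('n)" using assms(2) by simp
  hence "measure lborel (dcube k (cidx k x)) < measure lborel (dcube l (cidx l x))"
    unfolding measure_dcube by (intro powr_less_mono) auto
  hence "dcube k (cidx k x) \<noteq> dcube l (cidx l x)" by auto
  with sub have "dcube k (cidx k x) \<subset> dcube l (cidx l x)" by blast
  hence "side l powr \<alpha> * avg f (dcube l (cidx l x)) < side k powr \<alpha> * avg f (dcube k (cidx k x))"
    using assms(1) unfolding Q_alpha_def by blast
  thus ?thesis by (simp add: side_def powr_powr)
qed

lemma Q_alpha_avg_le:
  fixes x :: "real^'n::finite"
  assumes "(k, cidx k x) \<in> Q_alpha \<alpha> f" "k < l"
  shows "avg f (dcube l (cidx l x)) \<le> 2 powr (- (real_of_int (l - k) * \<alpha>)) * avg f (dcube k (cidx k x))"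
proof -
  have "2 powr (- (real_of_int l * \<alpha>)) * (2 powr (real_of_int l * \<alpha>) * avg f (dcube l (cidx l x))) \<le> 2 powr (- (real_of_int l * \<alpha>)) * (2 powr (real_of_int k * \<alpha>) * avg f (dcube k (cidx k x)))"
    using Q_alpha_avg_less[OF assms] by (intro mult_left_mono) auto
  thus ?thesis by (simp add: mult.assoc[symmetric] powr_add[symmetric] left_diff_distrib)
qed

text \<open>Each term of the supremum is at most the q-th root of Z, hence so is the supremum, and
  taking powers is monotone. If Z is infinite there is nothing to show.\<close>

lemma epowr_dyadic_max_le:
  fixes x :: "real^'n::finite"
  assumes good: "\<And>k j. x \<in> closure (dcube k j) \<Longrightarrow> cidx k x = j"
    and q: "0 < q"
    and le: "\<And>k. (k, cidx k x) \<in> Q_alpha \<alpha> f \<Longrightarrow> ennreal ((2 powr (real_of_int k * (\<alpha> + \<beta>)) * avg f (dcube k (cidx k x))) powr q) \<le> Z"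
    and nn: "\<And>k. 0 \<le> avg f (dcube k (cidx k x))"
  shows "epowr (dyadic_max \<alpha> \<beta> f x) q \<le> Z"
proof (cases Z)
  case (real z)
  have "dyadic_max \<alpha> \<beta> f x \<le> ennreal (z powr (1 / q))"
    unfolding dyadic_max_def
  proof (rule SUP_least)
    fix p assume p: "p \<in> {(k, j). (k, j) \<in> Q_alpha \<alpha> f \<and> x \<in> closure (dcube k j)}"
    then obtain k j where kj: "p = (k, j)" "(k, j) \<in> Q_alpha \<alpha> f" "x \<in> closure (dcube k j)" by blast
    have j: "j = cidx k x" using good[OF kj(3)] by simp
    let ?t = "2 powr (real_of_int k * (\<alpha> + \<beta>)) * avg f (dcube k (cidx k x))"
    have "?t powr q \<le> z" using le[of k] kj(2) j real by (simp add: ennreal_le_iff)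
    hence "(?t powr q) powr (1 / q) \<le> z powr (1 / q)" using q by (intro powr_mono2) auto
    hence "?t \<le> z powr (1 / q)" using q nn[of k] by (simp add: powr_powr)
    thus "(case p of (k, j) \<Rightarrow> ennreal (side k powr (\<alpha> + \<beta>) * avg f (dcube k j))) \<le> ennreal (z powr (1 / q))"
      using j kj(1) by (auto simp: side_def powr_powr intro!: ennreal_leI)
  qed
  hence "epowr (dyadic_max \<alpha> \<beta> f x) q \<le> epowr (ennreal (z powr (1 / q))) q" using q by (intro epowr_mono) auto
  also have "\<dots> = Z" using q real by (simp add: epowr_ennreal powr_powr)
  finally show ?thesis .
qed simp

lemma dyadic_max_le:
  fixes x :: "real^'n::finite"
  assumes good: "\<And>k j. x \<in> closure (dcube k j) \<Longrightarrow> cidx k x = j"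
    and le: "\<And>k. (k, cidx k x) \<in> Q_alpha \<alpha> f \<Longrightarrow> 2 powr (real_of_int k * (\<alpha> + \<beta>)) * avg f (dcube k (cidx k x)) \<le> z"
  shows "dyadic_max \<alpha> \<beta> f x \<le> ennreal z"
  unfolding dyadic_max_def
proof (rule SUP_least)
  fix p assume p: "p \<in> {(k, j). (k, j) \<in> Q_alpha \<alpha> f \<and> x \<in> closure (dcube k j)}"
  then obtain k j where kj: "p = (k, j)" "(k, j) \<in> Q_alpha \<alpha> f" "x \<in> closure (dcube k j)" by blast
  have j: "j = cidx k x" using good[OF kj(3)] by simp
  thus "(case p of (k, j) \<Rightarrow> ennreal (side k powr (\<alpha> + \<beta>) * avg f (dcube k j))) \<le> ennreal z"
    using le[of k] kj by (auto simp: side_def powr_powr intro!: ennreal_leI)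
qed

text \<open>Hoelder's inequality up to a factor 2. Pointwise \<eta> is at most s + s^(1-p) \<eta>^p
  for every s > 0, by comparing \<eta> with s. Taking for s the expected size 2^(-k d / p) G of the
  mean makes both summands average to at most s.\<close>

lemma dav_holder:
  fixes \<eta> :: "real^'n::finite \<Rightarrow> real"
  assumes [measurable]: "\<eta> \<in> borel_measurable borel" and \<eta>0: "\<And>x. 0 \<le> \<eta> x" and p: "1 \<le> p" and G: "0 \<le> G"
    and int: "(\<integral>\<^sup>+ x. ennreal (\<eta> x powr p) \<partial>lborel) \<le> ennreal (G powr p)"
  shows "dav k (\<lambda>y. ennreal (\<eta> y)) x \<le> ennreal (2 * 2 powr (- (real_of_int k * real CARD('n) / p)) * G)"
proof (cases "G = 0")
  \<comment> \<open>The comparison level s would be 0 here; instead \<eta> vanishes almost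
    everywhere.\<close>
  case True
  hence "(\<integral>\<^sup>+ x. ennreal (\<eta> x powr p) \<partial>lborel) = 0" using int by simp
  hence "AE x in lborel. ennreal (\<eta> x powr p) = 0" by (subst (asm) nn_integral_0_iff_AE) simp_all
  hence "AE y in lborel. ennreal (\<eta> y) * indicator {y. cidx k y = cidx k x} y = 0"
  proof eventually_elim
    fix y assume "ennreal (\<eta> y powr p) = 0"
    hence "\<eta> y = 0" by (simp add: ennreal_eq_0_iff)
    thus "ennreal (\<eta> y) * indicator {y. cidx k y = cidx k x} y = 0" by simp
  qed
  hence "(\<integral>\<^sup>+ y. ennreal (\<eta> y) * indicator {y. cidx k y = cidx k x} y \<partial>lborel) = 0"
    by (subst nn_integral_0_iff_AE) simp_all
  thus ?thesis by (simp add: dav_def)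
next
  case False
  hence Gp: "G > 0" using G by simp
  let ?v = "2 powr (real_of_int k * real CARD('n))"
  define s where "s = 2 powr (- (real_of_int k * real CARD('n) / p)) * G"
  have s: "s > 0" unfolding s_def using Gp by simp
  have pt: "\<eta> y \<le> s + s powr (1 - p) * \<eta> y powr p" for y
  proof (cases "\<eta> y \<le> s")
    case True
    have "0 \<le> s powr (1 - p) * \<eta> y powr p" by simp
    thus ?thesis using True by linarith
  next
    case False
    hence "s powr (p - 1) \<le> \<eta> y powr (p - 1)" using s p by (intro powr_mono2) auto
    hence "s powr (1 - p) * s powr (p - 1) \<le> s powr (1 - p) * \<eta> y powr (p - 1)" by (intro mult_left_mono) auto
    hence "1 \<le> s powr (1 - p) * \<eta> y powr (p - 1)" using s by (simp add: powr_add[symmetric])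
    hence "\<eta> y * 1 \<le> \<eta> y * (s powr (1 - p) * \<eta> y powr (p - 1))" by (intro mult_left_mono \<eta>0) auto
    also have "\<dots> = s powr (1 - p) * (\<eta> y powr 1 * \<eta> y powr (p - 1))" using False s by simp
    also have "\<eta> y powr 1 * \<eta> y powr (p - 1) = \<eta> y powr p" unfolding powr_add[symmetric] by simp
    finally show ?thesis using s by simp
  qed
  have "dav k (\<lambda>y. ennreal (\<eta> y)) x \<le> dav k (\<lambda>y. ennreal s + ennreal (s powr (1 - p)) * ennreal (\<eta> y powr p)) x"
  proof (rule dav_mono)
    fix y
    have "ennreal (\<eta> y) \<le> ennreal (s + s powr (1 - p) * \<eta> y powr p)" by (rule ennreal_leI[OF pt])
    also have "\<dots> = ennreal s + ennreal (s powr (1 - p)) * ennreal (\<eta> y powr p)"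
      using s by (simp add: ennreal_mult)
    finally show "ennreal (\<eta> y) \<le> ennreal s + ennreal (s powr (1 - p)) * ennreal (\<eta> y powr p)" .
  qed
  also have "\<dots> = ennreal s + dav k (\<lambda>y. ennreal (s powr (1 - p)) * ennreal (\<eta> y powr p)) x"
    by (simp add: dav_add dav_const)
  also have "dav k (\<lambda>y. ennreal (s powr (1 - p)) * ennreal (\<eta> y powr p)) x \<le> ennreal s"
  proof -
    have "dav k (\<lambda>y. ennreal (s powr (1 - p)) * ennreal (\<eta> y powr p)) x \<le> (\<integral>\<^sup>+ y. ennreal (s powr (1 - p)) * ennreal (\<eta> y powr p) \<partial>lborel) / ennreal ?v"
      unfolding dav_def by (intro divide_right_mono_ennreal nn_integral_mono) (auto simp: indicator_def)
    also have "\<dots> = ennreal (s powr (1 - p)) * (\<integral>\<^sup>+ y. ennreal (\<eta> y powr p) \<partial>lborel) / ennreal ?v"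
      by (subst nn_integral_cmult) auto
    also have "\<dots> \<le> ennreal (s powr (1 - p)) * ennreal (G powr p) / ennreal ?v"
      by (intro divide_right_mono_ennreal mult_left_mono int) auto
    also have "\<dots> = ennreal (s powr (1 - p) * G powr p / ?v)"
      by (simp add: ennreal_mult[symmetric] divide_ennreal)
    also have "s powr (1 - p) * G powr p / ?v = s"
    proof -
      have "s powr p = 2 powr (- (real_of_int k * real CARD('n))) * G powr p"
        unfolding s_def using Gp p by (simp add: powr_mult powr_powr)
      hence "G powr p / ?v = s powr p" by (simp add: powr_minus divide_inverse mult.commute)
      hence "s powr (1 - p) * G powr p / ?v = s powr (1 - p) * s powr p" by (metis times_divide_eq_right)
      also have "\<dots> = s" using s by (simp add: powr_add[symmetric])
      finally show ?thesis .
    qed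
    finally show ?thesis .
  qed
  finally have "dav k (\<lambda>y. ennreal (\<eta> y)) x \<le> ennreal s + ennreal s" by (simp add: add_left_mono)
  also have "\<dots> = ennreal (2 * 2 powr (- (real_of_int k * real CARD('n) / p)) * G)"
    using s by (simp add: ennreal_plus[symmetric] s_def mult_ac del: ennreal_plus)
  finally show ?thesis .
qed

section \<open>Exponent one: from stopping cubes to the maximal function\<close>

lemma ex_stopping_gap:
  assumes "0 < (\<alpha>::real)"
  obtains n :: nat where "0 < n" "2 ^ (d + 1) * 2 powr (- (real n * \<alpha>)) \<le> 1 / 2"
proof -
  \<comment> \<open>In d + 2, the part d + 1 pays for the factor of \<open>favmax\<close> and 1 for
    the half that must remain.\<close>
  define n where "n = nat \<lceil>real (d + 2) / \<alpha>\<rceil>"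
  have "real (d + 2) / \<alpha> \<le> real n" unfolding n_def by linarith
  hence n: "real (d + 2) \<le> real n * \<alpha>" using assms by (simp add: pos_divide_le_eq)
  have "2 powr (- (real n * \<alpha>)) \<le> 2 powr (- real (d + 2))" using n by (intro powr_mono) auto
  also have "\<dots> = 1 / 2 ^ (d + 2)" by (simp only: powr_minus powr_realpow inverse_eq_divide)
  finally have "2 ^ (d + 1) * 2 powr (- (real n * \<alpha>)) \<le> 2 ^ (d + 1) * (1 / 2 ^ (d + 2))" by (intro mult_left_mono) auto
  also have "\<dots> = 1 / 2" by (simp add: field_simps)
  finally show ?thesis using n assms by (intro that[of n]) (auto intro: Nat.gr0I)
qed

text \<open>The means over the ancestors of a selected cube decay like 2^(-(l-k) \<alpha>). From n
  scales up this beats the factor 2^(d+1) with a half to spare, which is the hypothesis of the layer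
  estimate. For the second claim keep one cube of the sum: 2^(-k) times its volume is 2^(k
  (d-1)).\<close>

lemma L1_modulus_stopping:
  fixes f f' :: "real^'n::finite \<Rightarrow> real"
  assumes n: "0 < n" "2 ^ (CARD('n) + 1) * 2 powr (- (real n * \<alpha>)) \<le> 1 / 2" and \<alpha>: "0 < \<alpha>"
    and f: "f \<in> borel_measurable lebesgue" "AE x in lborel. f x = f' x"
    and L1: "L1_modulus f' V"
  shows "(\<integral>\<^sup>+ x. \<integral>\<^sup>+ k. ennreal (2 powr (- real_of_int k)) * ennreal (fav f' k x) * indicator {j. (k, j) \<in> Q_alpha \<alpha> f} (cidx k x) \<partial>count_space UNIV \<partial>lborel)
      \<le> ennreal (2 ^ n * 4 * 2 ^ CARD('n) * real CARD('n) * V)" (is "?I \<le> _")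
    and "(k, cidx k x) \<in> Q_alpha \<alpha> f \<Longrightarrow> 2 powr (real_of_int k * (real CARD('n) - 1)) * fav f' k x \<le> 2 ^ n * 4 * 2 ^ CARD('n) * real CARD('n) * V"
proof -
  interpret L1_modulus f' V by (rule L1)
  have avg: "avg f (dcube k (cidx k x)) = fav f' k x" for k x
    by (rule avg_eq_fav[OF f(1) f_meas f(2)])
  show I: "?I \<le> ennreal (2 ^ n * 4 * 2 ^ CARD('n) * real CARD('n) * V)"
  proof (rule nn_integral_stopping_sum_le)
    fix k l :: int and x :: "real^'n"
    assume kx: "cidx k x \<in> {j. (k, j) \<in> Q_alpha \<alpha> f}" and l: "k + int n \<le> l"
    have kl: "k < l" using l n(1) by simp
    have "fav f' l x \<le> 2 powr (- (real_of_int (l - k) * \<alpha>)) * fav f' k x"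
      using Q_alpha_avg_le[of k x \<alpha> f l] kx kl by (simp add: avg)
    also have "\<dots> \<le> 2 powr (- (real n * \<alpha>)) * fav f' k x"
      using l \<alpha> by (intro mult_right_mono fav_nonneg powr_mono) (auto intro!: mult_right_mono)
    finally have "2 ^ (CARD('n) + 1) * fav f' l x \<le> 2 ^ (CARD('n) + 1) * (2 powr (- (real n * \<alpha>)) * fav f' k x)"
      by (rule mult_left_mono) simp
    also have "\<dots> = (2 ^ (CARD('n) + 1) * 2 powr (- (real n * \<alpha>))) * fav f' k x" by (simp only: mult.assoc)
    also have "\<dots> \<le> (1 / 2) * fav f' k x" by (rule mult_right_mono[OF n(2) fav_nonneg])
    finally show "2 ^ (CARD('n) + 1) * fav f' l x \<le> fav f' k x / 2" by simp
  qed
  assume kx: "(k, cidx k x) \<in> Q_alpha \<alpha> f"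
  let ?v = "2 powr (real_of_int k * real CARD('n))"
  have "ennreal (2 powr (- real_of_int k) * fav f' k x * ?v) = ennreal (2 powr (- real_of_int k)) * ennreal (fav f' k x) * emeasure lborel (dcube k (cidx k x))"
    by (simp add: emeasure_dcube ennreal_mult fav_nonneg)
  also have "\<dots> = (\<integral>\<^sup>+ y. ennreal (2 powr (- real_of_int k)) * ennreal (fav f' k x) * indicator (dcube k (cidx k x)) y \<partial>lborel)"
    by (rule nn_integral_cmult_indicator[symmetric]) simp
  also have "\<dots> \<le> ?I"
  proof (rule nn_integral_mono)
    fix y
    show "ennreal (2 powr (- real_of_int k)) * ennreal (fav f' k x) * indicator (dcube k (cidx k x)) y
      \<le> (\<integral>\<^sup>+ k. ennreal (2 powr (- real_of_int k)) * ennreal (fav f' k y) * indicator {j. (k, j) \<in> Q_alpha \<alpha> f} (cidx k y) \<partial>count_space UNIV)"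
    proof (cases "cidx k y = cidx k x")
      case True
      have "ennreal (2 powr (- real_of_int k)) * ennreal (fav f' k x) * indicator (dcube k (cidx k x)) y
         = ennreal (2 powr (- real_of_int k)) * ennreal (fav f' k y) * indicator {j. (k, j) \<in> Q_alpha \<alpha> f} (cidx k y)"
        using True kx fav_cong_cidx[OF True, of f'] by (simp add: mem_dcube_iff)
      also have "\<dots> \<le> (\<integral>\<^sup>+ k. ennreal (2 powr (- real_of_int k)) * ennreal (fav f' k y) * indicator {j. (k, j) \<in> Q_alpha \<alpha> f} (cidx k y) \<partial>count_space UNIV)"
        by (rule le_nn_integral_count_space)
      finally show ?thesis .
    next
      case False
      thus ?thesis by (simp add: mem_dcube_iff)
    qed
  qed
  also note I
  finally have "2 powr (- real_of_int k) * fav f' k x * ?v \<le> 2 ^ n * 4 * 2 ^ CARD('n) * real CARD('n) * V"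
    using V_nonneg by (subst (asm) ennreal_le_iff) auto
  moreover have "2 powr (real_of_int k * (real CARD('n) - 1)) = 2 powr (- real_of_int k) * ?v"
    by (simp add: powr_add[symmetric] right_diff_distrib)
  ultimately show "2 powr (real_of_int k * (real CARD('n) - 1)) * fav f' k x \<le> 2 ^ n * 4 * 2 ^ CARD('n) * real CARD('n) * V"
    by (simp add: mult_ac)
qed

text \<open>With a = 1 + \<alpha> + \<beta> this q is the Sobolev exponent. The last identity is the
  homogeneity that cancels the powers of 2^k in both L^q estimates.\<close>

lemma exponent_identity:
  fixes p a d :: real
  assumes "0 < d" "1 \<le> p" "0 \<le> a" "a < d / p"
  defines "q \<equiv> 1 / (1 / p - a / d)"
  shows "0 < q" "p \<le> q" "a * q = d * (q - p) / p"
proof -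
  have pos: "0 < 1 / p - a / d" using assms by (simp add: field_simps)
  thus "0 < q" by (simp add: q_def)
  have "1 / p - a / d \<le> 1 / p" using assms by simp
  hence "1 / (1 / p) \<le> q" unfolding q_def using pos by (intro divide_left_mono mult_pos_pos) (use assms in auto)
  thus "p \<le> q" by simp
  have "q * (1 / p - a / d) = 1" using pos by (simp add: q_def)
  hence "q * (d - a * p) = p * d" using assms by (simp add: field_simps)
  thus "a * q = d * (q - p) / p" using assms by (simp add: field_simps)
qed

text \<open>Put s = 2^(k (d-1)) times the mean. By homogeneity the q-th power of a term of the
  supremum is 2^(-k d) s^q, and the single-cube bound s <= B turns it into at most B^(q-1) times a
  term of the family whose integrated sum is at most B. The supremum is bounded by the sum.\<close>

lemma dyadic_max_Lq_of_L1_modulus: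
  fixes f f' :: "real^'n::finite \<Rightarrow> real"
  assumes n: "0 < n" "2 ^ (CARD('n) + 1) * 2 powr (- (real n * \<alpha>)) \<le> 1 / 2" and \<alpha>: "0 < \<alpha>"
    and f: "f \<in> borel_measurable lebesgue" "AE x in lborel. f x = f' x"
    and L1: "L1_modulus f' V"
    and ab: "0 \<le> \<alpha> + \<beta> + 1" "\<alpha> + \<beta> + 1 < real CARD('n)"
  shows "Lq_enorm (1 / (1 - (1 + \<alpha> + \<beta>) / real CARD('n))) (dyadic_max \<alpha> \<beta> f) \<le> ennreal (2 ^ n * 4 * 2 ^ CARD('n) * real CARD('n) * V)"
proof -
  interpret L1_modulus f' V by (rule L1)
  define d where "d = real CARD('n)"
  define q where "q = 1 / (1 - (1 + \<alpha> + \<beta>) / d)"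
  define B where "B = 2 ^ n * 4 * 2 ^ CARD('n) * real CARD('n) * V"
  have d: "d > 0" by (simp add: d_def)
  have B0: "B \<ge> 0" using V_nonneg by (simp add: B_def)
  have "0 < q \<and> 1 \<le> q \<and> (1 + \<alpha> + \<beta>) * q = d * (q - 1)"
    using exponent_identity[of d 1 "1 + \<alpha> + \<beta>"] ab d by (simp add: q_def d_def algebra_simps)
  hence q: "0 < q" "1 \<le> q" "(1 + \<alpha> + \<beta>) * q = d * (q - 1)" by auto
  have avg: "avg f (dcube k (cidx k x)) = fav f' k x" for k x
    by (rule avg_eq_fav[OF f(1) f_meas f(2)])
  let ?X = "\<lambda>x. \<integral>\<^sup>+ k. ennreal (2 powr (- real_of_int k)) * ennreal (fav f' k x) * indicator {j. (k, j) \<in> Q_alpha \<alpha> f} (cidx k x) \<partial>count_space UNIV"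
  have [measurable]: "(\<lambda>x. indicator {j. (k, j) \<in> Q_alpha \<alpha> f} (cidx k x) :: ennreal) \<in> borel_measurable borel" for k
    by (rule measurable_compose[OF cidx_measurable]) simp
  have term_le: "(2 powr (real_of_int k * (\<alpha> + \<beta>)) * fav f' k x) powr q \<le> B powr (q - 1) * (2 powr (- real_of_int k) * fav f' k x)"
    if kx: "(k, cidx k x) \<in> Q_alpha \<alpha> f" for k x
  proof (cases "fav f' k x = 0")
    case True thus ?thesis by simp
  next
    case False
    hence F: "fav f' k x > 0" using fav_nonneg[of f' k x] by simp
    define s where "s = 2 powr (real_of_int k * (d - 1)) * fav f' k x"
    have s: "s > 0" using F by (simp add: s_def)
    have sB: "s \<le> B" unfolding s_def d_def B_def by (rule L1_modulus_stopping(2)[OF n \<alpha> f L1 kx])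
    have "2 powr (real_of_int k * (\<alpha> + \<beta>)) * fav f' k x = 2 powr (real_of_int k * (1 + \<alpha> + \<beta> - d)) * s"
      unfolding s_def mult.assoc[symmetric] powr_add[symmetric] by (simp add: algebra_simps)
    hence "(2 powr (real_of_int k * (\<alpha> + \<beta>)) * fav f' k x) powr q = 2 powr (real_of_int k * ((1 + \<alpha> + \<beta>) * q - d * q)) * s powr q"
      using s by (simp add: powr_mult powr_powr algebra_simps)
    also have "(1 + \<alpha> + \<beta>) * q - d * q = - d" unfolding q(3) by (simp add: algebra_simps)
    also have "s powr q = s powr (q - 1) * s" using s by (simp add: powr_diff)
    also have "2 powr (real_of_int k * - d) * (s powr (q - 1) * s) = s powr (q - 1) * (2 powr (real_of_int k * - d) * s)" by simp
    also have "2 powr (real_of_int k * - d) * s = 2 powr (- real_of_int k) * fav f' k x"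
      unfolding s_def mult.assoc[symmetric] powr_add[symmetric] by (simp add: algebra_simps)
    also have "s powr (q - 1) * (2 powr (- real_of_int k) * fav f' k x) \<le> B powr (q - 1) * (2 powr (- real_of_int k) * fav f' k x)"
      using s sB q F by (intro mult_right_mono powr_mono2) auto
    finally show ?thesis .
  qed
  have "(\<integral>\<^sup>+ x. epowr (dyadic_max \<alpha> \<beta> f x) q \<partial>lebesgue) = (\<integral>\<^sup>+ x. epowr (dyadic_max \<alpha> \<beta> f x) q \<partial>lborel)"
    by (rule nn_integral_completion)
  also have "\<dots> \<le> (\<integral>\<^sup>+ x. ennreal (B powr (q - 1)) * ?X x \<partial>lborel)"
    using AE_not_in_closure_dcube
  proof (intro nn_integral_mono_AE, eventually_elim)
    fix x :: "real^'n" assume good: "\<forall>k j. x \<in> closure (dcube k j) \<longrightarrow> cidx k x = j"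
    show "epowr (dyadic_max \<alpha> \<beta> f x) q \<le> ennreal (B powr (q - 1)) * ?X x"
    proof (rule epowr_dyadic_max_le)
      show "cidx k x = j" if "x \<in> closure (dcube k j)" for k j using good that by blast
      show "0 \<le> avg f (dcube k (cidx k x))" for k by (simp add: avg fav_nonneg)
      fix k assume kx: "(k, cidx k x) \<in> Q_alpha \<alpha> f"
      have "ennreal ((2 powr (real_of_int k * (\<alpha> + \<beta>)) * fav f' k x) powr q) \<le> ennreal (B powr (q - 1) * (2 powr (- real_of_int k) * fav f' k x))"
        by (rule ennreal_leI[OF term_le[OF kx]])
      also have "\<dots> = ennreal (B powr (q - 1)) * (ennreal (2 powr (- real_of_int k)) * ennreal (fav f' k x) * indicator {j. (k, j) \<in> Q_alpha \<alpha> f} (cidx k x))"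
        using kx by (simp add: ennreal_mult fav_nonneg)
      also have "\<dots> \<le> ennreal (B powr (q - 1)) * ?X x"
        by (intro mult_left_mono le_nn_integral_count_space) simp
      finally show "ennreal ((2 powr (real_of_int k * (\<alpha> + \<beta>)) * avg f (dcube k (cidx k x))) powr q) \<le> ennreal (B powr (q - 1)) * ?X x"
        by (simp add: avg)
    qed (rule q(1))
  qed
  also have "\<dots> = ennreal (B powr (q - 1)) * (\<integral>\<^sup>+ x. ?X x \<partial>lborel)"
  proof (rule nn_integral_cmult)
    show "?X \<in> borel_measurable lborel"
    proof (rule sigma_finite_measure.borel_measurable_nn_integral[OF sigma_finite_measure_count_space_countable])
      show "(\<lambda>(x, k). ennreal (2 powr (- real_of_int k)) * ennreal (fav f' k x) * indicator {j. (k, j) \<in> Q_alpha \<alpha> f} (cidx k x))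
        \<in> borel_measurable (lborel \<Otimes>\<^sub>M count_space UNIV)"
        unfolding split_beta
        by (rule measurable_compose_countable[where g=snd and f="\<lambda>k z. ennreal (2 powr (- real_of_int k)) * ennreal (fav f' k (fst z)) * indicator {j. (k, j) \<in> Q_alpha \<alpha> f} (cidx k (fst z))"]) measurable
    qed simp
  qed
  also have "\<dots> \<le> ennreal (B powr (q - 1)) * ennreal B"
    unfolding B_def by (intro mult_left_mono L1_modulus_stopping(1)[OF n \<alpha> f L1]) simp
  also have "\<dots> = ennreal (B powr q)"
    using B0 by (cases "B = 0") (auto simp: ennreal_mult[symmetric] powr_diff)
  finally have "Lq_enorm q (dyadic_max \<alpha> \<beta> f) \<le> epowr (ennreal (B powr q)) (1 / q)"
    unfolding Lq_enorm_def using q by (intro epowr_mono) auto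
  also have "\<dots> = ennreal B" using B0 q by (simp add: epowr_ennreal powr_powr)
  finally show ?thesis by (simp add: q_def B_def d_def)
qed

text \<open>Here \<alpha> + \<beta> = d - 1, so the terms of the supremum are exactly the quantities
  bounded for single cubes.\<close>

lemma dyadic_max_endpoint_of_L1_modulus:
  fixes f f' :: "real^'n::finite \<Rightarrow> real"
  assumes n: "0 < n" "2 ^ (CARD('n) + 1) * 2 powr (- (real n * \<alpha>)) \<le> 1 / 2" and \<alpha>: "0 < \<alpha>"
    and f: "f \<in> borel_measurable lebesgue" "AE x in lborel. f x = f' x"
    and L1: "L1_modulus f' V"
    and ab: "1 + \<alpha> + \<beta> = real CARD('n)"
  shows "AE x in lebesgue. dyadic_max \<alpha> \<beta> f x \<le> ennreal (2 ^ n * 4 * 2 ^ CARD('n) * real CARD('n) * V)"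
proof (rule AE_completion)
  interpret L1_modulus f' V by (rule L1)
  have avg: "avg f (dcube k (cidx k x)) = fav f' k x" for k x
    by (rule avg_eq_fav[OF f(1) f_meas f(2)])
  have e: "\<alpha> + \<beta> = real CARD('n) - 1" using ab by simp
  show "AE x in lborel. dyadic_max \<alpha> \<beta> f x \<le> ennreal (2 ^ n * 4 * 2 ^ CARD('n) * real CARD('n) * V)"
    using AE_not_in_closure_dcube
  proof eventually_elim
    fix x :: "real^'n" assume good: "\<forall>k j. x \<in> closure (dcube k j) \<longrightarrow> cidx k x = j"
    show "dyadic_max \<alpha> \<beta> f x \<le> ennreal (2 ^ n * 4 * 2 ^ CARD('n) * real CARD('n) * V)"
      by (rule dyadic_max_le) (use good in blast, unfold avg e, rule L1_modulus_stopping(2)[OF n \<alpha> f L1])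
  qed
qed

section \<open>Borel representatives\<close>

lemma BV_Borel_representative:
  fixes f :: "real^'n::finite \<Rightarrow> real"
  assumes "BV f"
  obtains f' V where "AE x in lborel. f x = f' x" "L1_modulus f' V" "total_var f = ennreal V"
proof -
  have fm: "f \<in> borel_measurable lebesgue" and fi: "integrable lebesgue f" and tv: "total_var f < \<infinity>"
    using assms by (auto simp: BV_def)
  obtain f' where f' [measurable]: "f' \<in> borel_measurable borel" and eq: "AE x in lborel. f x = f' x"
    using completion_ex_borel_measurable_real[OF fm] by auto
  have f'l: "f' \<in> borel_measurable lebesgue" by (rule measurable_completion) simp
  have eq': "AE x in lebesgue. f x = f' x" using eq by (rule AE_completion)
  have "integrable lebesgue f'" using fi integrable_cong_AE[OF fm f'l eq'] by simp
  hence f'i: "integrable lborel f'" by (subst (asm) integrable_completion) auto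
  obtain V where V: "total_var f = ennreal V" "V \<ge> 0" using tv by (cases "total_var f") auto
  \<comment> \<open>The divergence of a test field is a sum of derivatives that are again
    differentiable, hence continuous and measurable. So f may be replaced by f' in each
    pairing.\<close>
  have "total_var f' = total_var f"
    unfolding total_var_def
  proof (rule SUP_cong[OF refl])
    fix \<Phi> :: "real^'n \<Rightarrow> real^'n" assume \<Phi>: "\<Phi> \<in> test_fields"
    have "pd i (\<lambda>y. \<Phi> y $ i) \<in> borel_measurable borel" for i
    proof (rule borel_measurable_continuous_onI, rule continuous_at_imp_continuous_on, rule ballI)
      fix x
      have "smooth_fun (\<lambda>y. \<Phi> y $ i)" using \<Phi> by (auto simp: test_fields_def test_fun_def)
      hence "foldr pd [i] (\<lambda>y. \<Phi> y $ i) differentiable (at x)" unfolding smooth_fun_def by blast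
      thus "isCont (pd i (\<lambda>y. \<Phi> y $ i)) x" by (simp add: differentiable_imp_continuous_within)
    qed
    hence "divergence \<Phi> \<in> borel_measurable borel"
      unfolding divergence_def by (intro borel_measurable_sum) auto
    hence div: "divergence \<Phi> \<in> borel_measurable lebesgue" by (intro measurable_completion) simp
    have "(\<integral>x. f' x * divergence \<Phi> x \<partial>lebesgue) = (\<integral>x. f x * divergence \<Phi> x \<partial>lebesgue)"
    proof (rule integral_cong_AE)
      show "AE x in lebesgue. f' x * divergence \<Phi> x = f x * divergence \<Phi> x" using eq' by eventually_elim simp
    qed (use fm f'l div in measurable)
    thus "ennreal (\<integral>x. f' x * divergence \<Phi> x \<partial>lebesgue) = ennreal (\<integral>x. f x * divergence \<Phi> x \<partial>lebesgue)" by simp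
  qed
  hence "L1_modulus f' V"
    unfolding L1_modulus_def using V BV_modulus[OF f'i, of V] f'i by simp
  thus ?thesis using that eq V(1) by blast
qed

text \<open>Pointwise |f| <= 1 + |f|^p, and constants are integrable on balls.\<close>

lemma locally_integrable_if_powr:
  fixes f :: "'a::euclidean_space \<Rightarrow> real"
  assumes [measurable]: "f \<in> borel_measurable borel" and p: "1 \<le> p"
    and fin: "(\<integral>\<^sup>+ x. ennreal (\<bar>f x\<bar> powr p) \<partial>lborel) < \<infinity>"
  shows "locally_integrable f"
  unfolding locally_integrable_def
proof (intro conjI allI)
  show "f \<in> borel_measurable borel" by fact
  have [measurable]: "cball (0::'a) r \<in> sets borel" for r by simp
  fix R
  have pt: "ennreal (norm (f x * indicator (cball 0 R) x)) \<le> indicator (cball 0 R) x + ennreal (\<bar>f x\<bar> powr p)" for x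
  proof (cases "x \<in> cball 0 R")
    case True
    have "\<bar>f x\<bar> \<le> 1 + \<bar>f x\<bar> powr p"
    proof (cases "\<bar>f x\<bar> \<le> 1")
      case False
      hence "\<bar>f x\<bar> powr 1 \<le> \<bar>f x\<bar> powr p" using p by (intro powr_mono) auto
      thus ?thesis by simp
    qed (simp add: add_increasing2)
    hence "ennreal \<bar>f x\<bar> \<le> ennreal (1 + \<bar>f x\<bar> powr p)" by (rule ennreal_leI)
    thus ?thesis using True by simp
  qed simp
  have "(\<integral>\<^sup>+ x. ennreal (norm (f x * indicator (cball 0 R) x)) \<partial>lborel) \<le> (\<integral>\<^sup>+ x. indicator (cball 0 R) x + ennreal (\<bar>f x\<bar> powr p) \<partial>lborel)"
    by (intro nn_integral_mono pt)
  also have "\<dots> = emeasure lborel (cball (0::'a) R) + (\<integral>\<^sup>+ x. ennreal (\<bar>f x\<bar> powr p) \<partial>lborel)"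
    by (subst nn_integral_add) auto
  also have "\<dots> < \<infinity>" using fin emeasure_lborel_cball_finite[of "0::'a" R] by (simp add: ennreal_add_eq_top less_top)
  finally show "integrable lborel (\<lambda>x. f x * indicator (cball 0 R) x)"
    by (intro integrableI_bounded) auto
qed

lemma Lq_enorm_cong_AE:
  fixes u v :: "'a::euclidean_space \<Rightarrow> ennreal"
  assumes "AE x in lborel. u x = v x"
  shows "Lq_enorm p u = epowr (\<integral>\<^sup>+ x. epowr (v x) p \<partial>lborel) (1 / p)"
proof -
  have "(\<integral>\<^sup>+ x. epowr (u x) p \<partial>lebesgue) = (\<integral>\<^sup>+ x. epowr (u x) p \<partial>lborel)" by (rule nn_integral_completion)
  also have "\<dots> = (\<integral>\<^sup>+ x. epowr (v x) p \<partial>lborel)" using assms by (intro nn_integral_cong_AE) auto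
  finally show ?thesis by (simp add: Lq_enorm_def)
qed

lemma sobolev_Borel_representative:
  fixes f :: "real^'n::finite \<Rightarrow> real"
  assumes W: "sobolev_W1p p f g" and p: "1 \<le> p"
  obtains f' and g' :: "real^'n \<Rightarrow> real^'n" and G where "f \<in> borel_measurable lebesgue" "AE x in lborel. f x = f' x" "g' \<in> borel_measurable borel"
    "translate_bound f' (\<lambda>x. ennreal (norm (g' x)))" "0 \<le> G"
    "(\<integral>\<^sup>+ x. ennreal (norm (g' x) powr p) \<partial>lborel) = ennreal (G powr p)"
    "Lq_enorm p (\<lambda>x. ennreal (norm (g x))) = ennreal G" "p = 1 \<Longrightarrow> integrable lborel f'"
proof -
  have fm: "f \<in> borel_measurable lebesgue" and gm: "g \<in> borel_measurable lebesgue"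
    and fL: "Lq_enorm p (\<lambda>x. ennreal \<bar>f x\<bar>) < \<infinity>" and gL: "Lq_enorm p (\<lambda>x. ennreal (norm (g x))) < \<infinity>"
    and wg: "weak_gradient f g" using W by (auto simp: sobolev_W1p_def)
  obtain f' where f' [measurable]: "f' \<in> borel_measurable borel" and eqf: "AE x in lborel. f x = f' x"
    using completion_ex_borel_measurable_real[OF fm] by auto
  have "\<exists>g'. g' \<in> borel_measurable borel \<and> (AE x in lborel. g x $ i = g' x)" for i
  proof -
    have "(\<lambda>x. g x $ i) \<in> borel_measurable lebesgue"
      by (rule measurable_compose[OF gm]) (intro borel_measurable_continuous_onI continuous_intros)
    thus ?thesis using completion_ex_borel_measurable_real by force
  qed
  then obtain gc where gc: "\<And>i. gc i \<in> borel_measurable borel" "\<And>i. AE x in lborel. g x $ i = gc i x" by metis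
  define g' where "g' x = (\<chi> i. gc i x)" for x
  have g'm [measurable]: "g' \<in> borel_measurable borel"
    by (subst borel_measurable_euclidean_space) (use gc(1) in \<open>auto simp: Basis_vec_def inner_axis g'_def\<close>)
  have "AE x in lborel. \<forall>i. g x $ i = gc i x" using gc(2) by (simp add: AE_all_countable)
  hence eqg: "AE x in lborel. g x = g' x" by eventually_elim (simp add: g'_def vec_eq_iff)
  \<comment> \<open>\<open>epowr\<close> keeps infinity, so a finite norm forces a finite integral.
    Writing that integral as G^p makes the norm the plain number G.\<close>
  have root: "\<exists>G\<ge>0. N = ennreal (G powr p) \<and> epowr N (1 / p) = ennreal G" if fin: "epowr N (1 / p) < \<infinity>" for N
  proof -
    have "N \<noteq> \<infinity>" using fin by (auto simp: epowr_def)
    then obtain \<nu> where \<nu>: "N = ennreal \<nu>" "\<nu> \<ge> 0" by (cases N) auto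
    show ?thesis using \<nu> p by (intro exI[of _ "\<nu> powr (1 / p)"]) (simp add: epowr_ennreal powr_powr)
  qed
  have Lf: "Lq_enorm p (\<lambda>x. ennreal \<bar>f x\<bar>) = epowr (\<integral>\<^sup>+ x. ennreal (\<bar>f' x\<bar> powr p) \<partial>lborel) (1 / p)"
  proof -
    have "AE x in lborel. ennreal \<bar>f x\<bar> = ennreal \<bar>f' x\<bar>" using eqf by eventually_elim simp
    from Lq_enorm_cong_AE[OF this, of p] show ?thesis by (simp add: epowr_ennreal)
  qed
  have Lg: "Lq_enorm p (\<lambda>x. ennreal (norm (g x))) = epowr (\<integral>\<^sup>+ x. ennreal (norm (g' x) powr p) \<partial>lborel) (1 / p)"
  proof -
    have "AE x in lborel. ennreal (norm (g x)) = ennreal (norm (g' x))" using eqg by eventually_elim simp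
    from Lq_enorm_cong_AE[OF this, of p] show ?thesis by (simp add: epowr_ennreal)
  qed
  obtain G where G: "G \<ge> 0" "(\<integral>\<^sup>+ x. ennreal (norm (g' x) powr p) \<partial>lborel) = ennreal (G powr p)" "Lq_enorm p (\<lambda>x. ennreal (norm (g x))) = ennreal G"
    using root[OF gL[unfolded Lg]] Lg by auto
  have ffin: "(\<integral>\<^sup>+ x. ennreal (\<bar>f' x\<bar> powr p) \<partial>lborel) < \<infinity>" using root[OF fL[unfolded Lf]] by auto
  have floc: "locally_integrable f'" by (rule locally_integrable_if_powr[OF f' p ffin])
  have g'i [measurable]: "(\<lambda>x. g' x $ i) \<in> borel_measurable borel" for i
    by (rule measurable_compose[OF g'm]) (intro borel_measurable_continuous_onI continuous_intros)
  have gloc: "locally_integrable (\<lambda>x. g' x $ i)" for i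
  proof (rule locally_integrable_if_powr[OF g'i p])
    have "(\<integral>\<^sup>+ x. ennreal (\<bar>g' x $ i\<bar> powr p) \<partial>lborel) \<le> (\<integral>\<^sup>+ x. ennreal (norm (g' x) powr p) \<partial>lborel)"
      using p component_le_norm_cart by (intro nn_integral_mono ennreal_leI powr_mono2) auto
    thus "(\<integral>\<^sup>+ x. ennreal (\<bar>g' x $ i\<bar> powr p) \<partial>lborel) < \<infinity>" using G(2) by (auto simp: less_top[symmetric] top_unique)
  qed
  have weak: "(\<integral>x. f' x * pd i \<phi> x \<partial>lborel) = - (\<integral>x. g' x $ i * \<phi> x \<partial>lborel)" if \<phi>: "bump_test \<phi>" for i \<phi>
  proof -
    have [measurable]: "\<phi> \<in> borel_measurable borel" "pd i \<phi> \<in> borel_measurable borel"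
      using \<phi> by (auto intro: bump_test_measurable bump_test_pd)
    have l: "\<phi> \<in> borel_measurable lebesgue" "pd i \<phi> \<in> borel_measurable lebesgue" "f' \<in> borel_measurable lebesgue" "g' \<in> borel_measurable lebesgue"
      by (rule measurable_completion, simp)+
    have gi: "(\<lambda>x. g x $ i) \<in> borel_measurable lebesgue" "(\<lambda>x. g' x $ i) \<in> borel_measurable lebesgue"
      by (rule measurable_compose[OF gm] measurable_compose[OF l(4)]; intro borel_measurable_continuous_onI continuous_intros)+
    have "(\<integral>x. f x * pd i \<phi> x \<partial>lebesgue) = (\<integral>x. f' x * pd i \<phi> x \<partial>lebesgue)"
    proof (rule integral_cong_AE)
      show "AE x in lebesgue. f x * pd i \<phi> x = f' x * pd i \<phi> x" using AE_completion[OF eqf] by eventually_elim simp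
    qed (use fm l in measurable)
    also have "\<dots> = (\<integral>x. f' x * pd i \<phi> x \<partial>lborel)" by (rule integral_completion) measurable
    finally have 1: "(\<integral>x. f x * pd i \<phi> x \<partial>lebesgue) = (\<integral>x. f' x * pd i \<phi> x \<partial>lborel)" .
    have "(\<integral>x. g x $ i * \<phi> x \<partial>lebesgue) = (\<integral>x. g' x $ i * \<phi> x \<partial>lebesgue)"
    proof (rule integral_cong_AE)
      show "AE x in lebesgue. g x $ i * \<phi> x = g' x $ i * \<phi> x" using AE_completion[OF eqg] by eventually_elim simp
    qed (use gi l in measurable)
    also have "\<dots> = (\<integral>x. g' x $ i * \<phi> x \<partial>lborel)" by (rule integral_completion) measurable
    finally have 2: "(\<integral>x. g x $ i * \<phi> x \<partial>lebesgue) = (\<integral>x. g' x $ i * \<phi> x \<partial>lborel)" .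
    show ?thesis using wg bump_test_test_fun[OF \<phi>] unfolding weak_gradient_def 1[symmetric] 2[symmetric] by blast
  qed
  have tb: "translate_bound f' (\<lambda>x. ennreal (norm (g' x)))"
    unfolding translate_bound_def
    by (intro conjI allI floc sobolev_translate gloc weak) measurable
  have "integrable lborel f'" if "p = 1"
  proof (rule integrableI_bounded)
    show "(\<integral>\<^sup>+ x. ennreal (norm (f' x)) \<partial>lborel) < \<infinity>" using ffin that by simp
  qed measurable
  thus ?thesis using that[OF fm eqf g'm tb G] by blast
qed

section \<open>Gradient estimates for Sobolev functions\<close>

lemma stopping_fav_le_gradient:
  fixes f f' :: "real^'n::finite \<Rightarrow> real"
  assumes \<alpha>: "0 < \<alpha>" and f: "f \<in> borel_measurable lebesgue" "AE x in lborel. f x = f' x"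
    and tb: "translate_bound f' h" and kx: "(k, cidx k x) \<in> Q_alpha \<alpha> f"
    and t: "dav (k + 1) h x = ennreal t" "0 \<le> t"
  shows "fav f' k x \<le> 2 * 4 ^ CARD('n) * real CARD('n) / (1 - 2 powr (- \<alpha>)) * 2 powr real_of_int k * t"
proof -
  interpret translate_bound f' h by (rule tb)
  have avg: "avg f (dcube k (cidx k x)) = fav f' k x" for k x
    by (rule avg_eq_fav[OF f(1) f_meas f(2)])
  let ?c = "2 * 4 ^ CARD('n) * real CARD('n) * 2 powr real_of_int k"
  have q: "0 < 1 - 2 powr (- \<alpha>)" using \<alpha> by (simp add: powr_less_one)
  \<comment> \<open>The mean over the parent is at most 2^(-\<alpha>) times that over the selected
    cube, so it is absorbed into the left-hand side. Here \<alpha> > 0 enters, through 1 -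
    2^(-\<alpha>) > 0.\<close>
  have par: "fav f' (k + 1) x \<le> 2 powr (- \<alpha>) * fav f' k x"
    using Q_alpha_avg_le[OF kx, of "k + 1"] by (simp add: avg)
  have "ennreal (fav f' k x) \<le> ennreal (fav f' (k+1) x) + ennreal ?c * ennreal t"
    using fav_le_parent[of k x] by (simp only: t(1))
  also have "\<dots> = ennreal (fav f' (k+1) x + ?c * t)"
    using t(2) by (simp add: ennreal_mult fav_nonneg)
  finally have "fav f' k x \<le> fav f' (k+1) x + ?c * t"
    using t(2) by (subst (asm) ennreal_le_iff) (auto intro!: add_nonneg_nonneg fav_nonneg)
  hence "(1 - 2 powr (- \<alpha>)) * fav f' k x \<le> ?c * t" using par by (simp add: left_diff_distrib)
  hence "fav f' k x \<le> ?c * t / (1 - 2 powr (- \<alpha>))" using q by (simp add: pos_le_divide_eq mult.commute)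
  thus ?thesis by simp
qed

text \<open>Hoelder bounds the mean of the gradient over the parent by a multiple of 2^(-(k+1) d /
  p) G, and d / p = 1 + \<alpha> + \<beta> makes the powers of 2^k cancel. The bound holds for each
  cube separately, so p = 1 is covered too.\<close>

lemma sobolev_endpoint:
  fixes f f' :: "real^'n::finite \<Rightarrow> real" and g' :: "real^'n \<Rightarrow> real^'n"
  assumes \<alpha>: "0 < \<alpha>" and f: "f \<in> borel_measurable lebesgue" "AE x in lborel. f x = f' x"
    and [measurable]: "g' \<in> borel_measurable borel" and tb: "translate_bound f' (\<lambda>x. ennreal (norm (g' x)))"
    and G: "0 \<le> G" "(\<integral>\<^sup>+ x. ennreal (norm (g' x) powr p) \<partial>lborel) = ennreal (G powr p)"
    and p: "1 \<le> p" "p = real CARD('n) / (1 + \<alpha> + \<beta>)"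
  shows "AE x in lebesgue. dyadic_max \<alpha> \<beta> f x \<le> ennreal (2 * (2 * 4 ^ CARD('n) * real CARD('n) / (1 - 2 powr (- \<alpha>))) * G)"
proof (rule AE_completion)
  interpret translate_bound f' "\<lambda>x. ennreal (norm (g' x))" by (rule tb)
  have avg: "avg f (dcube k (cidx k x)) = fav f' k x" for k x
    by (rule avg_eq_fav[OF f(1) f_meas f(2)])
  define C where "C = 2 * 4 ^ CARD('n) * real CARD('n) / (1 - 2 powr (- \<alpha>))"
  have C: "0 \<le> C" unfolding C_def using \<alpha> by (simp add: powr_less_one less_imp_le)
  define a where "a = 1 + \<alpha> + \<beta>"
  \<comment> \<open>Division by 0 gives 0 and a negative denominator gives a negative quotient; p >=
    1 excludes both.\<close>
  have a: "a > 0" "real CARD('n) / p = a"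
  proof -
    have "a \<noteq> 0" using p by (auto simp: a_def)
    show "a > 0"
    proof (rule ccontr)
      assume "\<not> 0 < a"
      hence "real CARD('n) / a \<le> 0" by (simp add: divide_le_0_iff)
      thus False using p by (simp add: a_def)
    qed
    thus "real CARD('n) / p = a" unfolding p(2) a_def[symmetric] by simp
  qed
  have bound: "2 powr (real_of_int k * (\<alpha> + \<beta>)) * avg f (dcube k (cidx k x)) \<le> 2 * C * G"
    if kx: "(k, cidx k x) \<in> Q_alpha \<alpha> f" for k x
  proof -
    let ?D = "dav (k + 1) (\<lambda>y. ennreal (norm (g' y))) x"
    have Dle: "?D \<le> ennreal (2 * 2 powr (- (real_of_int (k + 1) * a)) * G)"
    proof -
      have "real_of_int (k + 1) * real CARD('n) / p = real_of_int (k + 1) * a"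
        by (simp only: times_divide_eq_right[symmetric] a(2))
      thus ?thesis using dav_holder[of "\<lambda>y. norm (g' y)" p G "k + 1" x] p(1) G by simp
    qed
    then obtain t where t: "?D = ennreal t" "0 \<le> t" by (cases ?D) (auto simp: top_unique)
    have tle: "t \<le> 2 * 2 powr (- (real_of_int (k + 1) * a)) * G"
      using Dle G unfolding t(1) by (subst (asm) ennreal_le_iff) auto
    have "fav f' k x \<le> C * 2 powr real_of_int k * t"
      unfolding C_def by (rule stopping_fav_le_gradient[OF \<alpha> f tb kx t])
    also have "\<dots> \<le> C * 2 powr real_of_int k * (2 * 2 powr (- (real_of_int (k + 1) * a)) * G)"
      using C tle by (intro mult_left_mono) auto
    finally have "2 powr (real_of_int k * (\<alpha> + \<beta>)) * fav f' k x \<le> 2 powr (real_of_int k * (\<alpha> + \<beta>)) * (C * 2 powr real_of_int k * (2 * 2 powr (- (real_of_int (k + 1) * a)) * G))"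
      by (rule mult_left_mono) simp
    also have "\<dots> = 2 * C * G * (2 powr (real_of_int k * (\<alpha> + \<beta>)) * 2 powr real_of_int k * 2 powr (- (real_of_int (k + 1) * a)))"
      by (simp only: mult_ac)
    also have "2 powr (real_of_int k * (\<alpha> + \<beta>)) * 2 powr real_of_int k * 2 powr (- (real_of_int (k + 1) * a)) = 2 powr (- a)"
      unfolding powr_add[symmetric] by (simp add: a_def algebra_simps)
    also have "2 * C * G * 2 powr (- a) \<le> 2 * C * G * 1"
    proof (rule mult_left_mono)
      show "2 powr (- a) \<le> 1" using a powr_mono[of "- a" 0 2] by simp
    qed (use C G in auto)
    finally show ?thesis by (simp add: avg)
  qed
  show "AE x in lborel. dyadic_max \<alpha> \<beta> f x \<le> ennreal (2 * (2 * 4 ^ CARD('n) * real CARD('n) / (1 - 2 powr (- \<alpha>))) * G)"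
    unfolding C_def[symmetric] using AE_not_in_closure_dcube
  proof eventually_elim
    fix x :: "real^'n" assume good: "\<forall>k j. x \<in> closure (dcube k j) \<longrightarrow> cidx k x = j"
    show "dyadic_max \<alpha> \<beta> f x \<le> ennreal (2 * C * G)"
      by (rule dyadic_max_le) (use good in blast, rule bound)
  qed
qed

text \<open>Hedberg's splitting: for the mean t of the gradient over the parent write t^q = t^(q-p)
  t^p. Hoelder bounds the first factor, and a q = d (q - p) / p makes its power of 2^k cancel that
  of the term. The factor t^p is left to the dyadic maximal theorem.\<close>

lemma sobolev_subcritical:
  fixes f f' :: "real^'n::finite \<Rightarrow> real" and g' :: "real^'n \<Rightarrow> real^'n"
  assumes \<alpha>: "0 < \<alpha>" and f: "f \<in> borel_measurable lebesgue" "AE x in lborel. f x = f' x"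
    and [measurable]: "g' \<in> borel_measurable borel" and tb: "translate_bound f' (\<lambda>x. ennreal (norm (g' x)))"
    and G: "0 \<le> G" "(\<integral>\<^sup>+ x. ennreal (norm (g' x) powr p) \<partial>lborel) = ennreal (G powr p)"
    and p: "1 < p" "0 \<le> \<alpha> + \<beta> + 1" "\<alpha> + \<beta> + 1 < real CARD('n) / p"
  defines "q \<equiv> 1 / (1 / p - (1 + \<alpha> + \<beta>) / real CARD('n))"
  defines "C \<equiv> 2 * 4 ^ CARD('n) * real CARD('n) / (1 - 2 powr (- \<alpha>))"
  defines "M \<equiv> 4 powr p * 2 / (1 - 2 powr (- (p - 1)))"
  shows "Lq_enorm q (dyadic_max \<alpha> \<beta> f) \<le> ennreal ((C powr q * 2 powr (q - p) * M) powr (1 / q)) * ennreal G"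
proof -
  interpret translate_bound f' "\<lambda>x. ennreal (norm (g' x))" by (rule tb)
  have avg: "avg f (dcube k (cidx k x)) = fav f' k x" for k x
    by (rule avg_eq_fav[OF f(1) f_meas f(2)])
  have C: "0 \<le> C" unfolding C_def using \<alpha> by (simp add: powr_less_one less_imp_le)
  have M: "0 \<le> M" unfolding M_def using p by (simp add: powr_less_one less_imp_le)
  define d where "d = real CARD('n)"
  define a where "a = 1 + \<alpha> + \<beta>"
  have d: "d > 0" by (simp add: d_def)
  have q: "0 < q" "p \<le> q" "a * q = d * (q - p) / p"
    using exponent_identity[of d p a] d p by (simp_all add: q_def d_def a_def add.commute add.left_commute)
  let ?h = "\<lambda>y. ennreal (norm (g' y))"
  let ?S = "\<lambda>x. SUP k. ennreal (enn2real (dav k ?h x) powr p)"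
  have bound: "(2 powr (real_of_int k * (\<alpha> + \<beta>)) * fav f' k x) powr q \<le> C powr q * (2 * G) powr (q - p) * enn2real (dav (k + 1) ?h x) powr p"
    if kx: "(k, cidx k x) \<in> Q_alpha \<alpha> f" for k x
  proof -
    let ?D = "dav (k + 1) ?h x"
    have Dle: "?D \<le> ennreal (2 * 2 powr (- (real_of_int (k + 1) * d / p)) * G)"
      using dav_holder[of "\<lambda>y. norm (g' y)" p G "k + 1" x] p G unfolding d_def by simp
    then obtain t where t: "?D = ennreal t" "0 \<le> t" by (cases ?D) (auto simp: top_unique)
    have tle: "t \<le> 2 * 2 powr (- (real_of_int (k + 1) * d / p)) * G"
      using Dle G unfolding t(1) by (subst (asm) ennreal_le_iff) auto
    have fle: "fav f' k x \<le> C * 2 powr real_of_int k * t"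
      unfolding C_def by (rule stopping_fav_le_gradient[OF \<alpha> f tb kx t])
    show ?thesis
    proof (cases "t = 0")
      case True
      hence "fav f' k x = 0" using fle fav_nonneg[of f' k x] by simp
      thus ?thesis by (simp add: t True)
    next
      case False
      hence t0: "t > 0" using t by simp
      \<comment> \<open>The scale k + 1 of the parent is weakened to k, so that the powers of 2^k
        cancel exactly.\<close>
      have "2 powr (- (real_of_int (k + 1) * d / p)) \<le> 2 powr (- (real_of_int k * d / p))"
        using d p by (intro powr_mono) (auto simp: divide_right_mono ring_distribs)
      hence "2 * G * 2 powr (- (real_of_int (k + 1) * d / p)) \<le> 2 * G * 2 powr (- (real_of_int k * d / p))"
        using G(1) by (intro mult_left_mono) auto
      hence tle2: "t \<le> 2 * G * 2 powr (- (real_of_int k * d / p))" using tle by (simp only: mult_ac)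
      have "2 powr (real_of_int k * (\<alpha> + \<beta>)) * fav f' k x \<le> 2 powr (real_of_int k * (\<alpha> + \<beta>)) * (C * 2 powr real_of_int k * t)"
        using fle by (rule mult_left_mono) simp
      also have "\<dots> = C * (2 powr (real_of_int k * a) * t)"
        unfolding a_def by (simp add: powr_add ring_distribs mult_ac)
      finally have "(2 powr (real_of_int k * (\<alpha> + \<beta>)) * fav f' k x) powr q \<le> (C * (2 powr (real_of_int k * a) * t)) powr q"
        using q by (intro powr_mono2) (auto simp: fav_nonneg)
      also have "\<dots> = C powr q * (2 powr (real_of_int k * (a * q)) * t powr q)"
        using C t0 by (simp add: powr_mult powr_powr mult.assoc)
      also have "\<dots> = C powr q * (2 powr (real_of_int k * (a * q)) * (t powr (q - p) * t powr p))"
        unfolding powr_add[symmetric] by simp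
      also have "\<dots> \<le> C powr q * (2 powr (real_of_int k * (a * q)) * ((2 * G * 2 powr (- (real_of_int k * d / p))) powr (q - p) * t powr p))"
        using tle2 t0 q by (intro mult_left_mono mult_right_mono powr_mono2) auto
      also have "(2 * G * 2 powr (- (real_of_int k * d / p))) powr (q - p) = (2 * G) powr (q - p) * 2 powr (- (real_of_int k * (a * q)))"
        unfolding q(3) using G by (simp add: powr_mult powr_powr mult_ac)
      also have "C powr q * (2 powr (real_of_int k * (a * q)) * ((2 * G) powr (q - p) * 2 powr (- (real_of_int k * (a * q))) * t powr p))
         = C powr q * (2 * G) powr (q - p) * t powr p * (2 powr (real_of_int k * (a * q)) * 2 powr (- (real_of_int k * (a * q))))"
        by (simp only: mult_ac)
      also have "2 powr (real_of_int k * (a * q)) * 2 powr (- (real_of_int k * (a * q))) = 1"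
        unfolding powr_add[symmetric] by simp
      finally show ?thesis using t by simp
    qed
  qed
  have "(\<integral>\<^sup>+ x. epowr (dyadic_max \<alpha> \<beta> f x) q \<partial>lebesgue) = (\<integral>\<^sup>+ x. epowr (dyadic_max \<alpha> \<beta> f x) q \<partial>lborel)"
    by (rule nn_integral_completion)
  also have "\<dots> \<le> (\<integral>\<^sup>+ x. ennreal (C powr q * (2 * G) powr (q - p)) * ?S x \<partial>lborel)"
    using AE_not_in_closure_dcube
  proof (intro nn_integral_mono_AE, eventually_elim)
    fix x :: "real^'n" assume good: "\<forall>k j. x \<in> closure (dcube k j) \<longrightarrow> cidx k x = j"
    show "epowr (dyadic_max \<alpha> \<beta> f x) q \<le> ennreal (C powr q * (2 * G) powr (q - p)) * ?S x"
    proof (rule epowr_dyadic_max_le)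
      show "cidx k x = j" if "x \<in> closure (dcube k j)" for k j using good that by blast
      show "0 \<le> avg f (dcube k (cidx k x))" for k by (simp add: avg fav_nonneg)
      fix k assume kx: "(k, cidx k x) \<in> Q_alpha \<alpha> f"
      have "ennreal ((2 powr (real_of_int k * (\<alpha> + \<beta>)) * fav f' k x) powr q) \<le> ennreal (C powr q * (2 * G) powr (q - p) * enn2real (dav (k + 1) ?h x) powr p)"
        by (rule ennreal_leI[OF bound[OF kx]])
      also have "\<dots> = ennreal (C powr q * (2 * G) powr (q - p)) * ennreal (enn2real (dav (k + 1) ?h x) powr p)"
        by (rule ennreal_mult) auto
      also have "\<dots> \<le> ennreal (C powr q * (2 * G) powr (q - p)) * ?S x"
        by (intro mult_left_mono SUP_upper) auto
      finally show "ennreal ((2 powr (real_of_int k * (\<alpha> + \<beta>)) * avg f (dcube k (cidx k x))) powr q) \<le> ennreal (C powr q * (2 * G) powr (q - p)) * ?S x"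
        by (simp add: avg)
    qed (rule q(1))
  qed
  also have "\<dots> = ennreal (C powr q * (2 * G) powr (q - p)) * (\<integral>\<^sup>+ x. ?S x \<partial>lborel)"
    by (rule nn_integral_cmult) measurable
  also have "\<dots> \<le> ennreal (C powr q * (2 * G) powr (q - p)) * (ennreal M * ennreal (G powr p))"
    unfolding M_def G(2)[symmetric]
    by (intro mult_left_mono dyadic_maximal_strong_type) (use p in auto)
  also have "\<dots> = ennreal (C powr q * (2 * G) powr (q - p) * (M * G powr p))"
    using M by (simp add: ennreal_mult)
  also have "C powr q * (2 * G) powr (q - p) * (M * G powr p) = C powr q * 2 powr (q - p) * M * G powr q"
  proof (cases "G = 0")
    case False
    have "(2 * G) powr (q - p) = 2 powr (q - p) * G powr (q - p)" using G by (simp add: powr_mult)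
    moreover have "G powr (q - p) * G powr p = G powr q" unfolding powr_add[symmetric] by simp
    ultimately show ?thesis by (simp add: mult_ac)
  qed simp
  finally have "Lq_enorm q (dyadic_max \<alpha> \<beta> f) \<le> epowr (ennreal (C powr q * 2 powr (q - p) * M * G powr q)) (1 / q)"
    unfolding Lq_enorm_def using q by (intro epowr_mono) auto
  also have "\<dots> = ennreal ((C powr q * 2 powr (q - p) * M * G powr q) powr (1 / q))"
    using M by (simp add: epowr_ennreal)
  also have "(C powr q * 2 powr (q - p) * M * G powr q) powr (1 / q) = (C powr q * 2 powr (q - p) * M) powr (1 / q) * G"
    using M G q by (subst powr_mult) (auto simp: powr_powr)
  finally show ?thesis using G by (simp add: ennreal_mult)
qed

theorem theorem1p3:
  fixes \<alpha> \<beta> :: real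
  assumes "0 < \<alpha>" and "\<alpha> < real CARD('n::finite)"
  shows
   "(\<forall>p::real. 1 \<le> p \<and> 0 \<le> \<alpha> + \<beta> + 1 \<and> \<alpha> + \<beta> + 1 < real CARD('n) / p \<longrightarrow>
      (\<exists>C::real. \<forall>(f :: real^'n \<Rightarrow> real) g. sobolev_W1p p f g \<longrightarrow>
         Lq_enorm (1 / (1 / p - (1 + \<alpha> + \<beta>) / real CARD('n))) (dyadic_max \<alpha> \<beta> f)
           \<le> ennreal C * Lq_enorm p (\<lambda>x. ennreal (norm (g x))))) \<and>
    (0 \<le> \<alpha> + \<beta> + 1 \<and> \<alpha> + \<beta> + 1 < real CARD('n) \<longrightarrow>
      (\<exists>C::real. \<forall>f :: real^'n \<Rightarrow> real. BV f \<longrightarrow>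
         Lq_enorm (1 / (1 - (1 + \<alpha> + \<beta>) / real CARD('n))) (dyadic_max \<alpha> \<beta> f)
           \<le> ennreal C * total_var f)) \<and>
    (\<forall>p::real. 1 \<le> p \<and> p = real CARD('n) / (1 + \<alpha> + \<beta>) \<longrightarrow>
      (\<exists>C::real. \<forall>(f :: real^'n \<Rightarrow> real) g. sobolev_W1p p f g \<longrightarrow>
         (AE x in lebesgue. dyadic_max \<alpha> \<beta> f x
            \<le> ennreal C * Lq_enorm p (\<lambda>x. ennreal (norm (g x)))))) \<and>
    (1 + \<alpha> + \<beta> = real CARD('n) \<longrightarrow>
      (\<exists>C::real. \<forall>f :: real^'n \<Rightarrow> real. BV f \<longrightarrow>
         (AE x in lebesgue. dyadic_max \<alpha> \<beta> f x \<le> ennreal C * total_var f)))"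
proof -
  note \<alpha> = assms(1)
  obtain n :: nat where n: "0 < n" "2 ^ (CARD('n) + 1) * 2 powr (- (real n * \<alpha>)) \<le> 1 / 2"
    using ex_stopping_gap[OF \<alpha>] .
  define K where "K = (2 ^ n * 4 * 2 ^ CARD('n) * real CARD('n) :: real)"
  have KV: "ennreal (K * V) = ennreal K * ennreal V" if "V \<ge> 0" for V
    using that by (simp add: K_def ennreal_mult)
  have sub1: "\<exists>C::real. \<forall>(f :: real^'n \<Rightarrow> real) g. sobolev_W1p p f g \<longrightarrow>
         Lq_enorm (1 / (1 / p - (1 + \<alpha> + \<beta>) / real CARD('n))) (dyadic_max \<alpha> \<beta> f)
           \<le> ennreal C * Lq_enorm p (\<lambda>x. ennreal (norm (g x)))"
    if p: "1 \<le> p" "0 \<le> \<alpha> + \<beta> + 1" "\<alpha> + \<beta> + 1 < real CARD('n) / p" for p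
  \<comment> \<open>The maximal theorem requires p > 1. At p = 1 the function is instead treated by
    the layer argument, with the L1 norm G of its gradient as V.\<close>
  proof (cases "p = 1")
    case True
    show ?thesis
    proof (intro exI[of _ K] allI impI)
      fix f :: "real^'n \<Rightarrow> real" and g assume W: "sobolev_W1p p f g"
      obtain f' and g' :: "real^'n \<Rightarrow> real^'n" and G where *: "f \<in> borel_measurable lebesgue" "AE x in lborel. f x = f' x" "g' \<in> borel_measurable borel"
        "translate_bound f' (\<lambda>x. ennreal (norm (g' x)))" "0 \<le> G"
        "(\<integral>\<^sup>+ x. ennreal (norm (g' x) powr p) \<partial>lborel) = ennreal (G powr p)"
        "Lq_enorm p (\<lambda>x. ennreal (norm (g x))) = ennreal G" "p = 1 \<Longrightarrow> integrable lborel f'"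
        using sobolev_Borel_representative[OF W p(1)] by blast
      have "L1_modulus f' G"
      proof
        show "integrable lborel f'" using * True by blast
        show "(\<integral>\<^sup>+ x. ennreal \<bar>f' (x + w) - f' x\<bar> \<partial>lborel) \<le> ennreal (norm w * G)" for w
          using translate_bound.nn_integral_translate_le[OF *(4), of w] *(5,6) True by (simp add: ennreal_mult)
      qed (rule *(5))
      from dyadic_max_Lq_of_L1_modulus[OF n \<alpha> *(1,2) this p(2)] p(3) True *(5,7)
      show "Lq_enorm (1 / (1 / p - (1 + \<alpha> + \<beta>) / real CARD('n))) (dyadic_max \<alpha> \<beta> f)
           \<le> ennreal K * Lq_enorm p (\<lambda>x. ennreal (norm (g x)))"
        by (simp add: K_def[symmetric] KV)
    qed
  next
    case False
    hence p1: "1 < p" using p by simp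
    show ?thesis
    \<comment> \<open>The witness stays schematic until the bound of
      \<open>sobolev_subcritical\<close> instantiates it. It is introduced before f and g and cannot
      depend on them.\<close>
    proof (intro exI allI impI)
      fix f :: "real^'n \<Rightarrow> real" and g assume W: "sobolev_W1p p f g"
      obtain f' and g' :: "real^'n \<Rightarrow> real^'n" and G where *: "f \<in> borel_measurable lebesgue" "AE x in lborel. f x = f' x" "g' \<in> borel_measurable borel"
        "translate_bound f' (\<lambda>x. ennreal (norm (g' x)))" "0 \<le> G"
        "(\<integral>\<^sup>+ x. ennreal (norm (g' x) powr p) \<partial>lborel) = ennreal (G powr p)"
        "Lq_enorm p (\<lambda>x. ennreal (norm (g x))) = ennreal G" "p = 1 \<Longrightarrow> integrable lborel f'"
        using sobolev_Borel_representative[OF W p(1)] by blast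
      show "Lq_enorm (1 / (1 / p - (1 + \<alpha> + \<beta>) / real CARD('n))) (dyadic_max \<alpha> \<beta> f) \<le>
        ennreal (((2 * 4 ^ CARD('n) * real CARD('n) / (1 - 2 powr (- \<alpha>))) powr (1 / (1 / p - (1 + \<alpha> + \<beta>) / real CARD('n))) *
          2 powr (1 / (1 / p - (1 + \<alpha> + \<beta>) / real CARD('n)) - p) * (4 powr p * 2 / (1 - 2 powr (- (p - 1))))) powr
          (1 / (1 / (1 / p - (1 + \<alpha> + \<beta>) / real CARD('n))))) * Lq_enorm p (\<lambda>x. ennreal (norm (g x)))"
        unfolding *(7) by (rule sobolev_subcritical[OF \<alpha> *(1-6) p1 p(2,3)])
    qed
  qed
  have sub2: "\<exists>C::real. \<forall>f :: real^'n \<Rightarrow> real. BV f \<longrightarrow>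
         Lq_enorm (1 / (1 - (1 + \<alpha> + \<beta>) / real CARD('n))) (dyadic_max \<alpha> \<beta> f) \<le> ennreal C * total_var f"
    if p: "0 \<le> \<alpha> + \<beta> + 1" "\<alpha> + \<beta> + 1 < real CARD('n)"
  proof (intro exI[of _ K] allI impI)
    fix f :: "real^'n \<Rightarrow> real" assume f: "BV f"
    obtain f' V where *: "AE x in lborel. f x = f' x" "L1_modulus f' V" "total_var f = ennreal V"
      using BV_Borel_representative[OF f] .
    have "f \<in> borel_measurable lebesgue" using f by (simp add: BV_def)
    from dyadic_max_Lq_of_L1_modulus[OF n \<alpha> this *(1,2) p] L1_modulus.V_nonneg[OF *(2)]
    show "Lq_enorm (1 / (1 - (1 + \<alpha> + \<beta>) / real CARD('n))) (dyadic_max \<alpha> \<beta> f) \<le> ennreal K * total_var f"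
      by (simp add: K_def[symmetric] KV *(3))
  qed
  have sub3: "\<exists>C::real. \<forall>(f :: real^'n \<Rightarrow> real) g. sobolev_W1p p f g \<longrightarrow>
         (AE x in lebesgue. dyadic_max \<alpha> \<beta> f x \<le> ennreal C * Lq_enorm p (\<lambda>x. ennreal (norm (g x))))"
    if p: "1 \<le> p" "p = real CARD('n) / (1 + \<alpha> + \<beta>)" for p
  proof (intro exI allI impI)
    fix f :: "real^'n \<Rightarrow> real" and g assume W: "sobolev_W1p p f g"
    obtain f' and g' :: "real^'n \<Rightarrow> real^'n" and G where *: "f \<in> borel_measurable lebesgue" "AE x in lborel. f x = f' x" "g' \<in> borel_measurable borel"
      "translate_bound f' (\<lambda>x. ennreal (norm (g' x)))" "0 \<le> G"
      "(\<integral>\<^sup>+ x. ennreal (norm (g' x) powr p) \<partial>lborel) = ennreal (G powr p)"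
      "Lq_enorm p (\<lambda>x. ennreal (norm (g x))) = ennreal G" "p = 1 \<Longrightarrow> integrable lborel f'"
      using sobolev_Borel_representative[OF W p(1)] by blast
    have "0 \<le> 2 * (2 * 4 ^ CARD('n) * real CARD('n) / (1 - 2 powr (- \<alpha>)))"
      using \<alpha> by (simp add: powr_less_one less_imp_le)
    hence "ennreal (2 * (2 * 4 ^ CARD('n) * real CARD('n) / (1 - 2 powr (- \<alpha>))) * G) =
        ennreal (2 * (2 * 4 ^ CARD('n) * real CARD('n) / (1 - 2 powr (- \<alpha>)))) * ennreal G"
      using *(5) by (rule ennreal_mult)
    with sobolev_endpoint[OF \<alpha> *(1-6) p]
    show "AE x in lebesgue. dyadic_max \<alpha> \<beta> f x \<le>
        ennreal (2 * (2 * 4 ^ CARD('n) * real CARD('n) / (1 - 2 powr (- \<alpha>)))) * Lq_enorm p (\<lambda>x. ennreal (norm (g x)))"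
      unfolding *(7) by (simp only:)
  qed
  \<comment> \<open>A BV function need not have a gradient function to average over the parent, so
    its endpoint comes from the single-cube bound of the layer argument.\<close>
  have sub4: "\<exists>C::real. \<forall>f :: real^'n \<Rightarrow> real. BV f \<longrightarrow> (AE x in lebesgue. dyadic_max \<alpha> \<beta> f x \<le> ennreal C * total_var f)"
    if p: "1 + \<alpha> + \<beta> = real CARD('n)"
  proof (intro exI[of _ K] allI impI)
    fix f :: "real^'n \<Rightarrow> real" assume f: "BV f"
    obtain f' V where *: "AE x in lborel. f x = f' x" "L1_modulus f' V" "total_var f = ennreal V"
      using BV_Borel_representative[OF f] .
    have "f \<in> borel_measurable lebesgue" using f by (simp add: BV_def)
    from dyadic_max_endpoint_of_L1_modulus[OF n \<alpha> this *(1,2) p] L1_modulus.V_nonneg[OF *(2)]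
    show "AE x in lebesgue. dyadic_max \<alpha> \<beta> f x \<le> ennreal K * total_var f"
      by (simp add: K_def[symmetric] KV *(3))
  qed
  show ?thesis using sub1 sub2 sub3 sub4 by blast
qed

end
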